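(* Let $n\ge 3$, let $\Omega\subset\mathbb{R}^n$ be a bounded domain, and let $1<p<n$. Let $q$ satisfy $q>1$ and $q\ge \frac{np}{np-n+p}$. (i) Suppose $q<\frac{n}{p}$. For every $r$ with $1\le r<\frac{(p-1)qn}{n-pq}$ there is a constant $C$, independent of $f$ and $u$, such that for every $f\in L^q(\Omega)$ and every weak solution $u$ of the Dirichlet problem $$-\mathrm{div}(|\nabla u|^{p-2}\nabla u)=f \ \text{ in }\Omega,\qquad u=0\ \text{ on }\partial\Omega, \qquad ( * )$$ one has $u\in L^r(\Omega)$ and $$\|u\|_{L^r(\Omega)}\le C\,\|f\|_{L^q(\Omega)}^{\frac{1}{p-1}}.$$ (ii) Suppose $q<\frac{n}{p}$. For every finite $r>\frac{(p-1)qn}{n-pq}$ there exist $f\in L^q(\Omega)$ and a weak solution $u$ of $( * )$ with this $f$ such that $u\notin L^r(\Omega)$. (iii) Suppose $q=\frac{n}{p}$. For every $r$ with $1\le r<\infty$ there is a constant $C$, independent of $f$ and $u$, such that for every $f\in L^q(\Omega)$ and every weak solution $u$ of $( * )$ one has $u\in L^r(\Omega)$ and $\|u\|_{L^r(\Omega)}\le C\,\|f\|_{L^q(\Omega)}^{\frac{1}{p-1}}$.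
   Context: $W^{1,p}_0(\Omega)$ is the usual Sobolev space of weakly differentiable functions vanishing on $\partial\Omega$ with weak derivatives in $L^p(\Omega)$ (the closure of $C_0^\infty(\Omega)$ in the $W^{1,p}$ norm). A weak solution of the Dirichlet problem $-\mathrm{div}(|\nabla u|^{p-2}\nabla u)=f$ in $\Omega$, $u=0$ on $\partial\Omega$, is a function $u\in W^{1,p}_0(\Omega)$ such that $$\int_\Omega|\nabla u|^{p-2}\nabla u\cdot\nabla\varphi\,dx=\int_\Omega f\varphi\,dx$$ for every $\varphi\in C_0^\infty(\Omega)$ (equivalently, under the assumption $q\ge\frac{np}{np-n+p}$ on $f\in L^q(\Omega)$, for every $\varphi\in W^{1,p}_0(\Omega)$). *)

theory Defs
  imports "HOL-Analysis.Analysis"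
begin

text \<open>Lebesgue spaces. Elements are functions on the whole space, of which only the
  restriction to \<open>\<Omega>\<close> matters, and are not identified almost everywhere.
  \<open>Lp_norm\<close> is meaningful only on members of \<open>Lp\<close>, because the Bochner
  integral of a non-integrable function is 0.\<close>

definition Lp :: "real \<Rightarrow> 'a::euclidean_space set \<Rightarrow> ('a \<Rightarrow> 'b::euclidean_space) set" where
  "Lp p \<Omega> = {f. f \<in> borel_measurable (lebesgue_on \<Omega>) \<and>
                 integrable (lebesgue_on \<Omega>) (\<lambda>x. norm (f x) powr p)}"

definition Lp_norm :: "real \<Rightarrow> 'a::euclidean_space set \<Rightarrow> ('a \<Rightarrow> 'b::euclidean_space) \<Rightarrow> real" where
  "Lp_norm p \<Omega> f = (LINT x|lebesgue_on \<Omega>. norm (f x) powr p) powr (1 / p)"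

definition locally_integrable_on :: "('a::euclidean_space \<Rightarrow> 'b::euclidean_space) \<Rightarrow> 'a set \<Rightarrow> bool"
    (infix "locally'_integrable'_on" 50) where
  "f locally_integrable_on \<Omega> \<longleftrightarrow>
     (\<forall>K. compact K \<and> K \<subseteq> \<Omega> \<longrightarrow> integrable (lebesgue_on K) f)"

text \<open>Functions of class \<open>C\<^sup>k\<close> on the whole space, by iterated partial derivatives.\<close>

primrec Ck :: "nat \<Rightarrow> ('a::euclidean_space \<Rightarrow> real) \<Rightarrow> bool" where
  "Ck 0 f \<longleftrightarrow> continuous_on UNIV f"
| "Ck (Suc k) f \<longleftrightarrow> f differentiable_on UNIV \<and>
     (\<forall>b\<in>Basis. Ck k (\<lambda>x. frechet_derivative f (at x) b))"

definition test_functions :: "'a::euclidean_space set \<Rightarrow> ('a \<Rightarrow> real) set" where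
  "test_functions \<Omega> = {\<phi>. (\<forall>k. Ck k \<phi>) \<and>
     compact (closure {x. \<phi> x \<noteq> 0}) \<and> closure {x. \<phi> x \<noteq> 0} \<subseteq> \<Omega>}"

definition grad :: "('a::euclidean_space \<Rightarrow> real) \<Rightarrow> 'a \<Rightarrow> 'a" where
  "grad \<phi> x = (\<Sum>b\<in>Basis. frechet_derivative \<phi> (at x) b *\<^sub>R b)"

text \<open>The defining identity is vector valued; its component along a basis vector \<open>b\<close> is the
  usual integration by parts formula for the weak partial derivative in direction \<open>b\<close>.\<close>

definition has_weak_gradient ::
    "'a::euclidean_space set \<Rightarrow> ('a \<Rightarrow> real) \<Rightarrow> ('a \<Rightarrow> 'a) \<Rightarrow> bool" where
  "has_weak_gradient \<Omega> u g \<longleftrightarrow>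
     u locally_integrable_on \<Omega> \<and> g locally_integrable_on \<Omega> \<and>
     (\<forall>\<phi>\<in>test_functions \<Omega>.
        (LINT x|lebesgue_on \<Omega>. u x *\<^sub>R grad \<phi> x) = - (LINT x|lebesgue_on \<Omega>. \<phi> x *\<^sub>R g x))"

text \<open>A representative; for open \<open>\<Omega>\<close> weak gradients are unique up to null sets.\<close>

definition weak_grad :: "'a::euclidean_space set \<Rightarrow> ('a \<Rightarrow> real) \<Rightarrow> 'a \<Rightarrow> 'a" where
  "weak_grad \<Omega> u = (SOME g. has_weak_gradient \<Omega> u g)"

definition W1p :: "real \<Rightarrow> 'a::euclidean_space set \<Rightarrow> ('a \<Rightarrow> real) set" where
  "W1p p \<Omega> = {u \<in> Lp p \<Omega>. \<exists>g \<in> Lp p \<Omega>. has_weak_gradient \<Omega> u g}"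

definition W1p_norm :: "real \<Rightarrow> 'a::euclidean_space set \<Rightarrow> ('a \<Rightarrow> real) \<Rightarrow> real" where
  "W1p_norm p \<Omega> u =
     (Lp_norm p \<Omega> u powr p + Lp_norm p \<Omega> (weak_grad \<Omega> u) powr p) powr (1 / p)"

definition W1p_0 :: "real \<Rightarrow> 'a::euclidean_space set \<Rightarrow> ('a \<Rightarrow> real) set" where
  "W1p_0 p \<Omega> = {u \<in> W1p p \<Omega>.
     \<forall>\<epsilon>>0. \<exists>\<phi>\<in>test_functions \<Omega>. W1p_norm p \<Omega> (\<lambda>x. u x - \<phi> x) < \<epsilon>}"

text \<open>Since \<open>0 powr a = 0\<close>, the field \<open>|\<nabla>u|\<^bsup>p-2\<^esup> \<nabla>u\<close> is 0 where \<open>\<nabla>u\<close> vanishes, also for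
  \<open>p < 2\<close>.\<close>

definition weak_solution ::
    "real \<Rightarrow> 'a::euclidean_space set \<Rightarrow> ('a \<Rightarrow> real) \<Rightarrow> ('a \<Rightarrow> real) \<Rightarrow> bool" where
  "weak_solution p \<Omega> f u \<longleftrightarrow> u \<in> W1p_0 p \<Omega> \<and>
     (\<forall>\<phi>\<in>test_functions \<Omega>.
        (LINT x|lebesgue_on \<Omega>.
           ((norm (weak_grad \<Omega> u x) powr (p - 2)) *\<^sub>R weak_grad \<Omega> u x) \<bullet> grad \<phi> x)
        = (LINT x|lebesgue_on \<Omega>. f x * \<phi> x))"

end

theory Submission
  imports Defs
begin

text \<open>
  For the integrability statements let \<open>Q\<close> be the exponent conjugate to \<open>q\<close>, put
  \<open>\<alpha> = r/Q - 1\<close> and \<open>s = rp/(\<alpha> + p)\<close>, and test the equation with a smooth bounded approximation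
  of \<open>u|u|\<^sup>\<alpha>\<close>. With \<open>v = u|u|\<^bsup>\<alpha>/p\<^esup>\<close> this bounds \<open>\<integral>|\<nabla>v|\<^sup>p\<close> by
  \<open>\<parallel>f\<parallel>\<^sub>q (\<integral>|v|\<^sup>s)\<^bsup>1/Q\<^esup>\<close>, because \<open>(\<alpha> + 1) Q = r = (1 + \<alpha>/p) s\<close>. The bound on \<open>r\<close> says
  precisely that \<open>s\<close> is smaller than the Sobolev exponent \<open>np/(n - p)\<close>, so a subcritical Sobolev
  inequality closes the estimate for \<open>\<integral>|v|\<^sup>s = \<integral>|u|\<^sup>r\<close>; no critical embedding is needed.
  For the sharpness statement \<open>u\<close> is a smoothly cut off multiple of \<open>|x - c|\<^bsup>-n/r\<^esup>\<close>.
\<close>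

section \<open>Integral inequalities\<close>

text \<open>For \<open>r < Q\<close> the exponent \<alpha> is negative, so
  \<open>u|u|\<^sup>\<alpha>\<close> has an unbounded derivative at 0 besides being unbounded at
  infinity. One parameter \<open>e\<close> cures both: it smooths the power near 0 and bounds the
  argument. Boundedness also makes the integral of \<open>|v|\<^sup>s\<close> finite beforehand,
  without which it could not be absorbed. Absorption succeeds because that integral returns with the
  power \<open>s/(pQ) = 1 - (p - 1)/(r/Q + p - 1) < 1\<close>; solving for it leaves the norm of f
  with the power \<open>r/(p - 1)\<close>, as homogeneity demands. In the form
  \<open>r (n/q - p) < n (p - 1)\<close> the bound on r still makes sense for
  \<open>q = n/p\<close>, where the left side is 0, so (i) and (iii) are one estimate. For sharpness
  the exponent \<open>n/r\<close> is forced: \<open>|u|\<^sup>r\<close> then behaves like the power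
  \<open>-n\<close> of the distance to c, which just fails to be integrable. The right-hand side is
  at most a multiple of the power \<open>-((n/r)(p - 1) + p)\<close>, whose q-th power is integrable
  exactly when r exceeds the critical value, and the lower bound on q is what puts the gradient into
  \<open>L\<^sup>p\<close>.\<close>

lemma Holder_inequality:
  fixes f g :: "'a \<Rightarrow> real"
  assumes pq: "p > 1" "q > 1" "1 / p + 1 / q = 1"
    and [measurable]: "f \<in> borel_measurable M" "g \<in> borel_measurable M"
    and f: "integrable M (\<lambda>x. \<bar>f x\<bar> powr p)" and g: "integrable M (\<lambda>x. \<bar>g x\<bar> powr q)"
  shows "integrable M (\<lambda>x. f x * g x)"
    and "(LINT x|M. \<bar>f x * g x\<bar>) \<le>
      (LINT x|M. \<bar>f x\<bar> powr p) powr (1 / p) * (LINT x|M. \<bar>g x\<bar> powr q) powr (1 / q)"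
proof -
  have Y: "a * b \<le> a powr p / p + b powr q / q" if "a \<ge> 0" "b \<ge> 0" for a b
    using Youngs_inequality[OF pq that] .
  show int: "integrable M (\<lambda>x. f x * g x)"
  proof (rule Bochner_Integration.integrable_bound)
    show "integrable M (\<lambda>x. \<bar>f x\<bar> powr p / p + \<bar>g x\<bar> powr q / q)"
      using f g by auto
    have "norm (f x * g x) \<le> norm (\<bar>f x\<bar> powr p / p + \<bar>g x\<bar> powr q / q)" for x
      using Y[of "\<bar>f x\<bar>" "\<bar>g x\<bar>"] by (simp add: abs_mult)
    then show "AE x in M. norm (f x * g x) \<le> norm (\<bar>f x\<bar> powr p / p + \<bar>g x\<bar> powr q / q)" by simp
  qed simp
  define A B where "A = (LINT x|M. \<bar>f x\<bar> powr p)" and "B = (LINT x|M. \<bar>g x\<bar> powr q)"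
  have zero: "(LINT x|M. \<bar>h x * k x\<bar>) = 0"
    if "integrable M (\<lambda>x. \<bar>h x\<bar> powr r)" "(LINT x|M. \<bar>h x\<bar> powr r) = 0" for h k :: "'a \<Rightarrow> real" and r
  proof -
    have "AE x in M. \<bar>h x\<bar> powr r = 0"
      using that by (subst (asm) integral_nonneg_eq_0_iff_AE) auto
    then show ?thesis by (intro integral_eq_zero_AE) auto
  qed
  show "(LINT x|M. \<bar>f x * g x\<bar>) \<le> A powr (1 / p) * B powr (1 / q)"
  proof (cases "A = 0 \<or> B = 0")
    case True
    then show ?thesis
      using zero[of f p g] zero[of g q f] f g
      unfolding A_def B_def by (auto simp: mult.commute)
  next
    case False
    have "A \<ge> 0" "B \<ge> 0" unfolding A_def B_def by auto
    with False have AB: "A > 0" "B > 0" by auto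
    define a b where "a = A powr (1 / p)" and "b = B powr (1 / q)"
    have ab: "a > 0" "b > 0" "a powr p = A" "b powr q = B"
      using AB pq by (auto simp: a_def b_def powr_powr)
    \<comment> \<open>Young's inequality for the functions divided by their norms; after integration
      the right side is 1/p + 1/q = 1.\<close>
    have pt: "\<bar>f x * g x\<bar> / (a * b) \<le> \<bar>f x\<bar> powr p / (A * p) + \<bar>g x\<bar> powr q / (B * q)" for x
      using Y[of "\<bar>f x\<bar> / a" "\<bar>g x\<bar> / b"] ab
      by (simp add: abs_mult powr_divide)
    have "(LINT x|M. \<bar>f x * g x\<bar>) / (a * b) = (LINT x|M. \<bar>f x * g x\<bar> / (a * b))" by simp
    also have "\<dots> \<le> (LINT x|M. \<bar>f x\<bar> powr p / (A * p) + \<bar>g x\<bar> powr q / (B * q))"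
      using int f g pt by (intro integral_mono) auto
    also have "\<dots> = A / (A * p) + B / (B * q)"
      using f g by (simp add: A_def B_def)
    also have "\<dots> = 1" using AB pq by simp
    finally show ?thesis using ab by (simp add: a_def b_def field_simps)
  qed
qed

text \<open>Holder's inequality for \<open>|h|\<^sup>s\<close> against the constant 1, with
  exponents \<open>t/s\<close> and \<open>t/(t - s)\<close>. For \<open>s = 1\<close> it serves as
  Jensen's inequality for averages.\<close>

lemma Lp_mono_finite_measure:
  fixes h :: "'a \<Rightarrow> real"
  assumes "finite_measure M" and st: "0 < s" "s < t"
    and [measurable]: "h \<in> borel_measurable M" and h: "integrable M (\<lambda>x. \<bar>h x\<bar> powr t)"
  shows "integrable M (\<lambda>x. \<bar>h x\<bar> powr s)"
    and "(LINT x|M. \<bar>h x\<bar> powr s) \<le> measure M (space M) powr (1 - s / t) * (LINT x|M. \<bar>h x\<bar> powr t) powr (s / t)"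
proof -
  interpret finite_measure M by fact
  define p q where "p = t / s" and "q = t / (t - s)"
  have pq: "p > 1" "q > 1" "1 / p + 1 / q = 1" using st by (auto simp: p_def q_def field_simps)
  have "integrable M (\<lambda>x. \<bar>\<bar>h x\<bar> powr s\<bar> powr p)" using h st by (simp add: powr_powr p_def)
  from Holder_inequality[OF pq _ _ this, of "\<lambda>_. 1"]
  have 1: "integrable M (\<lambda>x. \<bar>h x\<bar> powr s * 1)"
    and 2: "(LINT x|M. \<bar>\<bar>h x\<bar> powr s * 1\<bar>) \<le> (LINT x|M. \<bar>\<bar>h x\<bar> powr s\<bar> powr p) powr (1/p) * (LINT x|M. \<bar>1::real\<bar> powr q) powr (1/q)"
    by auto
  show "integrable M (\<lambda>x. \<bar>h x\<bar> powr s)" using 1 by simp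
  have "1 / p = s / t" "1 / q = 1 - s / t" using st by (auto simp: p_def q_def field_simps)
  then show "(LINT x|M. \<bar>h x\<bar> powr s) \<le> measure M (space M) powr (1 - s / t) * (LINT x|M. \<bar>h x\<bar> powr t) powr (s / t)"
    using 2 st by (simp add: powr_powr p_def mult.commute)
qed

section \<open>Smooth functions\<close>

lemma Ck_SucI:
  fixes f :: "'a::euclidean_space \<Rightarrow> real"
  assumes "\<And>x. (f has_derivative D x) (at x)" "\<And>b. b \<in> Basis \<Longrightarrow> Ck k (\<lambda>x. D x b)"
  shows "Ck (Suc k) f"
proof -
  have "frechet_derivative f (at x) = D x" for x
    using assms(1) frechet_derivative_at by metis
  moreover have "f differentiable_on UNIV"
    using assms(1) by (auto simp: differentiable_on_def intro: differentiableI)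
  ultimately show ?thesis using assms(2) by simp
qed

lemma Ck_SucD:
  assumes "Ck (Suc k) f"
  shows "(f has_derivative frechet_derivative f (at x)) (at x)"
    and "b \<in> Basis \<Longrightarrow> Ck k (\<lambda>x. frechet_derivative f (at x) b)"
  using assms by (auto simp: differentiable_on_def frechet_derivative_works)

lemma Ck_Suc_imp_Ck: "Ck (Suc k) f \<Longrightarrow> Ck k f"
proof (induction k arbitrary: f)
  case 0
  then show ?case by (auto simp: differentiable_imp_continuous_on)
next
  case (Suc k)
  then show ?case by auto
qed

lemma Ck_imp_continuous: "Ck k f \<Longrightarrow> continuous_on S f"
proof (induction k)
  case 0
  then show ?case by (auto intro: continuous_on_subset)
next
  case (Suc k)
  then show ?case using Ck_Suc_imp_Ck by blast
qed

lemma Ck_const [simp]: "Ck k (\<lambda>x. c)"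
proof (induction k arbitrary: c)
  case (Suc k)
  show ?case by (rule Ck_SucI[where D="\<lambda>x h. 0"]) (use Suc in auto)
qed auto

lemma Ck_inner: "Ck k (\<lambda>x. x \<bullet> v)"
proof (cases k)
  case (Suc m)
  show ?thesis unfolding Suc
    by (rule Ck_SucI[where D="\<lambda>x h. h \<bullet> v"]) (auto intro!: derivative_eq_intros)
qed (auto intro!: continuous_intros)

lemma Ck_add: "Ck k f \<Longrightarrow> Ck k g \<Longrightarrow> Ck k (\<lambda>x. f x + g x)"
proof (induction k arbitrary: f g)
  case 0
  then show ?case by (auto intro: continuous_intros)
next
  case (Suc k)
  note D = Ck_SucD[OF Suc.prems(1)] Ck_SucD[OF Suc.prems(2)]
  show ?case
    by (rule Ck_SucI[OF has_derivative_add[OF D(1) D(3)]]) (intro Suc.IH D)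
qed

lemma Ck_mult: "Ck k f \<Longrightarrow> Ck k g \<Longrightarrow> Ck k (\<lambda>x. f x * g x)"
proof (induction k arbitrary: f g)
  case 0
  then show ?case by (auto intro: continuous_intros)
next
  case (Suc k)
  note D = Ck_SucD[OF Suc.prems(1)] Ck_SucD[OF Suc.prems(2)]
  show ?case
    by (rule Ck_SucI[OF has_derivative_mult[OF D(1) D(3)]])
      (intro Ck_add Suc.IH D Ck_Suc_imp_Ck[OF Suc.prems(1)] Ck_Suc_imp_Ck[OF Suc.prems(2)])
qed

lemma Ck_minus: "Ck k f \<Longrightarrow> Ck k (\<lambda>x. - f x)"
  using Ck_mult[OF Ck_const[of k "-1"], of f] by simp

lemma Ck_diff: "Ck k f \<Longrightarrow> Ck k g \<Longrightarrow> Ck k (\<lambda>x. f x - g x)"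
  using Ck_add[of k f "\<lambda>x. - g x"] Ck_minus by auto

lemma Ck_sum: "(\<And>i. i \<in> I \<Longrightarrow> Ck k (f i)) \<Longrightarrow> Ck k (\<lambda>x. \<Sum>i\<in>I. f i x)"
  by (induction I rule: infinite_finite_induct) (auto intro: Ck_add)

lemma Ck_prod: "(\<And>i. i \<in> I \<Longrightarrow> Ck k (f i)) \<Longrightarrow> Ck k (\<lambda>x. \<Prod>i\<in>I. f i x)"
  by (induction I rule: infinite_finite_induct) (auto intro: Ck_mult)

lemma Ck_power: "Ck k f \<Longrightarrow> Ck k (\<lambda>x. f x ^ m)"
  by (induction m) (auto intro: Ck_mult)

text \<open>The list F of all successive derivatives is carried through the induction, because
  differentiating \<open>F m (f x)\<close> produces \<open>F (Suc m) (f x)\<close>. The set S admits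
  functions such as real powers, which are smooth on a part of the line only.\<close>

lemma Ck_chain:
  fixes F :: "nat \<Rightarrow> real \<Rightarrow> real"
  assumes "\<And>m t. t \<in> S \<Longrightarrow> (F m has_real_derivative F (Suc m) t) (at t)"
    and "\<And>x. f x \<in> S" and "Ck k f"
  shows "Ck k (\<lambda>x. F m (f x))"
  using assms(3)
proof (induction k arbitrary: m)
  case 0
  have "isCont (F m) (f x)" for x
    using assms(1,2) DERIV_isCont by blast
  moreover have "isCont f x" for x using 0 by (simp add: continuous_on_eq_continuous_at)
  ultimately have "isCont (\<lambda>x. F m (f x)) x" for x by (rule isCont_o2[rotated])
  then show ?case by (simp add: continuous_at_imp_continuous_on)
next
  case (Suc k)
  note D = Ck_SucD[OF Suc.prems]
  have "((\<lambda>x. F m (f x)) has_derivative (\<lambda>h. F (Suc m) (f x) * frechet_derivative f (at x) h)) (at x)" for x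
    using has_derivative_compose[OF D(1) assms(1)[OF assms(2), unfolded has_field_derivative_def]] .
  then show ?case
    by (rule Ck_SucI) (intro Ck_mult Suc.IH Ck_Suc_imp_Ck[OF Suc.prems] D)
qed

lemma Ck_powr:
  assumes "\<And>x. f x > 0" "Ck k f"
  shows "Ck k (\<lambda>x. f x powr a)"
proof -
  \<comment> \<open>The m-th derivative of \<open>t powr a\<close>, with its falling factorial
    written as a product.\<close>
  define F where "F m t = (\<Prod>i<m. a - real i) * t powr (a - real m)" for m t
  have "(F m has_real_derivative F (Suc m) t) (at t)" if "t \<in> {0<..}" for m t
    unfolding F_def using that by (auto intro!: derivative_eq_intros simp: algebra_simps)
  from Ck_chain[of "{0<..}" F f k 0, OF this] assms show ?thesis
    by (simp add: F_def)
qed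

section \<open>The flat function exp (-1/t)\<close>

definition bump_exp :: "real \<Rightarrow> real" where
  "bump_exp t = (if t > 0 then exp (- 1 / t) else 0)"

lemma bump_exp_nonneg [simp]: "bump_exp t \<ge> 0"
  and bump_exp_le_1: "bump_exp t \<le> 1"
  and bump_exp_pos_iff: "bump_exp t > 0 \<longleftrightarrow> t > 0"
  and bump_exp_eq_0_iff: "bump_exp t = 0 \<longleftrightarrow> t \<le> 0"
  and bump_exp_mono: "s \<le> t \<Longrightarrow> bump_exp s \<le> bump_exp t"
  by (auto simp: bump_exp_def field_simps)

text \<open>A positive power only rescales the argument and hence stays smooth, even for exponents
  below 1. This is what makes this function a suitable cutoff for a nonlinear flux of degree p -
  1.\<close>

lemma bump_exp_powr: "c > 0 \<Longrightarrow> bump_exp t powr c = bump_exp (t / c)"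
  by (auto simp: bump_exp_def powr_def zero_less_divide_iff)

text \<open>All derivatives of \<open>bump_exp\<close> have this form: for t > 0, differentiation
  turns P into \<open>X\<^sup>2 (P - P')\<close>, where X stands for 1/t.\<close>

definition bump_poly :: "real poly \<Rightarrow> real \<Rightarrow> real" where
  "bump_poly P t = poly P (1 / t) * bump_exp t"

text \<open>From the right, the substitution y = 1/t reduces this to the decay of a polynomial times
  exp (-y) at infinity; from the left the function is identically 0.\<close>

lemma tendsto_bump_poly_0: "(bump_poly P \<longlongrightarrow> 0) (at 0)"
proof -
  have *: "((\<lambda>y::real. poly P y * exp (- y)) \<longlongrightarrow> 0) at_top"
  proof -
    have "((\<lambda>y. \<Sum>i\<le>degree P. coeff P i * (y ^ i / exp y)) \<longlongrightarrow> (\<Sum>i\<le>degree P. coeff P i * 0)) at_top"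
      by (intro tendsto_intros tendsto_power_div_exp_0)
    moreover have "(\<Sum>i\<le>degree P. coeff P i * (y ^ i / exp y)) = poly P y * exp (- y)" for y
      by (simp add: poly_altdef sum_distrib_right exp_minus divide_inverse mult.assoc)
    ultimately show ?thesis by simp
  qed
  have "((\<lambda>t. poly P (1 / t) * exp (- (1 / t))) \<longlongrightarrow> 0) (at_right 0)"
    using filterlim_compose[OF * filterlim_inverse_at_top_right] by (simp add: inverse_eq_divide)
  then have "(bump_poly P \<longlongrightarrow> 0) (at_right 0)"
    by (rule tendsto_cong[THEN iffD1, rotated])
      (auto simp: bump_poly_def bump_exp_def eventually_at_right_less intro!: eventually_mono[OF eventually_at_right_less])
  moreover have "(bump_poly P \<longlongrightarrow> 0) (at_left 0)"
    by (rule tendsto_eventually) (auto simp: bump_poly_def bump_exp_def eventually_at_left_field intro!: exI[of _ "-1"])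
  ultimately show ?thesis by (simp add: filterlim_split_at)
qed

lemma bump_poly_has_derivative:
  "(bump_poly P has_real_derivative bump_poly ([:0,0,1:] * (P - pderiv P)) t) (at t)"
proof -
  consider "t > 0" | "t < 0" | "t = 0" by linarith
  then show ?thesis
  proof cases
    case 1
    have "((\<lambda>t. poly P (1 / t) * exp (- 1 / t)) has_real_derivative
      (- poly (pderiv P) (1 / t) / t^2 + poly P (1 / t) / t^2) * exp (- 1 / t)) (at t)"
      using 1 by (auto intro!: derivative_eq_intros DERIV_chain2[OF poly_DERIV]
          simp: power2_eq_square field_simps)
    moreover have "eventually (\<lambda>s. poly P (1 / s) * exp (- 1 / s) = bump_poly P s) (nhds t)"
      using eventually_nhds_in_open[of "{0<..}" t] 1
      by (auto simp: bump_poly_def bump_exp_def elim!: eventually_mono)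
    ultimately have "(bump_poly P has_real_derivative
      (- poly (pderiv P) (1 / t) / t^2 + poly P (1 / t) / t^2) * exp (- 1 / t)) (at t)"
      by (subst (asm) DERIV_cong_ev) auto
    then show ?thesis using 1
      by (auto elim!: DERIV_cong simp: bump_poly_def bump_exp_def power2_eq_square field_simps)
  next
    case 2
    have "((\<lambda>t::real. 0) has_real_derivative 0) (at t)" by simp
    moreover have "eventually (\<lambda>s. 0 = bump_poly P s) (nhds t)"
      using eventually_nhds_in_open[of "{..<0}" t] 2
      by (auto simp: bump_poly_def bump_exp_def elim!: eventually_mono)
    ultimately have "(bump_poly P has_real_derivative 0) (at t)"
      by (subst (asm) DERIV_cong_ev) auto
    then show ?thesis using 2 by (simp add: bump_poly_def bump_exp_def)
  next
    case 3
    \<comment> \<open>Dividing by h multiplies the polynomial by its variable, so the difference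
      quotient at 0 is again a \<open>bump_poly\<close> and tends to 0.\<close>
    have "((\<lambda>h. bump_poly P h / h) \<longlongrightarrow> 0) (at 0)"
      using tendsto_bump_poly_0[of "pCons 0 P"] by (simp add: bump_poly_def[abs_def])
    then show ?thesis using 3
      by (simp add: DERIV_def bump_poly_def bump_exp_def)
  qed
qed

lemma Ck_bump_exp:
  assumes "Ck k f"
  shows "Ck k (\<lambda>x. bump_exp (f x))"
proof -
  define F where "F m = bump_poly (((\<lambda>P. [:0,0,1:] * (P - pderiv P)) ^^ m) 1)" for m
  have "(F m has_real_derivative F (Suc m) t) (at t)" for m t
    unfolding F_def using bump_poly_has_derivative by simp
  from Ck_chain[of UNIV F f k 0, OF this] assms show ?thesis
    by (simp add: F_def bump_poly_def)
qed

definition bump_exp' :: "real \<Rightarrow> real" where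
  "bump_exp' t = (1 / t)\<^sup>2 * bump_exp t"

lemma bump_exp_has_derivative: "(bump_exp has_real_derivative bump_exp' t) (at t)"
  using bump_poly_has_derivative[of 1 t]
  by (simp add: bump_poly_def[abs_def] bump_exp'_def power2_eq_square)

lemma isCont_bump_exp': "isCont bump_exp' t"
proof -
  have "bump_poly [:0,0,1:] = bump_exp'"
    by (simp add: bump_poly_def[abs_def] bump_exp'_def fun_eq_iff power2_eq_square)
  then show ?thesis using bump_poly_has_derivative[of "[:0,0,1:]" t] by (auto dest: DERIV_isCont)
qed

text \<open>With y = 1/t the upper bound reads \<open>y\<^sup>2 \<le> 2 exp y\<close>, which is
  contained in the quadratic Taylor bound for exp.\<close>

lemma bump_exp'_bounds: "0 \<le> bump_exp' t" "bump_exp' t \<le> 2"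
proof -
  show "0 \<le> bump_exp' t" by (simp add: bump_exp'_def)
  show "bump_exp' t \<le> 2"
  proof (cases "t > 0")
    case True
    have "1 + 1/t + (1/t)^2 / 2 \<le> exp (1/t)"
      using True by (intro exp_lower_Taylor_quadratic) auto
    moreover have "1/t > 0" using True by simp
    ultimately have "(1/t)^2 \<le> 2 * exp (1/t)" by linarith
    then show ?thesis using True by (simp add: bump_exp'_def bump_exp_def exp_minus field_simps)
  qed (simp add: bump_exp'_def bump_exp_def)
qed

section \<open>Test functions and integration by parts\<close>

lemma compact_support_bounded:
  fixes f :: "'a::euclidean_space \<Rightarrow> 'b::real_normed_vector"
  assumes "continuous_on UNIV f" "compact K" "\<And>x. x \<notin> K \<Longrightarrow> f x = 0"
  obtains B where "B > 0" "\<And>x. norm (f x) \<le> B"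
proof -
  have "bounded (f ` K)"
    using assms by (intro compact_imp_bounded compact_continuous_image) (auto intro: continuous_on_subset)
  then obtain B where "B > 0" "\<forall>x\<in>K. norm (f x) \<le> B" by (auto simp: bounded_pos)
  then have "norm (f x) \<le> B" for x using assms(3)[of x] by (cases "x \<in> K") auto
  with \<open>B > 0\<close> that show thesis by blast
qed

lemma integrable_lborel_compact_support:
  fixes f :: "'a::euclidean_space \<Rightarrow> 'b::{banach, second_countable_topology}"
  assumes "continuous_on UNIV f" "compact K" "\<And>x. x \<notin> K \<Longrightarrow> f x = 0"
  shows "integrable lborel f"
proof -
  have "integrable lborel (\<lambda>x. indicator K x *\<^sub>R f x)"
    using assms by (intro borel_integrable_compact) (auto intro: continuous_on_subset)
  also have "(\<lambda>x. indicator K x *\<^sub>R f x) = f" using assms(3) by (auto simp: indicator_def)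
  finally show ?thesis .
qed

text \<open>The definitions integrate over \<open>lebesgue_on \<Omega>\<close>, whereas translation,
  scaling and Fubini are applied to \<open>lborel\<close>. For Borel functions vanishing outside the
  domain this is the passage between the two.\<close>

lemma lebesgue_on_eq_lborel:
  fixes f :: "'a::euclidean_space \<Rightarrow> 'b::euclidean_space"
  assumes "S \<in> sets lebesgue" "f \<in> borel_measurable borel" "\<And>x. x \<notin> S \<Longrightarrow> f x = 0"
  shows "integral\<^sup>L (lebesgue_on S) f = integral\<^sup>L lborel f"
    and "integrable (lebesgue_on S) f \<longleftrightarrow> integrable lborel f"
proof -
  have eq: "(\<lambda>x. if x \<in> S then f x else 0) = f" using assms(3) by auto
  show "integral\<^sup>L (lebesgue_on S) f = integral\<^sup>L lborel f"
    using Lebesgue_Measure.integral_restrict_UNIV[OF assms(1), of f] assms(2) unfolding eq by (simp add: integral_completion)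
  show "integrable (lebesgue_on S) f \<longleftrightarrow> integrable lborel f"
    using Lebesgue_Measure.integrable_restrict_UNIV[OF assms(1), of f] assms(2) unfolding eq by (simp add: integrable_completion)
qed

lemma integrable_lebesgue_on_superset:
  fixes f :: "'a::euclidean_space \<Rightarrow> 'b::euclidean_space"
  assumes "K \<subseteq> S" "K \<in> sets lebesgue" "S \<in> sets lebesgue" "\<And>x. x \<notin> K \<Longrightarrow> f x = 0"
    and "integrable (lebesgue_on K) f"
  shows "integrable (lebesgue_on S) f"
proof -
  have "(\<lambda>x. if x \<in> K then f x else 0) = (\<lambda>x. if x \<in> S then f x else 0)"
    using assms(1,4) by (auto simp: fun_eq_iff)
  then show ?thesis
    using assms Lebesgue_Measure.integrable_restrict_UNIV[of K f]
      Lebesgue_Measure.integrable_restrict_UNIV[of S f] by auto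
qed

text \<open>By translation invariance every difference quotient of \<psi> has integral 0, and
  dominated convergence carries this over to the directional derivatives. All integrations by parts
  below are this fact applied to a product.\<close>

lemma integral_gradient_eq_0:
  fixes \<psi> :: "'a::euclidean_space \<Rightarrow> real"
  assumes der: "\<And>x. (\<psi> has_derivative (\<lambda>h. g x \<bullet> h)) (at x)" and g: "continuous_on UNIV g"
    and K: "compact K" "\<And>x. x \<notin> K \<Longrightarrow> \<psi> x = 0" "\<And>x. x \<notin> K \<Longrightarrow> g x = 0"
  shows "(LINT x|lborel. g x) = 0"
proof (rule euclidean_eqI)
  fix b :: 'a assume b: "b \<in> Basis"
  have cont: "continuous_on UNIV \<psi>"
    using der by (auto intro!: continuous_at_imp_continuous_on dest!: has_derivative_continuous)
  have int: "integrable lborel \<psi>" "integrable lborel g"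
    using integrable_lborel_compact_support cont g K by blast+
  have [measurable]: "\<psi> \<in> borel_measurable borel" "g \<in> borel_measurable borel"
    using cont g by (auto intro: borel_measurable_continuous_onI)
  obtain B where B: "B > 0" "\<And>x. norm (g x) \<le> B"
    using compact_support_bounded[OF g K(1,3)] by blast
  obtain R where R: "R > 0" "K \<subseteq> cball 0 R"
    using compact_imp_bounded[OF K(1)] by (force simp: bounded_pos subset_eq)
  define s where "s n = inverse (real (Suc n))" for n
  have s: "s n > 0" "s n \<le> 1" for n by (auto simp: s_def field_simps)
  have s0: "s \<longlonglongrightarrow> 0" unfolding s_def by (rule LIMSEQ_inverse_real_of_nat)
  define d where "d n x = (\<psi> (x + s n *\<^sub>R b) - \<psi> x) / s n" for n x
  have int_shift: "integrable lborel (\<lambda>x. \<psi> (x + t))" "(LINT x|lborel. \<psi> (x + t)) = (LINT x|lborel. \<psi> x)" for t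
  proof -
    have "integrable (distr lborel borel ((+) t)) \<psi>" "(LINT x|distr lborel borel ((+) t). \<psi> x) = (LINT x|lborel. \<psi> x)"
      using int by (simp_all add: lborel_distr_plus)
    then show "integrable lborel (\<lambda>x. \<psi> (x + t))" "(LINT x|lborel. \<psi> (x + t)) = (LINT x|lborel. \<psi> x)"
      by (auto simp: integrable_distr_eq integral_distr add.commute)
  qed
  have "(LINT x|lborel. d n x) = 0" for n
    unfolding d_def using int int_shift by simp
  moreover have "(\<lambda>n. LINT x|lborel. d n x) \<longlonglongrightarrow> (LINT x|lborel. g x \<bullet> b)"
  proof (rule integral_dominated_convergence)
    \<comment> \<open>The steps have length at most 1, so for \<open>norm x > R + 1\<close> both x
      and the shifted point lie outside K; inside, the mean value inequality bounds the quotient by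
      B.\<close>
    show "integrable lborel (\<lambda>x. B * indicator (cball 0 (R + 1)) x)"
      by (intro integrable_mult_right integrable_real_indicator)
        (use emeasure_bounded_finite[of "cball 0 (R + 1)"] in auto)
    show "AE x in lborel. (\<lambda>n. d n x) \<longlonglongrightarrow> g x \<bullet> b"
    proof (rule AE_I2)
      fix x
      have "((\<lambda>t. \<psi> (x + t *\<^sub>R b)) has_derivative (\<lambda>t. g x \<bullet> (t *\<^sub>R b))) (at 0)"
        by (rule has_derivative_compose[where g=\<psi>, of "\<lambda>t. x + t *\<^sub>R b" "\<lambda>t. t *\<^sub>R b"])
          (auto intro!: derivative_eq_intros simp: der)
      then have "((\<lambda>t. \<psi> (x + t *\<^sub>R b)) has_real_derivative (g x \<bullet> b)) (at 0)"
        unfolding has_field_derivative_def by (rule has_derivative_eq_rhs) (auto simp: fun_eq_iff)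
      then have "((\<lambda>t. (\<psi> (x + t *\<^sub>R b) - \<psi> x) / t) \<longlongrightarrow> g x \<bullet> b) (at 0)"
        by (simp add: DERIV_def)
      then show "(\<lambda>n. d n x) \<longlonglongrightarrow> g x \<bullet> b"
        unfolding d_def
      proof (rule filterlim_compose)
        show "filterlim s (at 0) sequentially"
          using s s0 by (auto simp: filterlim_at less_imp_neq[symmetric])
      qed
    qed
    show "AE x in lborel. norm (d n x) \<le> B * indicator (cball 0 (R + 1)) x" for n
    proof (rule AE_I2)
      fix x
      show "norm (d n x) \<le> B * indicator (cball 0 (R + 1)) x"
      proof (cases "x \<in> cball 0 (R + 1)")
        case True
        have "norm (\<psi> (x + s n *\<^sub>R b) - \<psi> x) \<le> B * norm ((x + s n *\<^sub>R b) - x)"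
        proof (rule differentiable_bound[where S=UNIV and f'="\<lambda>x h. g x \<bullet> h"])
          show "onorm (\<lambda>h. g y \<bullet> h) \<le> B" for y
            by (rule onorm_le) (metis B(2) Cauchy_Schwarz_ineq2 mult_right_mono norm_ge_zero order_trans real_norm_def)
        qed (use der in \<open>auto intro: has_derivative_at_withinI\<close>)
        also have "\<dots> = B * s n" using s[of n] b by simp
        finally show ?thesis using True s[of n] by (simp add: d_def field_simps)
      next
        case False
        then have "norm x > R + 1" by simp
        moreover have "norm x \<le> norm (x + s n *\<^sub>R b) + norm (s n *\<^sub>R b)"
          using norm_triangle_ineq4[of "x + s n *\<^sub>R b" "s n *\<^sub>R b"] by simp
        moreover have "norm (s n *\<^sub>R b) \<le> 1" using s[of n] b by simp
        ultimately have "x \<notin> K" "x + s n *\<^sub>R b \<notin> K" using R by (auto simp: subset_eq)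
        then show ?thesis using K B by (simp add: d_def)
      qed
    qed
  qed (auto simp: d_def)
  ultimately have "(LINT x|lborel. g x \<bullet> b) = 0"
    by (simp add: LIMSEQ_const_iff)
  then show "(LINT x|lborel. g x) \<bullet> b = 0 \<bullet> b"
    using int by simp
qed

lemma test_functions_Ck: "\<phi> \<in> test_functions \<Omega> \<Longrightarrow> Ck k \<phi>"
  by (simp add: test_functions_def)

lemma test_functionsI:
  assumes "\<And>k. Ck k \<phi>" "compact K" "K \<subseteq> \<Omega>" "\<And>x. x \<notin> K \<Longrightarrow> \<phi> x = 0"
  shows "\<phi> \<in> test_functions \<Omega>"
proof -
  have "closure {x. \<phi> x \<noteq> 0} \<subseteq> K"
    using assms by (intro closure_minimal) (auto intro: compact_imp_closed)
  then show ?thesis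
    using assms unfolding test_functions_def
    using compact_Int_closed[of K "closure {x. \<phi> x \<noteq> 0}"] by (auto simp: Int_absorb1)
qed

lemma Ck_has_gradient:
  assumes "Ck 1 \<phi>"
  shows "(\<phi> has_derivative (\<lambda>h. grad \<phi> x \<bullet> h)) (at x)" and "continuous_on UNIV (grad \<phi>)"
proof -
  note D = Ck_SucD[of 0 \<phi>, unfolded One_nat_def[symmetric], OF assms]
  interpret bounded_linear "frechet_derivative \<phi> (at x)"
    using D(1) by (rule has_derivative_bounded_linear)
  have "frechet_derivative \<phi> (at x) h = grad \<phi> x \<bullet> h" for h
  proof -
    have "frechet_derivative \<phi> (at x) h = frechet_derivative \<phi> (at x) (\<Sum>b\<in>Basis. (h \<bullet> b) *\<^sub>R b)"
      by (simp add: euclidean_representation)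
    also have "\<dots> = grad \<phi> x \<bullet> h"
      unfolding grad_def inner_sum_left sum scaleR
      by (intro sum.cong) (auto simp: inner_commute)
    finally show ?thesis .
  qed
  then show "(\<phi> has_derivative (\<lambda>h. grad \<phi> x \<bullet> h)) (at x)"
    using D(1)[of x] by presburger
  have "continuous_on UNIV (\<lambda>x. frechet_derivative \<phi> (at x) b)" if "b \<in> Basis" for b
    using D(2)[OF that] by simp
  then show "continuous_on UNIV (grad \<phi>)"
    unfolding grad_def[abs_def] by (auto intro!: continuous_intros)
qed

lemma grad_eqI:
  assumes "(\<phi> has_derivative (\<lambda>h. g \<bullet> h)) (at x)"
  shows "grad \<phi> x = g"
  unfolding grad_def frechet_derivative_at[OF assms, symmetric] by (rule euclidean_representation)

lemma test_functionE:
  fixes \<phi> :: "'a::euclidean_space \<Rightarrow> real"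
  assumes "\<phi> \<in> test_functions \<Omega>"
  obtains K where "compact K" "K \<subseteq> \<Omega>" "\<And>x. x \<notin> K \<Longrightarrow> \<phi> x = 0" "\<And>x. x \<notin> K \<Longrightarrow> grad \<phi> x = 0"
proof
  define K where "K = closure {x. \<phi> x \<noteq> 0}"
  show "compact K" "K \<subseteq> \<Omega>" using assms by (auto simp: test_functions_def K_def)
  show 0: "\<phi> x = 0" if "x \<notin> K" for x
    using that closure_subset[of "{x. \<phi> x \<noteq> 0}"] by (auto simp: K_def)
  show "grad \<phi> x = 0" if "x \<notin> K" for x
  proof (rule grad_eqI)
    have "((\<lambda>x. 0::real) has_derivative (\<lambda>h. 0 \<bullet> h)) (at x)" by simp
    moreover have "open (- K)" unfolding K_def by (rule open_Compl) (rule closed_closure)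
    ultimately show "(\<phi> has_derivative (\<lambda>h. 0 \<bullet> h)) (at x)"
      using that 0 by (auto intro: has_derivative_transform_within_open[of "\<lambda>x. 0" _ x UNIV "- K" \<phi>])
  qed
qed

lemma test_function_has_gradient:
  "\<phi> \<in> test_functions \<Omega> \<Longrightarrow> (\<phi> has_derivative (\<lambda>h. grad \<phi> x \<bullet> h)) (at x)"
  and test_function_continuous: "\<phi> \<in> test_functions \<Omega> \<Longrightarrow> continuous_on UNIV \<phi>"
  and test_function_continuous_grad: "\<phi> \<in> test_functions \<Omega> \<Longrightarrow> continuous_on UNIV (grad \<phi>)"
  by (rule Ck_has_gradient Ck_imp_continuous, erule test_functions_Ck)+

lemma integrable_locally_integrable_mult:
  assumes h: "h locally_integrable_on \<Omega>" and \<Omega>: "open \<Omega>"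
    and \<phi>: "continuous_on UNIV \<phi>" "compact K" "K \<subseteq> \<Omega>" "\<And>x. x \<notin> K \<Longrightarrow> \<phi> x = 0"
  shows "integrable (lebesgue_on \<Omega>) (\<lambda>x. \<phi> x *\<^sub>R h x)"
proof (rule integrable_lebesgue_on_superset[OF \<phi>(3)])
  obtain B where B: "B > 0" "\<And>x. norm (\<phi> x) \<le> B"
    using compact_support_bounded[OF \<phi>(1,2,4)] by blast
  have hK: "integrable (lebesgue_on K) h" using h \<phi> by (auto simp: locally_integrable_on_def)
  have [measurable]: "\<phi> \<in> borel_measurable (lebesgue_on K)"
    using \<phi>(1,2) by (intro continuous_imp_measurable_on_sets_lebesgue) (auto intro: continuous_on_subset simp: lmeasurable_compact fmeasurableD)
  show "integrable (lebesgue_on K) (\<lambda>x. \<phi> x *\<^sub>R h x)"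
  proof (rule Bochner_Integration.integrable_bound)
    show "integrable (lebesgue_on K) (\<lambda>x. B *\<^sub>R h x)" using hK by simp
    have "norm (\<phi> x *\<^sub>R h x) \<le> norm (B *\<^sub>R h x)" for x
      using B(2)[of x] B(1) by (simp add: mult_right_mono)
    then show "AE x in lebesgue_on K. norm (\<phi> x *\<^sub>R h x) \<le> norm (B *\<^sub>R h x)" by simp
  qed (use hK in measurable)
qed (use \<phi> \<Omega> in \<open>auto simp: lmeasurable_compact fmeasurableD borel_open\<close>)

text \<open>The gradient of the product of v with a test function is compactly supported and so has
  integral 0; the product rule splits it into the two required terms.\<close>

lemma C1_has_weak_gradient:
  fixes v :: "'a::euclidean_space \<Rightarrow> real"
  assumes \<Omega>: "open \<Omega>" and der: "\<And>x. (v has_derivative (\<lambda>h. g x \<bullet> h)) (at x)" and g: "continuous_on UNIV g"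
  shows "has_weak_gradient \<Omega> v g"
proof -
  have cont: "continuous_on UNIV v"
    using der by (auto intro!: continuous_at_imp_continuous_on dest!: has_derivative_continuous)
  have li: "f locally_integrable_on \<Omega>" if "continuous_on UNIV f" for f :: "'a \<Rightarrow> 'b::euclidean_space"
    unfolding locally_integrable_on_def
  proof (intro allI impI; elim conjE)
    fix K :: "'a set" assume K: "compact K" "K \<subseteq> \<Omega>"
    have "integrable lebesgue (\<lambda>x. indicator K x *\<^sub>R f x)"
      using borel_integrable_compact[OF K(1) continuous_on_subset[OF that]]
      by (subst integrable_completion) (auto intro: borel_measurable_integrable)
    then show "integrable (lebesgue_on K) f"
      using K by (subst integrable_restrict_space) (auto simp: lmeasurable_compact fmeasurableD)
  qed
  have "(LINT x|lebesgue_on \<Omega>. v x *\<^sub>R grad \<phi> x) = - (LINT x|lebesgue_on \<Omega>. \<phi> x *\<^sub>R g x)"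
    if \<phi>: "\<phi> \<in> test_functions \<Omega>" for \<phi>
  proof -
    obtain K where K: "compact K" "K \<subseteq> \<Omega>" "\<And>x. x \<notin> K \<Longrightarrow> \<phi> x = 0" "\<And>x. x \<notin> K \<Longrightarrow> grad \<phi> x = 0"
      using test_functionE[OF \<phi>] by blast
    note c = test_function_continuous[OF \<phi>] test_function_continuous_grad[OF \<phi>] cont g
    have *: "(LINT x|lborel. v x *\<^sub>R grad \<phi> x + \<phi> x *\<^sub>R g x) = 0"
    proof (rule integral_gradient_eq_0[where \<psi>="\<lambda>x. v x * \<phi> x" and K=K])
      show "((\<lambda>x. v x * \<phi> x) has_derivative (\<lambda>h. (v x *\<^sub>R grad \<phi> x + \<phi> x *\<^sub>R g x) \<bullet> h)) (at x)" for x
        using has_derivative_mult[OF der test_function_has_gradient[OF \<phi>]]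
        by (rule has_derivative_eq_rhs) (auto simp: inner_add_left)
    qed (use K c in \<open>auto intro!: continuous_intros\<close>)
    have i: "integrable lborel (\<lambda>x. v x *\<^sub>R grad \<phi> x)" "integrable lborel (\<lambda>x. \<phi> x *\<^sub>R g x)"
      using K c by (auto intro!: integrable_lborel_compact_support[of _ K] continuous_intros)
    have "\<Omega> \<in> sets lebesgue" using \<Omega> by auto
    moreover have "v x *\<^sub>R grad \<phi> x = 0" "\<phi> x *\<^sub>R g x = 0" if "x \<notin> \<Omega>" for x
      using that K by force+
    ultimately have e: "(LINT x|lebesgue_on \<Omega>. v x *\<^sub>R grad \<phi> x) = (LINT x|lborel. v x *\<^sub>R grad \<phi> x)"
       "(LINT x|lebesgue_on \<Omega>. \<phi> x *\<^sub>R g x) = (LINT x|lborel. \<phi> x *\<^sub>R g x)"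
      using i[THEN borel_measurable_integrable] by (intro lebesgue_on_eq_lborel; simp)+
    show ?thesis unfolding e using * i by (simp add: add_eq_0_iff)
  qed
  then show ?thesis unfolding has_weak_gradient_def using li[OF cont] li[OF g] by auto
qed

section \<open>Uniqueness of weak gradients\<close>

text \<open>In each coordinate the parabola \<open>c b\<close> is positive exactly inside the side
  of the box. Multiplying it by growing factors inside the flat function makes the value exp (-1/(k
  c)) tend to 1 there while it stays 0 outside; the product over the coordinates does the
  rest.\<close>

lemma box_indicator_limit_of_test_functions:
  fixes l u :: "'a::euclidean_space"
  assumes "cbox l u \<subseteq> \<Omega>" "box l u \<noteq> {}"
  obtains \<phi> where "\<And>k. \<phi> k \<in> test_functions \<Omega>" "\<And>k x. \<bar>\<phi> k x\<bar> \<le> indicator (cbox l u) x"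
    "\<And>x. (\<lambda>k. \<phi> k x) \<longlonglongrightarrow> indicator (box l u) x"
proof
  define c where "c b x = (x \<bullet> b - l \<bullet> b) * (u \<bullet> b - x \<bullet> b)" for b x :: 'a
  define \<phi> where "\<phi> k x = (\<Prod>b\<in>Basis. bump_exp (real (Suc k) * c b x))" for k x
  have lu: "l \<bullet> b < u \<bullet> b" if "b \<in> Basis" for b using assms(2) that by (auto simp: box_ne_empty)
  have zero: "\<phi> k x = 0" if nb: "x \<notin> box l u" for k x
  proof -
    obtain b where b: "b \<in> Basis" "x \<bullet> b \<le> l \<bullet> b \<or> u \<bullet> b \<le> x \<bullet> b"
      using nb by (force simp: mem_box not_less)
    then have "c b x \<le> 0"
      using lu[OF b(1)] unfolding c_def by (smt (verit) mult_nonneg_nonpos mult_nonpos_nonneg)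
    then have "real (Suc k) * c b x \<le> 0" by (intro mult_nonneg_nonpos) auto
    then have "bump_exp (real (Suc k) * c b x) = 0" by (simp add: bump_exp_eq_0_iff)
    with b(1) show ?thesis unfolding \<phi>_def by (intro prod_zero) auto
  qed
  show "\<phi> k \<in> test_functions \<Omega>" for k
  proof (rule test_functionsI[OF _ compact_cbox assms(1)])
    show "Ck j (\<phi> k)" for j
      unfolding \<phi>_def[abs_def] c_def by (intro Ck_prod Ck_bump_exp Ck_mult Ck_diff Ck_inner Ck_const)
    show "\<phi> k x = 0" if "x \<notin> cbox l u" for x
      using that zero box_subset_cbox[of l u] by blast
  qed
  show "\<bar>\<phi> k x\<bar> \<le> indicator (cbox l u) x" for k x
  proof (cases "x \<in> cbox l u")
    case True
    have "\<bar>\<phi> k x\<bar> \<le> 1" unfolding \<phi>_def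
      by (simp add: prod_nonneg prod_le_1 bump_exp_le_1)
    with True show ?thesis by simp
  next
    case False
    then have "x \<notin> box l u" using box_subset_cbox[of l u] by blast
    then show ?thesis using zero by simp
  qed
  show "(\<lambda>k. \<phi> k x) \<longlonglongrightarrow> indicator (box l u) x" for x
  proof (cases "x \<in> box l u")
    case True
    have "(\<lambda>k. bump_exp (real (Suc k) * c b x)) \<longlonglongrightarrow> 1" if b: "b \<in> Basis" for b
    proof -
      have c: "c b x > 0" using True b by (auto simp: c_def mem_box)
      have "(\<lambda>k. exp (- (inverse (real (Suc k)) * inverse (c b x)))) \<longlonglongrightarrow> exp (- (0 * inverse (c b x)))"
        by (intro tendsto_intros LIMSEQ_inverse_real_of_nat)
      moreover have "bump_exp (real (Suc k) * c b x) = exp (- (inverse (real (Suc k)) * inverse (c b x)))" for k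
        using mult_pos_pos[of "real (Suc k)", OF _ c] by (simp add: bump_exp_def divide_inverse)
      ultimately show ?thesis by simp
    qed
    then have "(\<lambda>k. \<phi> k x) \<longlonglongrightarrow> (\<Prod>b\<in>(Basis::'a set). 1)"
      unfolding \<phi>_def by (rule tendsto_prod)
    with True show ?thesis by simp
  next
    case False
    then show ?thesis using zero[OF False] by simp
  qed
qed

text \<open>Test functions converging to indicators of boxes show that h has integral 0 over every
  closed box in the domain. Differentiating these integrals over shrinking cubes recovers h almost
  everywhere, first inside one box and then on a countable cover.\<close>

lemma fundamental_lemma_calculus_of_variations:
  fixes h :: "'a::euclidean_space \<Rightarrow> 'b::euclidean_space"
  assumes \<Omega>: "open \<Omega>" and h: "h locally_integrable_on \<Omega>"
    and zero: "\<And>\<phi>. \<phi> \<in> test_functions \<Omega> \<Longrightarrow> (LINT x|lebesgue_on \<Omega>. \<phi> x *\<^sub>R h x) = 0"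
  shows "AE x in lebesgue_on \<Omega>. h x = 0"
proof -
  have \<Omega>s: "\<Omega> \<in> sets lebesgue" using \<Omega> by auto
  have box: "integral (cbox l u) h = 0" if lu: "cbox l u \<subseteq> \<Omega>" "box l u \<noteq> {}" for l u
  proof -
    obtain \<phi> where \<phi>: "\<And>k. \<phi> k \<in> test_functions \<Omega>" "\<And>k x. \<bar>\<phi> k x\<bar> \<le> indicator (cbox l u) x"
        "\<And>x. (\<lambda>k. \<phi> k x) \<longlonglongrightarrow> indicator (box l u) x"
      using box_indicator_limit_of_test_functions[OF lu] by blast
    have hK: "integrable (lebesgue_on (cbox l u)) h"
      using h lu by (auto simp: locally_integrable_on_def)
    have ind: "integrable (lebesgue_on (cbox l u)) (\<lambda>x. indicator (cbox l u) x *\<^sub>R h x)"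
      by (subst Bochner_Integration.integrable_cong[OF refl, where g=h]) (auto simp: hK)
    have "integrable (lebesgue_on \<Omega>) (\<lambda>x. indicator (cbox l u) x *\<^sub>R h x)"
      by (rule integrable_lebesgue_on_superset[OF lu(1) _ \<Omega>s _ ind]) auto
    moreover have "norm (indicator (cbox l u) x *\<^sub>R h x) = indicator (cbox l u) x * norm (h x)" for x
      by (simp add: indicator_def)
    ultimately have dom: "integrable (lebesgue_on \<Omega>) (\<lambda>x. indicator (cbox l u) x * norm (h x))"
      using integrable_norm by force
    have meas: "(\<lambda>x. \<phi> k x *\<^sub>R h x) \<in> borel_measurable (lebesgue_on \<Omega>)" for k
    proof (rule borel_measurable_integrable)
      obtain K where "compact K" "K \<subseteq> \<Omega>" "\<And>x. x \<notin> K \<Longrightarrow> \<phi> k x = 0" "\<And>x. x \<notin> K \<Longrightarrow> grad (\<phi> k) x = 0"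
        using test_functionE[OF \<phi>(1)[of k]] by blast
      then show "integrable (lebesgue_on \<Omega>) (\<lambda>x. \<phi> k x *\<^sub>R h x)"
        by (intro integrable_locally_integrable_mult[OF h \<Omega> test_function_continuous[OF \<phi>(1)[of k]]])
    qed
    have lim: "(\<lambda>k. \<phi> k x *\<^sub>R h x) \<longlonglongrightarrow> indicator (box l u) x *\<^sub>R h x" for x
      using \<phi>(3) by (intro tendsto_intros)
    have "(\<lambda>k. LINT x|lebesgue_on \<Omega>. \<phi> k x *\<^sub>R h x) \<longlonglongrightarrow> (LINT x|lebesgue_on \<Omega>. indicator (box l u) x *\<^sub>R h x)"
    proof (rule integral_dominated_convergence[OF _ meas dom])
      show "(\<lambda>x. indicator (box l u) x *\<^sub>R h x) \<in> borel_measurable (lebesgue_on \<Omega>)"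
        by (rule borel_measurable_LIMSEQ_metric[OF meas lim])
      have "norm (\<phi> k x *\<^sub>R h x) \<le> indicator (cbox l u) x * norm (h x)" for k x
        using \<phi>(2)[of k x] by (simp add: mult_right_mono)
      then show "AE x in lebesgue_on \<Omega>. norm (\<phi> k x *\<^sub>R h x) \<le> indicator (cbox l u) x * norm (h x)" for k
        by simp
    qed (use lim in simp)
    then have "(LINT x|lebesgue_on \<Omega>. indicator (box l u) x *\<^sub>R h x) = 0"
      using zero[OF \<phi>(1)] by (simp add: LIMSEQ_const_iff)
    moreover have "(\<lambda>x. if x \<in> \<Omega> then indicator (box l u) x *\<^sub>R h x else 0) = (\<lambda>x. indicator (box l u) x *\<^sub>R h x)"
      using lu box_subset_cbox[of l u] by (auto simp: indicator_def fun_eq_iff)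
    ultimately have "(LINT x|lebesgue. indicator (box l u) x *\<^sub>R h x) = 0"
      using Lebesgue_Measure.integral_restrict_UNIV[OF \<Omega>s, of "\<lambda>x. indicator (box l u) x *\<^sub>R h x"] by simp
    moreover have "set_integrable lebesgue (cbox l u) h"
      using hK by (simp add: set_integrable_def integrable_restrict_space)
    then have "set_integrable lebesgue (box l u) h"
      by (rule set_integrable_subset) (auto simp: box_subset_cbox)
    note set_lebesgue_integral_eq_integral(2)[OF this]
    ultimately have "integral (box l u) h = 0"
      by (simp add: set_lebesgue_integral_def)
    then show ?thesis by (simp add: integral_open_interval)
  qed
  have local: "AE x in lebesgue. x \<in> box a b \<longrightarrow> h x = 0" if ab: "cbox a b \<subseteq> \<Omega>" for a b
  proof -
    define f where "f = (\<lambda>x. if x \<in> cbox a b then h x else 0)"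
    have "integrable (lebesgue_on (cbox a b)) h"
      using h ab by (auto simp: locally_integrable_on_def)
    then have fU: "f integrable_on UNIV"
      unfolding f_def by (intro integrable_on_lebesgue)
        (simp add: Lebesgue_Measure.integrable_restrict_UNIV)
    then have "f integrable_on cbox c d" for c d
      using integrable_on_subcbox by blast
    from integrable_ccontinuous_explicit[OF this] obtain N where
      N: "negligible N" "\<And>x e. \<lbrakk>x \<notin> N; 0 < e\<rbrakk> \<Longrightarrow>
               \<exists>d>0. \<forall>t. 0 < t \<and> t < d \<longrightarrow>
                         norm(integral (cbox x (x + t *\<^sub>R One)) f /\<^sub>R t ^ DIM('a) - f x) < e"
      by blast
    have "h x = 0" if x: "x \<in> box a b" "x \<notin> N" for x
    proof -
      have "norm (f x) \<le> e" if e: "e > 0" for e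
      proof -
        obtain d where d: "d > 0" "\<And>t. 0 < t \<Longrightarrow> t < d \<Longrightarrow>
            norm(integral (cbox x (x + t *\<^sub>R One)) f /\<^sub>R t ^ DIM('a) - f x) < e"
          using N(2)[OF x(2) e] by blast
        \<comment> \<open>Small enough that the cubes with corner x and side below m stay inside the
          box, where their integrals are known to vanish, and within the range d of the
          differentiation theorem.\<close>
        define m where "m = Min (insert d ((\<lambda>i. (b \<bullet> i - x \<bullet> i)) ` Basis))"
        have m: "m > 0" "m \<le> d" "\<And>i. i \<in> Basis \<Longrightarrow> m \<le> b \<bullet> i - x \<bullet> i"
        proof -
          show "m > 0" using d x by (auto simp: m_def mem_box)
          show "m \<le> d" unfolding m_def by (rule Min_le) auto
          show "m \<le> b \<bullet> i - x \<bullet> i" if "i \<in> Basis" for i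
            unfolding m_def using that by (intro Min_le) auto
        qed
        define t where "t = m / 2"
        have t: "0 < t" "t < d" using m by (auto simp: t_def)
        have sub: "cbox x (x + t *\<^sub>R One) \<subseteq> cbox a b"
        proof (intro subsetI)
          fix y assume y: "y \<in> cbox x (x + t *\<^sub>R One)"
          show "y \<in> cbox a b"
            unfolding mem_box
          proof
            fix i :: 'a assume i: "i \<in> Basis"
            have "x \<bullet> i \<le> y \<bullet> i" "y \<bullet> i \<le> x \<bullet> i + t"
              using y i by (auto simp: mem_box inner_add_left)
            then show "a \<bullet> i \<le> y \<bullet> i \<and> y \<bullet> i \<le> b \<bullet> i"
              using m(3)[OF i] m(1) x(1) i by (force simp: t_def mem_box)
          qed
        qed
        have "integral (cbox x (x + t *\<^sub>R One)) f = integral (cbox x (x + t *\<^sub>R One)) h"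
          using sub by (intro Henstock_Kurzweil_Integration.integral_cong) (auto simp: f_def)
        also have "\<dots> = 0"
          using sub ab t by (intro box) (auto simp: box_ne_empty inner_add_left)
        finally show ?thesis using d(2)[OF t] by simp
      qed
      then have "f x = 0" using field_le_epsilon[of "norm (f x)" 0] by simp
      then show ?thesis using x box_subset_cbox[of a b] by (auto simp: f_def)
    qed
    then show ?thesis
      using N(1) by (intro AE_I'[of N]) (auto simp: negligible_iff_null_sets)
  qed
  obtain \<D> where \<D>: "countable \<D>" "\<D> \<subseteq> Pow \<Omega>" "\<And>X. X \<in> \<D> \<Longrightarrow> \<exists>a b. X = cbox a b" "\<Union>\<D> = \<Omega>"
    by (rule open_countable_Union_open_cbox[OF \<Omega>]) (rule that; assumption)
  have "AE x in lebesgue. x \<in> X \<longrightarrow> h x = 0" if "X \<in> \<D>" for X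
  proof -
    from \<D>(3)[OF that] obtain a b where X: "X = cbox a b" by blast
    \<comment> \<open>The cover consists of closed boxes but the local statement concerns open ones;
      they differ by a null set.\<close>
    have "negligible (cbox a b - box a b)" by (rule negligible_frontier_interval)
    then have "AE x in lebesgue. x \<notin> cbox a b - box a b"
      by (intro AE_not_in) (simp add: negligible_iff_null_sets)
    moreover have "AE x in lebesgue. x \<in> box a b \<longrightarrow> h x = 0"
      using \<D>(2) that X by (intro local) auto
    ultimately show ?thesis unfolding X by eventually_elim auto
  qed
  then have "AE x in lebesgue. \<forall>X\<in>\<D>. x \<in> X \<longrightarrow> h x = 0"
    using AE_ball_countable[OF \<D>(1), of "\<lambda>x X. x \<in> X \<longrightarrow> h x = 0" lebesgue] by blast
  then have "AE x in lebesgue. x \<in> \<Omega> \<longrightarrow> h x = 0"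
    using \<D>(4) by (auto elim!: eventually_mono)
  then show ?thesis using \<Omega>s by (simp add: AE_restrict_space_iff)
qed

lemma weak_gradient_unique:
  assumes \<Omega>: "open \<Omega>" and g: "has_weak_gradient \<Omega> u g" "has_weak_gradient \<Omega> u g'"
  shows "AE x in lebesgue_on \<Omega>. g x = g' x"
proof -
  have li: "g locally_integrable_on \<Omega>" "g' locally_integrable_on \<Omega>"
    using g by (auto simp: has_weak_gradient_def)
  have "AE x in lebesgue_on \<Omega>. g x - g' x = 0"
  proof (rule fundamental_lemma_calculus_of_variations[OF \<Omega>])
    show "(\<lambda>x. g x - g' x) locally_integrable_on \<Omega>"
      using li by (auto simp: locally_integrable_on_def)
    fix \<phi> assume \<phi>: "\<phi> \<in> test_functions \<Omega>"
    obtain K where "compact K" "K \<subseteq> \<Omega>" "\<And>x. x \<notin> K \<Longrightarrow> \<phi> x = 0" "\<And>x. x \<notin> K \<Longrightarrow> grad \<phi> x = 0"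
      using test_functionE[OF \<phi>] by blast
    then have "integrable (lebesgue_on \<Omega>) (\<lambda>x. \<phi> x *\<^sub>R g x)" "integrable (lebesgue_on \<Omega>) (\<lambda>x. \<phi> x *\<^sub>R g' x)"
      using integrable_locally_integrable_mult[OF li(1) \<Omega> test_function_continuous[OF \<phi>]]
        integrable_locally_integrable_mult[OF li(2) \<Omega> test_function_continuous[OF \<phi>]] by simp_all
    moreover have "(LINT x|lebesgue_on \<Omega>. \<phi> x *\<^sub>R g x) = (LINT x|lebesgue_on \<Omega>. \<phi> x *\<^sub>R g' x)"
    proof -
      have "- (LINT x|lebesgue_on \<Omega>. \<phi> x *\<^sub>R g x) = - (LINT x|lebesgue_on \<Omega>. \<phi> x *\<^sub>R g' x)"
        using g[unfolded has_weak_gradient_def, THEN conjunct2, THEN conjunct2, THEN bspec, OF \<phi>] by simp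
      then show ?thesis by simp
    qed
    ultimately show "(LINT x|lebesgue_on \<Omega>. \<phi> x *\<^sub>R (g x - g' x)) = 0"
      by (simp add: scaleR_diff_right)
  qed
  then show ?thesis by simp
qed

lemma weak_grad_works: "has_weak_gradient \<Omega> u g \<Longrightarrow> has_weak_gradient \<Omega> u (weak_grad \<Omega> u)"
  unfolding weak_grad_def by (rule someI[of "has_weak_gradient \<Omega> u"])

text \<open>\<open>weak_grad\<close> is an arbitrary choice among the weak gradients, so any
  concrete computation with it must pass through this identification.\<close>

lemma weak_grad_AE_eq:
  assumes "open \<Omega>" "has_weak_gradient \<Omega> u g"
  shows "AE x in lebesgue_on \<Omega>. weak_grad \<Omega> u x = g x"
  by (rule weak_gradient_unique[OF assms(1) weak_grad_works[OF assms(2)] assms(2)])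

section \<open>The subcritical Sobolev inequality\<close>

text \<open>Balls and intervals enter the Sobolev argument as densities of \<open>lborel\<close> and
  not as restricted spaces: every measure then lives on the whole space with the Borel sets, which
  keeps Fubini and measurability uniform.\<close>

lemma finite_measure_density_indicator:
  fixes A :: "'a::euclidean_space set"
  assumes "bounded A" "A \<in> sets borel"
  shows "finite_measure (density lborel (indicator A))"
  using assms emeasure_bounded_finite[of A]
  by (intro finite_measureI) (auto simp: emeasure_density)

lemma LINT_density_indicator:
  fixes f :: "'a::euclidean_space \<Rightarrow> real"
  assumes "f \<in> borel_measurable borel" "A \<in> sets borel"
  shows "(LINT x|density lborel (indicator A). f x) = (LINT x|lborel. indicator A x * f x)"
  using integral_density[of f lborel "indicator A"] assms
  by (simp add: ennreal_indicator)

lemma LINT_density_indicator_le: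
  fixes f :: "'a::euclidean_space \<Rightarrow> real"
  assumes "integrable lborel f" "A \<in> sets borel" "\<And>x. f x \<ge> 0"
  shows "(LINT x|density lborel (indicator A). f x) \<le> (LINT x|lborel. f x)"
proof -
  have "(LINT x|density lborel (indicator A). f x) = (LINT x|lborel. indicator A x *\<^sub>R f x)"
    using assms LINT_density_indicator[of f A] by simp
  also have "\<dots> \<le> (LINT x|lborel. f x)"
  proof (rule integral_mono)
    show "integrable lborel (\<lambda>x. indicator A x *\<^sub>R f x)"
      using assms by (intro integrable_mult_indicator) auto
    show "indicator A x *\<^sub>R f x \<le> f x" for x using assms(3) by (simp add: indicator_def)
  qed (use assms in simp)
  finally show ?thesis .
qed

lemma AE_density_indicator:
  fixes A :: "'a::euclidean_space set"
  assumes "A \<in> sets borel"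
  shows "AE x in density lborel (indicator A). x \<in> A"
  using assms by (subst AE_density) (auto simp: indicator_def)

text \<open>Bounded measurable integrands on finite measures are integrable on the product, and test
  functions give rise only to such integrands.\<close>

lemma Fubini_bounded:
  fixes f :: "'a \<Rightarrow> 'b \<Rightarrow> real"
  assumes "finite_measure M" "finite_measure N"
    and f: "(\<lambda>(x, y). f x y) \<in> borel_measurable (M \<Otimes>\<^sub>M N)" and B: "\<And>x y. \<bar>f x y\<bar> \<le> B"
  shows "(LINT x|M. LINT y|N. f x y) = (LINT y|N. LINT x|M. f x y)"
    and "integrable M (\<lambda>x. LINT y|N. f x y)" and "integrable N (\<lambda>y. LINT x|M. f x y)"
proof -
  interpret M: finite_measure M by fact
  interpret N: finite_measure N by fact
  interpret MN: pair_sigma_finite M N ..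
  interpret P: finite_measure "M \<Otimes>\<^sub>M N"
    by (intro finite_measureI) (auto simp: space_pair_measure N.emeasure_pair_measure_Times
        M.emeasure_eq_measure N.emeasure_eq_measure ennreal_mult_eq_top_iff)
  have "integrable (M \<Otimes>\<^sub>M N) (case_prod f)"
    using f B by (intro P.integrable_const_bound[of _ B]) (auto intro!: AE_I2)
  then show "(LINT x|M. LINT y|N. f x y) = (LINT y|N. LINT x|M. f x y)"
    "integrable M (\<lambda>x. LINT y|N. f x y)" "integrable N (\<lambda>y. LINT x|M. f x y)"
    using MN.Fubini_integral[of f] MN.integrable_fst[of f] MN.integrable_snd[of f] by auto
qed

lemma integral_scale_translate:
  fixes f :: "'a::euclidean_space \<Rightarrow> real"
  assumes f: "integrable lborel f" and t: "t > 0"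
  shows "integrable lborel (\<lambda>w. f (x + t *\<^sub>R w))"
    and "(LINT w|lborel. f (x + t *\<^sub>R w)) = (LINT w|lborel. f w) / t ^ DIM('a)"
proof -
  have [measurable]: "f \<in> borel_measurable borel" using f by simp
  have L: "lborel = density (distr lborel borel (\<lambda>w. x + t *\<^sub>R w)) (\<lambda>_. ennreal (t ^ DIM('a)))"
    using lborel_affine[of t x] t by simp
  have "integrable (density (distr lborel borel (\<lambda>w. x + t *\<^sub>R w)) (\<lambda>_. ennreal (t ^ DIM('a)))) f"
    using f unfolding L[symmetric] .
  then show i: "integrable lborel (\<lambda>w. f (x + t *\<^sub>R w))"
    using t by (subst (asm) integrable_density) (auto simp: integrable_distr_eq)
  have "(LINT w|lborel. f w) = (LINT w|density (distr lborel borel (\<lambda>w. x + t *\<^sub>R w)) (\<lambda>_. ennreal (t ^ DIM('a))). f w)"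
    unfolding L[symmetric] ..
  also have "\<dots> = t ^ DIM('a) * (LINT w|lborel. f (x + t *\<^sub>R w))"
    using t by (subst integral_density) (auto simp: integral_distr)
  finally show "(LINT w|lborel. f (x + t *\<^sub>R w)) = (LINT w|lborel. f w) / t ^ DIM('a)"
    using t by (simp add: field_simps)
qed

lemma integrable_powr_from_0:
  fixes a T :: real
  assumes "a > -1" "T \<ge> 0"
  shows "integrable lborel (\<lambda>t. indicator {0..T} t * t powr a)"
proof -
  have "(\<lambda>t. t powr a) absolutely_integrable_on {0..T}"
    using has_integral_powr_from_0[OF assms] by (intro nonnegative_absolutely_integrable_1) auto
  then have "integrable lebesgue (\<lambda>t. indicator {0..T} t * t powr a)"
    by (simp add: set_integrable_def)
  then show ?thesis by (subst (asm) integrable_completion) auto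
qed

lemma line_integral_bound:
  fixes \<phi> :: "'a::euclidean_space \<Rightarrow> real"
  assumes der: "\<And>x. (\<phi> has_derivative (\<lambda>h. G x \<bullet> h)) (at x)" and G: "continuous_on UNIV G"
    and T: "T \<ge> 0" and zero: "\<phi> (x + T *\<^sub>R w) = 0"
  shows "\<bar>\<phi> x\<bar> \<le> norm w * (LINT t|density lborel (indicator {0..T}). norm (G (x + t *\<^sub>R w)))"
proof -
  have "((\<lambda>t. \<phi> (x + t *\<^sub>R w)) has_vector_derivative G (x + t *\<^sub>R w) \<bullet> w) (at t within {0..T})" for t
  proof -
    have "((\<lambda>t. \<phi> (x + t *\<^sub>R w)) has_derivative (\<lambda>s. G (x + t *\<^sub>R w) \<bullet> (s *\<^sub>R w))) (at t within {0..T})"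
      by (rule has_derivative_compose[where g=\<phi>, of "\<lambda>t. x + t *\<^sub>R w" "\<lambda>s. s *\<^sub>R w"])
        (auto intro!: derivative_eq_intros simp: der)
    then show ?thesis unfolding has_vector_derivative_def
      by (rule has_derivative_eq_rhs) (auto simp: fun_eq_iff)
  qed
  then have I: "((\<lambda>t. G (x + t *\<^sub>R w) \<bullet> w) has_integral (\<phi> (x + T *\<^sub>R w) - \<phi> (x + 0 *\<^sub>R w))) {0..T}"
    using T by (intro fundamental_theorem_of_calculus) auto
  have cont: "continuous_on UNIV (\<lambda>t. norm (G (x + t *\<^sub>R w)))"
    using G by (intro continuous_intros continuous_on_compose2[OF G]) auto
  then have J: "(\<lambda>t. norm w * norm (G (x + t *\<^sub>R w))) integrable_on {0..T}"
    by (intro integrable_continuous_interval continuous_on_mult_left) (auto intro: continuous_on_subset)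
  have "norm (integral {0..T} (\<lambda>t. G (x + t *\<^sub>R w) \<bullet> w)) \<le> integral {0..T} (\<lambda>t. norm w * norm (G (x + t *\<^sub>R w)))"
    using I J
  proof (intro integral_norm_bound_integral)
    show "norm (G (x + t *\<^sub>R w) \<bullet> w) \<le> norm w * norm (G (x + t *\<^sub>R w))" for t
      using Cauchy_Schwarz_ineq2[of "G (x + t *\<^sub>R w)" w] by (simp add: mult.commute)
  qed auto
  moreover have "integral {0..T} (\<lambda>t. G (x + t *\<^sub>R w) \<bullet> w) = - \<phi> x"
    using I zero by (simp add: integral_unique)
  moreover have "integral {0..T} (\<lambda>t. norm (G (x + t *\<^sub>R w))) = (LINT t|density lborel (indicator {0..T}). norm (G (x + t *\<^sub>R w)))"
  proof -
    have m: "(\<lambda>t. norm (G (x + t *\<^sub>R w))) \<in> borel_measurable borel"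
      using cont by (intro borel_measurable_continuous_onI)
    have "set_integrable lborel {0..T} (\<lambda>t. norm (G (x + t *\<^sub>R w)))"
      using cont by (intro borel_integrable_atLeastAtMost') (auto intro: continuous_on_subset)
    from set_borel_integral_eq_integral(2)[OF this] show ?thesis
      using LINT_density_indicator[OF m, of "{0..T}"]
      by (simp add: set_lebesgue_integral_def)
  qed
  ultimately show ?thesis by (simp add: integral_mult_right)
qed

text \<open>The exponent is that of t in the final integral, after Jensen's inequality with the
  weight \<open>t powr (-\<theta>)\<close>. At \<theta> = 1 it equals D - 1, and D > 0 is the
  subcriticality of s. The weight itself needs \<theta> < 1 to be integrable, so \<theta> is lowered
  by \<delta>, which costs \<delta> (s - 1) < D.\<close>

lemma sobolev_exponent_weight:
  fixes n p s :: real
  assumes "1 < p" "p < s" "s * (n - p) < n * p"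
  obtains \<theta> where "0 \<le> \<theta>" "\<theta> < 1" "\<theta> * s - \<theta> - n * (s - p) / p > -1"
proof -
  define D where "D = s - n * (s - p) / p"
  have D: "D > 0" using assms by (simp add: D_def field_simps)
  define \<delta> where "\<delta> = min 1 (D / s)"
  have \<delta>: "0 < \<delta>" "\<delta> \<le> 1" "\<delta> \<le> D / s" using D assms by (auto simp: \<delta>_def)
  have "\<delta> * (s - 1) \<le> D / s * (s - 1)" using \<delta> assms by (intro mult_right_mono) auto
  also have "\<dots> < D" using D assms by (simp add: field_simps)
  finally have "(1 - \<delta>) * s - (1 - \<delta>) - n * (s - p) / p > -1"
    by (simp add: D_def algebra_simps)
  with \<delta> that[of "1 - \<delta>"] show thesis by auto
qed

text \<open>
  Averaging the fundamental theorem of calculus along the rays \<open>x + t w\<close> over \<open>w\<close> in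
  \<open>A = ball c 1\<close>, \<open>|c| = 2\<close>, gives \<open>|\<phi> x| \<le> C \<integral>\<^sub>0\<^sup>T M t x dt\<close>, where \<open>M t x\<close> is the integral of
  \<open>|\<nabla>\<phi>(x + t w)|\<close> over \<open>A\<close>. Interpolating \<open>M t x \<le> C t\<^bsup>-n/p\<^esup> \<parallel>\<nabla>\<phi>\<parallel>\<^sub>p\<close> and
  \<open>\<parallel>M t\<parallel>\<^sub>p \<le> C \<parallel>\<nabla>\<phi>\<parallel>\<^sub>p\<close> yields \<open>\<parallel>M t\<parallel>\<^sub>s \<le> C t\<^bsup>-n(1/p-1/s)\<^esup> \<parallel>\<nabla>\<phi>\<parallel>\<^sub>p\<close>, which is integrable at
  \<open>t = 0\<close> exactly for subcritical \<open>s\<close>. The weight \<open>t\<^bsup>-\<theta>\<^esup>\<close> replaces Minkowski's integral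
  inequality by Jensen's.
\<close>

lemma sobolev_subcritical_above:
  fixes \<Omega> :: "'a::euclidean_space set" and p s :: real
  assumes bd: "bounded \<Omega>" and p: "1 < p" "p < s" "s * (real DIM('a) - p) < real DIM('a) * p"
  shows "\<exists>C\<ge>0. \<forall>\<phi>\<in>test_functions \<Omega>.
    (LINT x|lborel. \<bar>\<phi> x\<bar> powr s) \<le> C * (LINT x|lborel. norm (grad \<phi> x) powr p) powr (s / p)"
proof -
  let ?n = "real DIM('a)"
  obtain \<theta> where \<theta>: "0 \<le> \<theta>" "\<theta> < 1" "\<theta> * s - \<theta> - ?n * (s - p) / p > -1"
    using sobolev_exponent_weight[OF p] by blast
  obtain R where R: "R > 0" "\<Omega> \<subseteq> ball 0 R" using bd bounded_subset_ballD by blast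
  obtain c :: 'a where c: "norm c = 2" using vector_choose_size[of 2] by auto
  \<comment> \<open>The directions w in A have norm at least 1, so x + T w lies outside the ball of
    radius R for every x in it, and test functions vanish there.\<close>
  define T where "T = 2 * R"
  define A where "A = ball c 1"
  define MA where "MA = density lborel (indicator A :: 'a \<Rightarrow> ennreal)"
  define MX where "MX = density lborel (indicator (ball 0 R) :: 'a \<Rightarrow> ennreal)"
  define MT where "MT = density lborel (indicator {0..T} :: real \<Rightarrow> ennreal)"
  \<comment> \<open>The weighted measure for Jensen's inequality in t, finite because \<theta> <
    1.\<close>
  define \<nu> where "\<nu> = density lborel (\<lambda>t. ennreal (indicator {0..T} t * t powr (- \<theta>)))"
  have T: "T > 0" using R by (simp add: T_def)
  have fin: "finite_measure MA" "finite_measure MX" "finite_measure MT"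
    unfolding MA_def MX_def MT_def A_def by (auto intro!: finite_measure_density_indicator)
  have "(\<integral>\<^sup>+t. ennreal (indicator {0..T} t * t powr (- \<theta>)) \<partial>lborel) < \<infinity>"
    using integrable_powr_from_0[of "-\<theta>" T] \<theta> T
    by (subst nn_integral_eq_integral) auto
  then have fin\<nu>: "finite_measure \<nu>"
    unfolding \<nu>_def by (intro finite_measureI) (auto simp: emeasure_density)
  have sets [measurable_cong, simp]: "sets MA = sets borel" "sets MX = sets borel" "sets MT = sets borel" "sets \<nu> = sets borel"
    by (simp_all add: MA_def MX_def MT_def \<nu>_def)
  have sp [simp]: "space MA = UNIV" "space MX = UNIV" "space MT = UNIV" "space \<nu> = UNIV"
    by (simp_all add: MA_def MX_def MT_def \<nu>_def)
  interpret MA: finite_measure MA by fact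
  interpret MX: finite_measure MX by fact
  interpret MT: finite_measure MT by fact
  interpret \<nu>: finite_measure \<nu> by fact
  define a where "a = measure MA UNIV"
  have a: "a > 0"
  proof -
    have "emeasure MA UNIV = emeasure lborel A"
      unfolding MA_def by (subst emeasure_density) (auto simp: A_def intro!: borel_measurable_indicator)
    then have "a = measure lborel A"
      by (simp add: a_def measure_def)
    moreover have "measure lborel A > 0" unfolding A_def by (rule content_ball_pos) simp
    ultimately show ?thesis by simp
  qed
  define m where "m = measure \<nu> UNIV"
  define K where "K = (LINT t|\<nu>. t powr (\<theta> * s) * t powr (- ?n * (s - p) / p))"
  \<comment> \<open>3 bounds the norm of w on A and 1/a comes from averaging over A; the power of m
    is Jensen's factor in t; the bracket collects the interpolation constants and the t-integral
    K.\<close>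
  define C where "C = (3 / a) powr s * m powr (s - 1) * (a powr ((p - 1) * (s - p) / p) * a powr p * K)"
  have K_int: "integrable \<nu> (\<lambda>t. t powr (\<theta> * s) * t powr (- ?n * (s - p) / p))"
  proof -
    have "integrable lborel (\<lambda>t. indicator {0..T} t * t powr (\<theta> * s - \<theta> - ?n * (s - p) / p))"
      using \<theta>(3) T by (intro integrable_powr_from_0) auto
    moreover have "(indicator {0..T} t * t powr (- \<theta>)) *\<^sub>R (t powr (\<theta> * s) * t powr (- ?n * (s - p) / p))
      = indicator {0..T} t * t powr (\<theta> * s - \<theta> - ?n * (s - p) / p)" for t
      by (auto simp: indicator_def powr_add[symmetric] algebra_simps diff_divide_distrib)
    ultimately have "integrable lborel (\<lambda>t. (indicator {0..T} t * t powr (- \<theta>)) *\<^sub>R (t powr (\<theta> * s) * t powr (- ?n * (s - p) / p)))"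
      by presburger
    then show ?thesis unfolding \<nu>_def by (subst integrable_density) auto
  qed
  have K0: "K \<ge> 0" unfolding K_def by (intro integral_nonneg_AE) auto
  have C0: "C \<ge> 0" unfolding C_def using K0 by simp
  show ?thesis
  proof (intro exI[of _ C] conjI C0 ballI)
    fix \<phi> assume \<phi>: "\<phi> \<in> test_functions \<Omega>"
    obtain Q where Q: "compact Q" "Q \<subseteq> \<Omega>" "\<And>x. x \<notin> Q \<Longrightarrow> \<phi> x = 0" "\<And>x. x \<notin> Q \<Longrightarrow> grad \<phi> x = 0"
      using test_functionE[OF \<phi>] by blast
    note der = test_function_has_gradient[OF \<phi>]
      and cont = test_function_continuous[OF \<phi>] test_function_continuous_grad[OF \<phi>]
    define g where "g x = norm (grad \<phi> x)" for x
    have gc: "continuous_on UNIV g" unfolding g_def[abs_def] using cont by (intro continuous_intros)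
    have gm [measurable]: "g \<in> borel_measurable borel" using gc by (rule borel_measurable_continuous_onI)
    have \<phi>m [measurable]: "\<phi> \<in> borel_measurable borel" using cont(1) by (rule borel_measurable_continuous_onI)
    have g0: "g x \<ge> 0" for x by (simp add: g_def)
    obtain B where B: "B > 0" "\<And>x. g x \<le> B"
      using compact_support_bounded[OF cont(2) Q(1,4)] unfolding g_def by blast
    define N where "N = (LINT x|lborel. g x powr p)"
    have Nint: "integrable lborel (\<lambda>x. g x powr p)"
      using Q p by (intro integrable_lborel_compact_support[OF _ Q(1)] continuous_on_powr' gc continuous_intros)
        (auto simp: g_def)
    have N0: "N \<ge> 0" by (simp add: N_def)
    define M where "M t x = (LINT w|MA. g (x + t *\<^sub>R w))" for t x
    have M0: "0 \<le> M t x" for t x unfolding M_def using g0 by (intro integral_nonneg_AE) auto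
    have MB: "M t x \<le> a * B" for t x
    proof -
      have "M t x \<le> (LINT w|MA. B)"
        unfolding M_def using B g0 by (intro integral_mono MA.integrable_const_bound[of _ B]) auto
      then show ?thesis by (simp add: a_def)
    qed
    have Mm [measurable]: "(\<lambda>(t, x). M t x) \<in> borel_measurable (borel \<Otimes>\<^sub>M borel)"
      unfolding M_def by measurable
    have 1: "\<bar>\<phi> x\<bar> \<le> 3 / a * (LINT t|MT. M t x)" if x: "x \<in> ball 0 R" for x
    proof -
      have Fub: "(LINT w|MA. LINT t|MT. g (x + t *\<^sub>R w)) = (LINT t|MT. M t x)"
        "integrable MA (\<lambda>w. LINT t|MT. g (x + t *\<^sub>R w))"
        unfolding M_def using B g0
        by (intro Fubini_bounded[where f="\<lambda>w t. g (x + t *\<^sub>R w)" and B=B] fin; simp add: split_beta')+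
      have "\<bar>\<phi> x\<bar> \<le> 3 * (LINT t|MT. g (x + t *\<^sub>R w))" if w: "w \<in> A" for w
      proof -
        have "norm w \<le> norm c + norm (w - c)" using norm_triangle_ineq[of c "w - c"] by simp
        moreover have "norm c \<le> norm w + norm (c - w)" using norm_triangle_ineq[of w "c - w"] by simp
        moreover have "norm (w - c) < 1" using w by (simp add: A_def dist_norm norm_minus_commute)
        ultimately have nw: "norm w \<le> 3" "norm w \<ge> 1" using c by (auto simp: norm_minus_commute)
        have "norm (T *\<^sub>R w) \<le> norm (x + T *\<^sub>R w) + norm x"
          using norm_triangle_ineq4[of "x + T *\<^sub>R w" x] by simp
        moreover have "norm (T *\<^sub>R w) \<ge> T" using nw T by simp
        ultimately have "x + T *\<^sub>R w \<notin> ball 0 R" using x by (simp add: T_def)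
        then have "\<phi> (x + T *\<^sub>R w) = 0" using Q(2,3) R(2) by blast
        from line_integral_bound[OF der cont(2) _ this] T
        have "\<bar>\<phi> x\<bar> \<le> norm w * (LINT t|MT. g (x + t *\<^sub>R w))" by (simp add: MT_def g_def)
        also have "\<dots> \<le> 3 * (LINT t|MT. g (x + t *\<^sub>R w))"
          using nw g0 by (intro mult_right_mono integral_nonneg_AE) auto
        finally show ?thesis .
      qed
      then have "AE w in MA. \<bar>\<phi> x\<bar> \<le> 3 * (LINT t|MT. g (x + t *\<^sub>R w))"
        using AE_density_indicator[of A] unfolding MA_def A_def by (auto elim!: eventually_mono)
      then have "(LINT w|MA. \<bar>\<phi> x\<bar>) \<le> (LINT w|MA. 3 * (LINT t|MT. g (x + t *\<^sub>R w)))"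
        using Fub(2) by (intro integral_mono_AE) auto
      then show ?thesis using a by (simp add: Fub(1) a_def field_simps)
    qed
    \<comment> \<open>Undoes the weight in \<nu>: writing M as the weight times r M before applying
      Jensen's inequality puts the factor \<open>t powr (\<theta> * s)\<close> into h, which
      compensates the singularity at t = 0.\<close>
    define r where "r t = indicator {0..T} t * t powr \<theta>" for t :: real
    have rm [measurable]: "r \<in> borel_measurable borel" unfolding r_def by measurable
    have rB: "0 \<le> r t" "r t \<le> T powr \<theta>" for t
      using \<theta>(1) by (auto simp: r_def indicator_def intro!: powr_mono2)
    define h where "h t x = (r t * M t x) powr s" for t x
    have hm [measurable]: "(\<lambda>(t, x). h t x) \<in> borel_measurable (borel \<Otimes>\<^sub>M borel)"
      unfolding h_def by measurable
    have hB: "\<bar>h t x\<bar> \<le> (T powr \<theta> * (a * B)) powr s" for t x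
      unfolding h_def using rB[of t] M0[of t x] MB[of t x] p
      by (auto intro!: powr_mono2 mult_mono)
    have 2: "(LINT t|MT. M t x) \<le> m powr (1 - 1 / s) * (LINT t|\<nu>. h t x) powr (1 / s)" for x
    proof -
      have "(LINT t|MT. M t x) = (LINT t|lborel. indicator {0..T} t * M t x)"
        unfolding MT_def by (rule LINT_density_indicator) auto
      also have "\<dots> = (LINT t|lborel. (indicator {0..T} t * t powr (- \<theta>)) *\<^sub>R (r t * M t x))"
      \<comment> \<open>Equality can fail at t = 0, where \<open>0 powr (-\<theta>)\<close> is
        0.\<close>
      proof (intro integral_cong_AE)
        show "AE t in lborel. indicator {0..T} t * M t x = (indicator {0..T} t * t powr (- \<theta>)) *\<^sub>R (r t * M t x)"
          using AE_lborel_singleton[of "0::real"]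
          by eventually_elim (auto simp: r_def indicator_def powr_minus field_simps)
      qed auto
      also have "\<dots> = (LINT t|\<nu>. r t * M t x)"
        unfolding \<nu>_def by (subst integral_density) auto
      also have "\<dots> \<le> m powr (1 - 1 / s) * (LINT t|\<nu>. h t x) powr (1 / s)"
      proof -
        have "integrable \<nu> (\<lambda>t. h t x)"
          using hB by (intro \<nu>.integrable_const_bound[of _ "(T powr \<theta> * (a * B)) powr s"]) auto
        then have "integrable \<nu> (\<lambda>t. \<bar>r t * M t x\<bar> powr s)"
          using M0 rB by (simp add: h_def abs_mult)
        from Lp_mono_finite_measure(2)[OF fin\<nu> _ _ _ this, of 1] p
        show ?thesis using M0 rB by (simp add: m_def h_def abs_mult)
      qed
      finally show ?thesis .
    qed
    have J0: "(LINT t|\<nu>. h t x) \<ge> 0" for x by (intro integral_nonneg_AE) (auto simp: h_def)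
    have 3: "\<bar>\<phi> x\<bar> powr s \<le> (3 / a) powr s * m powr (s - 1) * (LINT t|\<nu>. h t x)" if x: "x \<in> ball 0 R" for x
    proof -
      have "\<bar>\<phi> x\<bar> \<le> 3 / a * (m powr (1 - 1 / s) * (LINT t|\<nu>. h t x) powr (1 / s))"
        using 1[OF x] mult_left_mono[OF 2[of x], of "3 / a"] a by simp
      then have "\<bar>\<phi> x\<bar> powr s \<le> (3 / a * (m powr (1 - 1 / s) * (LINT t|\<nu>. h t x) powr (1 / s))) powr s"
        using p by (intro powr_mono2) auto
      also have "\<dots> = (3 / a) powr s * m powr ((1 - 1 / s) * s) * (LINT t|\<nu>. h t x)"
      proof -
        have "1 / s * s = 1" using p by simp
        then show ?thesis using a J0[of x] by (simp only: powr_mult powr_powr) simp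
      qed
      also have "(1 - 1 / s) * s = s - 1" using p by (simp add: field_simps)
      finally show ?thesis .
    qed
    have Nsc: "(LINT w|lborel. g (x + t *\<^sub>R w) powr p) = N * t powr (- ?n)"
      "integrable lborel (\<lambda>w. g (x + t *\<^sub>R w) powr p)" if "t > 0" for t x
      using integral_scale_translate[OF Nint that, of x] that
      by (auto simp: N_def powr_minus powr_realpow divide_inverse)
    \<comment> \<open>P is controlled in two ways: pointwise in x by scaling, which costs the power
      \<open>-n\<close> of t, and in the integral over x by translation invariance, at no cost in t.
      These are the two endpoints of the interpolation.\<close>
    define P where "P t x = (LINT w|MA. g (x + t *\<^sub>R w) powr p)" for t x
    have gpB: "\<bar>g x powr p\<bar> \<le> B powr p" for x
      using g0 B p by (auto intro!: powr_mono2)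
    have P1: "M t x powr p \<le> a powr (p - 1) * P t x" for t x
    proof -
      have "integrable MA (\<lambda>w. \<bar>g (x + t *\<^sub>R w)\<bar> powr p)"
        using gpB g0 by (intro MA.integrable_const_bound[of _ "B powr p"]) auto
      from Lp_mono_finite_measure(2)[OF fin(1) _ _ _ this, of 1] p
      have "M t x \<le> a powr (1 - 1 / p) * P t x powr (1 / p)"
        using g0 by (simp add: M_def P_def a_def)
      then have "M t x powr p \<le> (a powr (1 - 1 / p) * P t x powr (1 / p)) powr p"
        using M0 p by (intro powr_mono2) auto
      also have "\<dots> = a powr ((1 - 1 / p) * p) * P t x"
        using p by (simp add: powr_mult powr_powr P_def)
      also have "(1 - 1 / p) * p = p - 1" using p by (simp add: field_simps)
      finally show ?thesis .
    qed
    have P2: "P t x \<le> N * t powr (- ?n)" if t: "t > 0" for t x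
    proof -
      have "P t x \<le> (LINT w|lborel. g (x + t *\<^sub>R w) powr p)"
        unfolding P_def MA_def A_def by (intro LINT_density_indicator_le Nsc(2)[OF t]) auto
      then show ?thesis using Nsc(1)[OF t] by simp
    qed
    have P3: "integrable MX (P t)" "(LINT x|MX. P t x) \<le> a * N" for t
    proof -
      have Fub: "(LINT x|MX. LINT w|MA. g (x + t *\<^sub>R w) powr p) = (LINT w|MA. LINT x|MX. g (x + t *\<^sub>R w) powr p)"
        "integrable MX (\<lambda>x. LINT w|MA. g (x + t *\<^sub>R w) powr p)"
        "integrable MA (\<lambda>w. LINT x|MX. g (x + t *\<^sub>R w) powr p)"
        using gpB by (intro Fubini_bounded[where f="\<lambda>x w. g (x + t *\<^sub>R w) powr p" and B="B powr p"] fin; simp add: split_beta')+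
      show "integrable MX (P t)" using Fub(2) by (simp add: P_def[abs_def])
      have "(LINT x|MX. g (x + t *\<^sub>R w) powr p) \<le> N" for w
      proof -
        have i: "integrable lborel (\<lambda>x. g (x + t *\<^sub>R w) powr p)"
          "(LINT x|lborel. g (x + t *\<^sub>R w) powr p) = N"
          using integral_scale_translate[OF Nint, of 1 "t *\<^sub>R w"] by (auto simp: N_def add.commute)
        have "(LINT x|MX. g (x + t *\<^sub>R w) powr p) \<le> (LINT x|lborel. g (x + t *\<^sub>R w) powr p)"
          unfolding MX_def by (intro LINT_density_indicator_le i(1)) auto
        then show ?thesis using i(2) by simp
      qed
      then have "(LINT w|MA. LINT x|MX. g (x + t *\<^sub>R w) powr p) \<le> (LINT w|MA. N)"
        using Fub(3) by (intro integral_mono) auto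
      then show "(LINT x|MX. P t x) \<le> a * N" using Fub(1) by (simp add: P_def a_def)
    qed
    define c1 where "c1 = a powr ((p - 1) * (s - p) / p) * a powr p"
    have 4: "(LINT x|MX. h t x) \<le> c1 * N powr (s / p) * (t powr (\<theta> * s) * t powr (- ?n * (s - p) / p))"
      if t: "t > 0" "t \<le> T" for t
    proof -
      \<comment> \<open>In the s-th power of M the part with exponent s - p is estimated by the
        pointwise bound, which yields c2, while the part with exponent p is kept for the integration
        over x.\<close>
      define c2 where "c2 = t powr (\<theta> * s) * (a powr (p - 1) * (N * t powr (- ?n))) powr ((s - p) / p) * a powr (p - 1)"
      have "h t x \<le> c2 * P t x" for x
      proof -
        have "h t x = t powr (\<theta> * s) * (M t x powr (s - p) * M t x powr p)"
          using t M0[of t x] by (simp add: h_def r_def powr_mult powr_powr powr_add[symmetric])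
        also have "M t x powr (s - p) = (M t x powr p) powr ((s - p) / p)"
          using p by (simp add: powr_powr)
        also have "\<dots> \<le> (a powr (p - 1) * (N * t powr (- ?n))) powr ((s - p) / p)"
          using p P1[of t x] mult_left_mono[OF P2[OF t(1), of x], of "a powr (p - 1)"]
          by (intro powr_mono2) auto
        finally have "h t x \<le> t powr (\<theta> * s) * ((a powr (p - 1) * (N * t powr (- ?n))) powr ((s - p) / p) * M t x powr p)"
          by (simp add: mult_left_mono mult_right_mono)
        also have "\<dots> \<le> t powr (\<theta> * s) * ((a powr (p - 1) * (N * t powr (- ?n))) powr ((s - p) / p) * (a powr (p - 1) * P t x))"
          using P1[of t x] by (intro mult_left_mono) auto
        finally show ?thesis by (simp add: c2_def mult_ac)
      qed
      moreover have "integrable MX (h t)"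
        using hB[of t] by (intro MX.integrable_const_bound[of _ "(T powr \<theta> * (a * B)) powr s"]) auto
      ultimately have "(LINT x|MX. h t x) \<le> (LINT x|MX. c2 * P t x)"
        using P3(1)[of t] by (intro integral_mono) auto
      also have "\<dots> \<le> c2 * (a * N)"
        using P3(2)[of t] by (simp add: c2_def mult_left_mono)
      also have "\<dots> = c1 * N powr (s / p) * (t powr (\<theta> * s) * t powr (- ?n * (s - p) / p))"
      proof -
        have "N powr ((s - p) / p) * N = N powr (s / p)"
        proof (cases "N = 0")
          case False
          then have "N powr ((s - p) / p) * N powr 1 = N powr ((s - p) / p + 1)" by (simp add: powr_add)
          also have "(s - p) / p + 1 = s / p" using p by (simp add: field_simps)
          finally show ?thesis using N0 by simp
        qed simp
        moreover have "a powr (p - 1) * a = a powr p"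
          using a powr_add[of a "p - 1" 1] by simp
        moreover have "(a powr (p - 1) * (N * t powr (- ?n))) powr ((s - p) / p)
           = a powr ((p - 1) * (s - p) / p) * N powr ((s - p) / p) * t powr (- ?n * (s - p) / p)"
          using N0 a t by (simp add: powr_mult powr_powr mult_ac)
        ultimately show ?thesis
          by (simp add: c1_def c2_def mult_ac) (metis mult.assoc mult.left_commute)
      qed
      finally show ?thesis .
    qed
    have Fub: "(LINT x|MX. LINT t|\<nu>. h t x) = (LINT t|\<nu>. LINT x|MX. h t x)"
      "integrable MX (\<lambda>x. LINT t|\<nu>. h t x)" "integrable \<nu> (\<lambda>t. LINT x|MX. h t x)"
      using hB by (intro Fubini_bounded[where f="\<lambda>x t. h t x" and B="(T powr \<theta> * (a * B)) powr s"] fin fin\<nu>; simp add: split_beta')+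
    have AE\<nu>: "AE t in \<nu>. t > 0 \<and> t \<le> T"
      unfolding \<nu>_def by (subst AE_density) (auto simp: indicator_def)
    have "(LINT t|\<nu>. LINT x|MX. h t x) \<le> (LINT t|\<nu>. c1 * N powr (s / p) * (t powr (\<theta> * s) * t powr (- ?n * (s - p) / p)))"
    proof (rule integral_mono_AE[OF Fub(3)])
      show "AE t in \<nu>. (LINT x|MX. h t x) \<le> c1 * N powr (s / p) * (t powr (\<theta> * s) * t powr (- ?n * (s - p) / p))"
        using AE\<nu> by eventually_elim (use 4 in auto)
    qed (use K_int in simp)
    also have "\<dots> = c1 * N powr (s / p) * K"
      by (simp add: K_def)
    finally have 5: "(LINT x|MX. LINT t|\<nu>. h t x) \<le> c1 * N powr (s / p) * K" using Fub(1) by simp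
    have "(LINT x|lborel. \<bar>\<phi> x\<bar> powr s) = (LINT x|lborel. indicator (ball 0 R) x * \<bar>\<phi> x\<bar> powr s)"
    proof (rule Bochner_Integration.integral_cong[OF refl])
      show "\<bar>\<phi> x\<bar> powr s = indicator (ball 0 R) x * \<bar>\<phi> x\<bar> powr s" for x
        using Q(2,3) R(2) by (cases "x \<in> ball 0 R") (auto simp: subset_eq)
    qed
    also have "\<dots> = (LINT x|MX. \<bar>\<phi> x\<bar> powr s)"
      unfolding MX_def by (rule LINT_density_indicator[symmetric]) auto
    also have "\<dots> \<le> (LINT x|MX. (3 / a) powr s * m powr (s - 1) * (LINT t|\<nu>. h t x))"
    proof (rule integral_mono_AE')
      show "AE x in MX. \<bar>\<phi> x\<bar> powr s \<le> (3 / a) powr s * m powr (s - 1) * (LINT t|\<nu>. h t x)"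
        using AE_density_indicator[of "ball (0::'a) R"] 3 unfolding MX_def by (auto elim!: eventually_mono)
      show "AE x in MX. 0 \<le> (3 / a) powr s * m powr (s - 1) * (LINT t|\<nu>. h t x)" using J0 by simp
    qed (use Fub(2) in simp)
    also have "\<dots> = (3 / a) powr s * m powr (s - 1) * (LINT x|MX. LINT t|\<nu>. h t x)" by simp
    also have "\<dots> \<le> (3 / a) powr s * m powr (s - 1) * (c1 * N powr (s / p) * K)"
      using 5 by (intro mult_left_mono) auto
    finally show "(LINT x|lborel. \<bar>\<phi> x\<bar> powr s) \<le> C * (LINT x|lborel. norm (grad \<phi> x) powr p) powr (s / p)"
      by (simp add: C_def c1_def N_def g_def mult_ac)
  qed
qed

text \<open>The interpolation splits off a power s - p and so requires p < s. Smaller exponents are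
  reduced to the midpoint t between p and the critical exponent D, using the finite measure of a
  ball that contains the domain.\<close>

theorem sobolev_subcritical:
  fixes \<Omega> :: "'a::euclidean_space set" and p s :: real
  assumes bd: "bounded \<Omega>" and p: "1 < p" "p < real DIM('a)"
    and s: "0 < s" "s * (real DIM('a) - p) < real DIM('a) * p"
  obtains C where "C \<ge> 0" "\<And>\<phi>. \<phi> \<in> test_functions \<Omega> \<Longrightarrow>
    (LINT x|lborel. \<bar>\<phi> x\<bar> powr s) \<le> C * (LINT x|lborel. norm (grad \<phi> x) powr p) powr (s / p)"
proof (cases "p < s")
  case True
  then show thesis using sobolev_subcritical_above[OF bd p(1) True s(2)] that by blast
next
  case False
  let ?n = "real DIM('a)"
  define D where "D = ?n * p / (?n - p)"
  define t where "t = (p + D) / 2"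
  have D: "D > p" "D * (?n - p) = ?n * p" using p by (simp_all add: D_def field_simps)
  then have t: "p < t" "t < D" by (auto simp: t_def)
  then have t: "p < t" "t * (?n - p) < ?n * p"
    using mult_strict_right_mono[of t D "?n - p"] D p by auto
  have st: "s < t" using False t by simp
  obtain C where C: "C \<ge> 0" "\<And>\<phi>. \<phi> \<in> test_functions \<Omega> \<Longrightarrow>
    (LINT x|lborel. \<bar>\<phi> x\<bar> powr t) \<le> C * (LINT x|lborel. norm (grad \<phi> x) powr p) powr (t / p)"
    using sobolev_subcritical_above[OF bd p(1) t] by blast
  obtain R where R: "R > 0" "\<Omega> \<subseteq> ball 0 R" using bd bounded_subset_ballD by blast
  define MX where "MX = density lborel (indicator (ball 0 R) :: 'a \<Rightarrow> ennreal)"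
  have fin: "finite_measure MX" unfolding MX_def by (auto intro!: finite_measure_density_indicator)
  have [measurable_cong, simp]: "sets MX = sets borel" and [simp]: "space MX = UNIV" by (simp_all add: MX_def)
  define m where "m = measure MX UNIV"
  show thesis
  proof (rule that)
    show "m powr (1 - s / t) * C powr (s / t) \<ge> 0" by simp
    fix \<phi> assume \<phi>: "\<phi> \<in> test_functions \<Omega>"
    obtain Q where Q: "compact Q" "Q \<subseteq> \<Omega>" "\<And>x. x \<notin> Q \<Longrightarrow> \<phi> x = 0" "\<And>x. x \<notin> Q \<Longrightarrow> grad \<phi> x = 0"
      using test_functionE[OF \<phi>] by blast
    note cont = test_function_continuous[OF \<phi>]
    have \<phi>m [measurable]: "\<phi> \<in> borel_measurable borel" using cont by (rule borel_measurable_continuous_onI)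
    obtain B where B: "B > 0" "\<And>x. norm (\<phi> x) \<le> B"
      using compact_support_bounded[OF cont Q(1,3)] by blast
    interpret finite_measure MX by fact
    have MX: "(LINT x|lborel. \<bar>\<phi> x\<bar> powr r) = (LINT x|MX. \<bar>\<phi> x\<bar> powr r)" for r
    proof -
      have "(LINT x|lborel. \<bar>\<phi> x\<bar> powr r) = (LINT x|lborel. indicator (ball 0 R) x * \<bar>\<phi> x\<bar> powr r)"
      proof (rule Bochner_Integration.integral_cong[OF refl])
        show "\<bar>\<phi> x\<bar> powr r = indicator (ball 0 R) x * \<bar>\<phi> x\<bar> powr r" for x
          using Q(2,3) R(2) by (cases "x \<in> ball 0 R") (auto simp: subset_eq)
      qed
      also have "\<dots> = (LINT x|MX. \<bar>\<phi> x\<bar> powr r)"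
        unfolding MX_def by (rule LINT_density_indicator[symmetric]) auto
      finally show ?thesis .
    qed
    define N where "N = (LINT x|lborel. norm (grad \<phi> x) powr p)"
    have "integrable MX (\<lambda>x. \<bar>\<phi> x\<bar> powr t)"
      using B t p by (intro integrable_const_bound[of _ "B powr t"]) (auto intro!: AE_I2 powr_mono2)
    from Lp_mono_finite_measure(2)[OF fin s(1) st _ this]
    have "(LINT x|lborel. \<bar>\<phi> x\<bar> powr s) \<le> m powr (1 - s / t) * (LINT x|lborel. \<bar>\<phi> x\<bar> powr t) powr (s / t)"
      by (simp add: MX m_def)
    also have "\<dots> \<le> m powr (1 - s / t) * (C * N powr (t / p)) powr (s / t)"
      unfolding N_def using C(2)[OF \<phi>] s st by (intro mult_left_mono powr_mono2) auto
    also have "\<dots> = m powr (1 - s / t) * C powr (s / t) * N powr (s / p)"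
      using C(1) s st by (simp add: powr_mult powr_powr)
    finally show "(LINT x|lborel. \<bar>\<phi> x\<bar> powr s) \<le>
        m powr (1 - s / t) * C powr (s / t) * (LINT x|lborel. norm (grad \<phi> x) powr p) powr (s / p)"
      by (simp add: N_def)
  qed
qed

section \<open>Approximation by test functions\<close>

text \<open>An open set is a countable union of closed boxes, and local integrability gives
  measurability on each of them. This supplies measurability of weak gradients, whose definition
  mentions only local integrability.\<close>

lemma locally_integrable_on_imp_measurable:
  fixes f :: "'a::euclidean_space \<Rightarrow> 'b::euclidean_space"
  assumes "open \<Omega>" "f locally_integrable_on \<Omega>"
  shows "f \<in> borel_measurable (lebesgue_on \<Omega>)"
proof -
  obtain \<D> where \<D>: "countable \<D>" "\<D> \<subseteq> Pow \<Omega>" "\<And>X. X \<in> \<D> \<Longrightarrow> \<exists>a b. X = cbox a b" "\<Union>\<D> = \<Omega>"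
    by (rule open_countable_Union_open_cbox[OF assms(1)]) (rule that; assumption)
  show ?thesis
  proof (rule measurable_piecewise_restrict[OF \<D>(1)])
    fix X assume X: "X \<in> \<D>"
    from \<D>(3)[OF X] obtain a b where ab: "X = cbox a b" by blast
    have sub: "X \<subseteq> \<Omega>" using \<D>(2) X by blast
    show "X \<inter> space (lebesgue_on \<Omega>) \<in> sets (lebesgue_on \<Omega>)"
      using sub assms(1) by (auto simp: ab sets_restrict_space_iff)
    have "restrict_space (lebesgue_on \<Omega>) X = lebesgue_on X"
      using sub assms(1) by (subst restrict_restrict_space) (auto simp: ab Int_absorb1)
    moreover have "f \<in> borel_measurable (lebesgue_on X)"
      using assms(2) sub by (intro borel_measurable_integrable) (auto simp: locally_integrable_on_def ab)
    ultimately show "f \<in> borel_measurable (restrict_space (lebesgue_on \<Omega>) X)" by simp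
  qed (use \<D>(4) in auto)
qed

lemma has_weak_gradient_measurable:
  assumes "open \<Omega>" "has_weak_gradient \<Omega> u g"
  shows "u \<in> borel_measurable (lebesgue_on \<Omega>)" "g \<in> borel_measurable (lebesgue_on \<Omega>)"
  using assms locally_integrable_on_imp_measurable by (auto simp: has_weak_gradient_def)

lemma continuous_measurable_lebesgue_on:
  fixes f :: "'a::euclidean_space \<Rightarrow> 'b::euclidean_space"
  assumes "continuous_on UNIV f"
  shows "f \<in> borel_measurable (lebesgue_on \<Omega>)"
proof -
  have "f \<in> borel_measurable borel" using assms by (rule borel_measurable_continuous_onI)
  then have "f \<in> borel_measurable lebesgue" by (intro measurable_completion) simp
  then show ?thesis by (rule measurable_restrict_space1)
qed

lemma add_powr_le:
  fixes a b p :: real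
  assumes "a \<ge> 0" "b \<ge> 0" "p > 0"
  shows "(a + b) powr p \<le> 2 powr p * (a powr p + b powr p)"
proof -
  have "(a + b) powr p \<le> (2 * max a b) powr p"
    using assms by (intro powr_mono2) auto
  also have "\<dots> = 2 powr p * max a b powr p" using assms by (simp add: powr_mult)
  also have "max a b powr p \<le> a powr p + b powr p" by (simp add: max_def)
  finally show ?thesis by simp
qed

lemma Lp_diff:
  assumes "f \<in> Lp p \<Omega>" "g \<in> Lp p \<Omega>" "p > 0"
  shows "(\<lambda>x. f x - g x) \<in> Lp p \<Omega>"
proof -
  have [measurable]: "f \<in> borel_measurable (lebesgue_on \<Omega>)" "g \<in> borel_measurable (lebesgue_on \<Omega>)"
    and i: "integrable (lebesgue_on \<Omega>) (\<lambda>x. norm (f x) powr p)" "integrable (lebesgue_on \<Omega>) (\<lambda>x. norm (g x) powr p)"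
    using assms by (auto simp: Lp_def)
  have *: "norm (norm (f x - g x) powr p) \<le> norm (2 powr p * (norm (f x) powr p + norm (g x) powr p))" for x
    using powr_mono2[OF less_imp_le[OF assms(3)] norm_ge_zero norm_triangle_ineq4[of "f x" "g x"]]
      add_powr_le[of "norm (f x)" "norm (g x)" p] assms(3) by simp
  have "integrable (lebesgue_on \<Omega>) (\<lambda>x. norm (f x - g x) powr p)"
  proof (rule Bochner_Integration.integrable_bound)
    show "integrable (lebesgue_on \<Omega>) (\<lambda>x. 2 powr p * (norm (f x) powr p + norm (g x) powr p))"
      using i by simp
  qed (use * in simp_all)
  then show ?thesis by (simp add: Lp_def)
qed

lemma compact_support_in_Lp:
  fixes f :: "'a::euclidean_space \<Rightarrow> 'b::euclidean_space"
  assumes "continuous_on UNIV f" "compact K" "\<And>x. x \<notin> K \<Longrightarrow> f x = 0" "K \<subseteq> \<Omega>" "open \<Omega>" "p > 0"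
  shows "f \<in> Lp p \<Omega>"
proof -
  have c: "continuous_on UNIV (\<lambda>x. norm (f x) powr p)"
    using assms by (intro continuous_on_powr' continuous_intros) auto
  have "integrable (lebesgue_on \<Omega>) (\<lambda>x. norm (f x) powr p)"
    using assms by (subst lebesgue_on_eq_lborel(2))
      (auto intro!: borel_measurable_continuous_onI[OF c] integrable_lborel_compact_support[OF c assms(2)])
  then show ?thesis using continuous_measurable_lebesgue_on[OF assms(1)] by (simp add: Lp_def)
qed

lemma test_function_in_Lp:
  assumes "\<phi> \<in> test_functions \<Omega>" "open \<Omega>" "p > 0"
  shows "\<phi> \<in> Lp p \<Omega>" "grad \<phi> \<in> Lp p \<Omega>"
proof -
  obtain K where "compact K" "K \<subseteq> \<Omega>" "\<And>x. x \<notin> K \<Longrightarrow> \<phi> x = 0" "\<And>x. x \<notin> K \<Longrightarrow> grad \<phi> x = 0"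
    using test_functionE[OF assms(1)] by blast
  with assms(2,3) test_function_continuous[OF assms(1)] test_function_continuous_grad[OF assms(1)]
  show "\<phi> \<in> Lp p \<Omega>" "grad \<phi> \<in> Lp p \<Omega>" by (auto intro!: compact_support_in_Lp[of _ K])
qed

lemma integrable_locally_integrable_scaleR:
  assumes h: "h locally_integrable_on \<Omega>" and \<Omega>: "open \<Omega>"
    and G: "continuous_on UNIV G" "compact K" "K \<subseteq> \<Omega>" "\<And>x. x \<notin> K \<Longrightarrow> G x = 0"
  shows "integrable (lebesgue_on \<Omega>) (\<lambda>x. h x *\<^sub>R (G x :: 'a::euclidean_space))"
proof -
  have "integrable (lebesgue_on \<Omega>) (\<lambda>x. norm (G x) *\<^sub>R h x)"
    using G by (intro integrable_locally_integrable_mult[OF h \<Omega> _ G(2,3)] continuous_intros) auto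
  then show ?thesis
  proof (rule Bochner_Integration.integrable_bound)
    show "(\<lambda>x. h x *\<^sub>R G x) \<in> borel_measurable (lebesgue_on \<Omega>)"
      using locally_integrable_on_imp_measurable[OF \<Omega> h] continuous_measurable_lebesgue_on[OF G(1)]
      by (intro borel_measurable_scaleR)
  qed (simp add: mult.commute)
qed

lemma has_weak_gradient_diff:
  assumes \<Omega>: "open \<Omega>" and u: "has_weak_gradient \<Omega> u g" and v: "has_weak_gradient \<Omega> v k"
  shows "has_weak_gradient \<Omega> (\<lambda>x. u x - v x) (\<lambda>x. g x - k x)"
proof -
  have li: "u locally_integrable_on \<Omega>" "g locally_integrable_on \<Omega>" "v locally_integrable_on \<Omega>" "k locally_integrable_on \<Omega>"
    using u v by (auto simp: has_weak_gradient_def)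
  have "(LINT x|lebesgue_on \<Omega>. (u x - v x) *\<^sub>R grad \<phi> x) = - (LINT x|lebesgue_on \<Omega>. \<phi> x *\<^sub>R (g x - k x))"
    if \<phi>: "\<phi> \<in> test_functions \<Omega>" for \<phi>
  proof -
    obtain K where K: "compact K" "K \<subseteq> \<Omega>" "\<And>x. x \<notin> K \<Longrightarrow> \<phi> x = 0" "\<And>x. x \<notin> K \<Longrightarrow> grad \<phi> x = 0"
      using test_functionE[OF \<phi>] by blast
    note i = integrable_locally_integrable_mult[OF li(2) \<Omega> test_function_continuous[OF \<phi>] K(1-3)]
      integrable_locally_integrable_mult[OF li(4) \<Omega> test_function_continuous[OF \<phi>] K(1-3)]
      integrable_locally_integrable_scaleR[OF li(1) \<Omega> test_function_continuous_grad[OF \<phi>] K(1,2,4)]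
      integrable_locally_integrable_scaleR[OF li(3) \<Omega> test_function_continuous_grad[OF \<phi>] K(1,2,4)]
    have "(LINT x|lebesgue_on \<Omega>. u x *\<^sub>R grad \<phi> x) = - (LINT x|lebesgue_on \<Omega>. \<phi> x *\<^sub>R g x)"
      "(LINT x|lebesgue_on \<Omega>. v x *\<^sub>R grad \<phi> x) = - (LINT x|lebesgue_on \<Omega>. \<phi> x *\<^sub>R k x)"
      using u v \<phi> by (auto simp: has_weak_gradient_def)
    then show ?thesis
      using i by (simp add: scaleR_diff_left scaleR_diff_right)
  qed
  moreover have "(\<lambda>x. u x - v x) locally_integrable_on \<Omega>" "(\<lambda>x. g x - k x) locally_integrable_on \<Omega>"
    using li by (auto simp: locally_integrable_on_def)
  ultimately show ?thesis by (auto simp: has_weak_gradient_def)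
qed

lemma test_function_has_weak_gradient:
  "open \<Omega> \<Longrightarrow> \<phi> \<in> test_functions \<Omega> \<Longrightarrow> has_weak_gradient \<Omega> \<phi> (grad \<phi>)"
  by (intro C1_has_weak_gradient test_function_has_gradient test_function_continuous_grad)

lemma Lp_norm_powr: "p > 0 \<Longrightarrow> Lp_norm p \<Omega> f powr p = (LINT x|lebesgue_on \<Omega>. norm (f x) powr p)"
  by (simp add: Lp_norm_def powr_powr)

lemma Lp_cong_AE:
  assumes "AE x in lebesgue_on \<Omega>. f x = g x" "f \<in> borel_measurable (lebesgue_on \<Omega>)" "g \<in> borel_measurable (lebesgue_on \<Omega>)"
  shows "f \<in> Lp p \<Omega> \<longleftrightarrow> g \<in> Lp p \<Omega>"
    and "(LINT x|lebesgue_on \<Omega>. norm (f x) powr p) = (LINT x|lebesgue_on \<Omega>. norm (g x) powr p)"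
proof -
  have "integrable (lebesgue_on \<Omega>) (\<lambda>x. norm (f x) powr p) \<longleftrightarrow> integrable (lebesgue_on \<Omega>) (\<lambda>x. norm (g x) powr p)"
    using assms by (intro integrable_cong_AE) auto
  then show "f \<in> Lp p \<Omega> \<longleftrightarrow> g \<in> Lp p \<Omega>" using assms by (simp add: Lp_def)
  show "(LINT x|lebesgue_on \<Omega>. norm (f x) powr p) = (LINT x|lebesgue_on \<Omega>. norm (g x) powr p)"
    using assms by (intro integral_cong_AE) auto
qed

lemma W1p_norm_eq:
  assumes "open \<Omega>" "has_weak_gradient \<Omega> v g" "p > 0"
  shows "W1p_norm p \<Omega> v =
    ((LINT x|lebesgue_on \<Omega>. \<bar>v x\<bar> powr p) + (LINT x|lebesgue_on \<Omega>. norm (g x) powr p)) powr (1 / p)"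
proof -
  have "(LINT x|lebesgue_on \<Omega>. norm (weak_grad \<Omega> v x) powr p) = (LINT x|lebesgue_on \<Omega>. norm (g x) powr p)"
    using assms by (intro Lp_cong_AE weak_grad_AE_eq has_weak_gradient_measurable(2)[of _ v] weak_grad_works)
  then show ?thesis using assms by (simp add: W1p_norm_def Lp_norm_powr)
qed

lemma W1p_weak_grad:
  assumes "open \<Omega>" "u \<in> W1p p \<Omega>"
  shows "has_weak_gradient \<Omega> u (weak_grad \<Omega> u)" "weak_grad \<Omega> u \<in> Lp p \<Omega>" "u \<in> Lp p \<Omega>"
proof -
  obtain g where g: "g \<in> Lp p \<Omega>" "has_weak_gradient \<Omega> u g" using assms(2) by (auto simp: W1p_def)
  show w: "has_weak_gradient \<Omega> u (weak_grad \<Omega> u)" using weak_grad_works[OF g(2)] .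
  show "weak_grad \<Omega> u \<in> Lp p \<Omega>"
    using Lp_cong_AE(1)[OF weak_grad_AE_eq[OF assms(1) g(2)]] has_weak_gradient_measurable(2)[OF assms(1)] w g by blast
  show "u \<in> Lp p \<Omega>" using assms(2) by (auto simp: W1p_def)
qed

lemma summable_AE_of_integrals:
  fixes d :: "nat \<Rightarrow> 'a \<Rightarrow> real"
  assumes d: "\<And>j. integrable M (d j)" "\<And>j x. d j x \<ge> 0" and s: "summable (\<lambda>j. LINT x|M. d j x)"
  shows "AE x in M. summable (\<lambda>j. d j x)" and "integrable M (\<lambda>x. \<Sum>j. d j x)"
proof -
  have [measurable]: "d j \<in> borel_measurable M" for j using d(1) by simp
  have "(\<integral>\<^sup>+x. (\<Sum>j. ennreal (d j x)) \<partial>M) = (\<Sum>j. ennreal (LINT x|M. d j x))"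
    using d by (subst nn_integral_suminf) (auto simp: nn_integral_eq_integral)
  also have "\<dots> < \<infinity>"
    using s d by (auto simp: ennreal_suminf_neq_top less_top[symmetric] integral_nonneg_AE)
  finally have "AE x in M. (\<Sum>j. ennreal (d j x)) \<noteq> \<infinity>"
    by (intro nn_integral_PInf_AE) auto
  then show "AE x in M. summable (\<lambda>j. d j x)"
    by eventually_elim (use d(2) in \<open>auto intro: summable_suminf_not_top\<close>)
  then show "integrable M (\<lambda>x. \<Sum>j. d j x)"
    using d s by (intro integrable_suminf) auto
qed

text \<open>
  If \<open>\<phi> j\<close> converges to \<open>u\<close> so fast that \<open>d j = |u - \<phi> j|\<^sup>p + |\<nabla>u - \<nabla>(\<phi> j)|\<^sup>p\<close> has summable
  integrals, then \<open>\<Sum>j. d j\<close> is finite almost everywhere and integrable: this gives pointwise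
  convergence and a common majorant at once.
\<close>

lemma W1p_0_approx:
  fixes u :: "'a::euclidean_space \<Rightarrow> real"
  assumes \<Omega>: "open \<Omega>" and p: "p > 0" and u: "u \<in> W1p_0 p \<Omega>"
  obtains \<phi> D where "\<And>j. \<phi> j \<in> test_functions \<Omega>" "integrable (lebesgue_on \<Omega>) D"
    "AE x in lebesgue_on \<Omega>. (\<lambda>j. \<phi> j x) \<longlonglongrightarrow> u x"
    "AE x in lebesgue_on \<Omega>. (\<lambda>j. grad (\<phi> j) x) \<longlonglongrightarrow> weak_grad \<Omega> u x"
    "AE x in lebesgue_on \<Omega>. \<forall>j. norm (grad (\<phi> j) x) powr p \<le> D x"
proof -
  define U where "U = weak_grad \<Omega> u"
  have uW: "u \<in> W1p p \<Omega>" using u by (simp add: W1p_0_def)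
  note U = W1p_weak_grad[OF \<Omega> uW, folded U_def]
  \<comment> \<open>The Sobolev norm is a p-th root, so this accuracy bounds the integral of d j
    below by \<open>(1/2) ^ j\<close>.\<close>
  define e where "e j = ((1/2) ^ j) powr (1 / p)" for j :: nat
  have "\<exists>\<phi>\<in>test_functions \<Omega>. W1p_norm p \<Omega> (\<lambda>x. u x - \<phi> x) < e j" for j
    using u by (auto simp: W1p_0_def e_def)
  then obtain \<phi> where \<phi>: "\<And>j. \<phi> j \<in> test_functions \<Omega>" "\<And>j. W1p_norm p \<Omega> (\<lambda>x. u x - \<phi> j x) < e j"
    by metis
  define d where "d j x = \<bar>u x - \<phi> j x\<bar> powr p + norm (U x - grad (\<phi> j) x) powr p" for j x
  have i: "integrable (lebesgue_on \<Omega>) (\<lambda>x. \<bar>u x - \<phi> j x\<bar> powr p)"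
     "integrable (lebesgue_on \<Omega>) (\<lambda>x. norm (U x - grad (\<phi> j) x) powr p)" for j
    using Lp_diff[OF U(3) test_function_in_Lp(1)[OF \<phi>(1)[of j] \<Omega> p] p]
      Lp_diff[OF U(2) test_function_in_Lp(2)[OF \<phi>(1)[of j] \<Omega> p] p] by (auto simp: Lp_def)
  have d: "integrable (lebesgue_on \<Omega>) (d j)" for j unfolding d_def using i by auto
  have d0: "d j x \<ge> 0" for j x by (simp add: d_def)
  have dle: "(LINT x|lebesgue_on \<Omega>. d j x) \<le> (1/2) ^ j" for j
  proof -
    have "W1p_norm p \<Omega> (\<lambda>x. u x - \<phi> j x) = (LINT x|lebesgue_on \<Omega>. d j x) powr (1 / p)"
      unfolding d_def using i
        W1p_norm_eq[OF \<Omega> has_weak_gradient_diff[OF \<Omega> U(1) test_function_has_weak_gradient[OF \<Omega> \<phi>(1)]] p]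
      by simp
    then have "(LINT x|lebesgue_on \<Omega>. d j x) powr (1 / p) < ((1/2) ^ j) powr (1 / p)"
      using \<phi>(2)[of j] by (simp add: e_def)
    moreover have "(LINT x|lebesgue_on \<Omega>. d j x) \<ge> 0" using d0 by (intro integral_nonneg_AE) auto
    ultimately show ?thesis
      using p powr_mono2[of "1 / p" "(1/2) ^ j" "LINT x|lebesgue_on \<Omega>. d j x"] by fastforce
  qed
  have "summable (\<lambda>j. LINT x|lebesgue_on \<Omega>. d j x)"
  proof (rule summable_comparison_test')
    show "summable (\<lambda>j. (1/2::real) ^ j)" by (rule summable_geometric) simp
    have "(LINT x|lebesgue_on \<Omega>. d j x) \<ge> 0" for j using d0 by (intro integral_nonneg_AE) simp
    then show "norm (LINT x|lebesgue_on \<Omega>. d j x) \<le> (1/2) ^ j" for j using dle[of j] by simp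
  qed
  note S = summable_AE_of_integrals[OF d d0 this]
  \<comment> \<open>Each gradient is at most the norm of U plus its distance from U; the p-th power
    of a sum costs \<open>2 powr p\<close>, and the distance term is at most a single member of the
    series.\<close>
  define D where "D x = 2 powr p * (norm (U x) powr p + (\<Sum>j. d j x))" for x
  show thesis
  proof (rule that[of \<phi> D])
    show "\<phi> j \<in> test_functions \<Omega>" for j by (rule \<phi>)
    show "integrable (lebesgue_on \<Omega>) D" unfolding D_def using S(2) U(2) by (auto simp: Lp_def)
    have lim: "(\<lambda>j. w j) \<longlonglongrightarrow> v" if "summable (\<lambda>j. d j x)" "\<And>j. norm (v - w j) powr p \<le> d j x" for x and v :: "'b::euclidean_space" and w
    proof -
      have "(\<lambda>j. d j x powr (1 / p)) \<longlonglongrightarrow> 0"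
        using summable_LIMSEQ_zero[OF that(1)] p d0 by (intro tendsto_zero_powrI[of _ _ _ "1/p"]) auto
      moreover have "norm (v - w j) \<le> d j x powr (1 / p)" for j
        using powr_mono2[OF _ _ that(2)[of j], of "1 / p"] p by (simp add: powr_powr)
      ultimately have "(\<lambda>j. v - w j) \<longlonglongrightarrow> 0"
        by (intro Lim_null_comparison[of "\<lambda>j. v - w j" "\<lambda>j. d j x powr (1 / p)"]) auto
      from tendsto_diff[OF tendsto_const[of v] this] show ?thesis by simp
    qed
    show "AE x in lebesgue_on \<Omega>. (\<lambda>j. \<phi> j x) \<longlonglongrightarrow> u x"
      using S(1) by eventually_elim (rule lim, auto simp: d_def)
    show "AE x in lebesgue_on \<Omega>. (\<lambda>j. grad (\<phi> j) x) \<longlonglongrightarrow> weak_grad \<Omega> u x"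
      using S(1) by eventually_elim (rule lim, auto simp: d_def U_def)
    show "AE x in lebesgue_on \<Omega>. \<forall>j. norm (grad (\<phi> j) x) powr p \<le> D x"
      using S(1)
    proof eventually_elim
      case (elim x)
      show ?case
      proof
        fix j
        have "norm (grad (\<phi> j) x) \<le> norm (U x) + norm (U x - grad (\<phi> j) x)"
          using norm_triangle_ineq4[of "U x" "U x - grad (\<phi> j) x"] by simp
        then have "norm (grad (\<phi> j) x) powr p \<le> (norm (U x) + norm (U x - grad (\<phi> j) x)) powr p"
          using p by (intro powr_mono2) auto
        also have "\<dots> \<le> 2 powr p * (norm (U x) powr p + norm (U x - grad (\<phi> j) x) powr p)"
          using p by (intro add_powr_le) auto
        also have "norm (U x - grad (\<phi> j) x) powr p \<le> (\<Sum>j. d j x)"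
        proof -
          have "norm (U x - grad (\<phi> j) x) powr p \<le> d j x" by (simp add: d_def)
          also have "\<dots> \<le> (\<Sum>j. d j x)"
            using sum_le_suminf[OF elim, of "{j}"] d0 by simp
          finally show ?thesis .
        qed
        finally show "norm (grad (\<phi> j) x) powr p \<le> D x" by (simp add: D_def)
      qed
    qed
  qed
qed

section \<open>Truncated test functions in the weak equation\<close>

lemma finite_measure_lebesgue_on_bounded:
  fixes \<Omega> :: "'a::euclidean_space set"
  assumes "open \<Omega>" "bounded \<Omega>"
  shows "finite_measure (lebesgue_on \<Omega>)"
  using assms emeasure_bounded_finite[of \<Omega>]
  by (intro finite_measureI) (auto simp: emeasure_restrict_space)

text \<open>The bounds may vary with i because the estimates below carry an error that disappears
  only in the limit. Integrability of f is part of the conclusion: this is how membership of u in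
  the Lebesgue space is obtained.\<close>

lemma Fatou_integral_bound:
  fixes f :: "'a \<Rightarrow> real"
  assumes g: "\<And>i. integrable M (g i)" "\<And>i x. g i x \<ge> 0" and f: "f \<in> borel_measurable M" "\<And>x. f x \<ge> 0"
    and lim: "AE x in M. (\<lambda>i. g i x) \<longlonglongrightarrow> f x"
    and c: "\<And>i. (LINT x|M. g i x) \<le> c i" "c \<longlonglongrightarrow> L"
  shows "integrable M f" "(LINT x|M. f x) \<le> L"
proof -
  have [measurable]: "g i \<in> borel_measurable M" for i using g by simp
  have c0: "c i \<ge> 0" for i
    using order.trans[OF integral_nonneg_AE[of "g i" M] c(1)[of i]] g(2) by auto
  then have L: "L \<ge> 0" using c(2) by (intro LIMSEQ_le_const[of c]) auto
  have "(\<integral>\<^sup>+x. ennreal (f x) \<partial>M) = (\<integral>\<^sup>+x. liminf (\<lambda>i. ennreal (g i x)) \<partial>M)"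
  proof (rule nn_integral_cong_AE)
    show "AE x in M. ennreal (f x) = liminf (\<lambda>i. ennreal (g i x))"
      using lim
    proof eventually_elim
      case (elim x)
      from tendsto_ennrealI[OF elim] show ?case by (metis lim_imp_Liminf trivial_limit_sequentially)
    qed
  qed
  also have "\<dots> \<le> liminf (\<lambda>i. \<integral>\<^sup>+x. ennreal (g i x) \<partial>M)"
    by (intro nn_integral_liminf) auto
  also have "\<dots> \<le> liminf (\<lambda>i. ennreal (c i))"
    using g c(1) by (intro Liminf_mono always_eventually) (auto simp: nn_integral_eq_integral intro!: ennreal_leI)
  also have "\<dots> = ennreal L"
    using tendsto_ennrealI[OF c(2)] by (metis lim_imp_Liminf trivial_limit_sequentially)
  finally have le: "(\<integral>\<^sup>+x. ennreal (f x) \<partial>M) \<le> ennreal L" .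
  then show i: "integrable M f"
    using f by (intro integrableI_nonneg) (auto intro: le_less_trans)
  show "(LINT x|M. f x) \<le> L"
    using le L f(2) nn_integral_eq_integral[OF i] by simp
qed

text \<open>Both factors are at most powers of the maximum of a and b, and the p-th power of the
  maximum is one of the two summands.\<close>

lemma powr_minus_one_mult_le:
  fixes a b p :: real
  assumes "a \<ge> 0" "b \<ge> 0" "p > 1"
  shows "a powr (p - 1) * b \<le> a powr p + b powr p"
proof (cases "max a b = 0")
  case False
  define m where "m = max a b"
  have m: "m > 0" using False assms by (auto simp: m_def max_def)
  have "a powr (p - 1) * b \<le> m powr (p - 1) * m"
    using assms by (intro mult_mono powr_mono2) (auto simp: m_def)
  also have "\<dots> = m powr p" using m powr_add[of m "p - 1" 1] by simp
  also have "\<dots> \<le> a powr p + b powr p" by (simp add: m_def max_def)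
  finally show ?thesis .
qed (use assms in \<open>auto simp: max_def split: if_splits\<close>)

lemma norm_powr_minus_two_scaleR: "norm ((norm v powr (p - 2)) *\<^sub>R v) = norm v powr (p - 1)"
  by (cases "v = 0") (auto simp: powr_diff power2_eq_square powr_numeral)

lemma Ck_compose:
  fixes g :: "real \<Rightarrow> real"
  shows "Ck k g \<Longrightarrow> Ck k f \<Longrightarrow> Ck k (\<lambda>x. g (f x))"
proof (induction k arbitrary: g f)
  case 0
  then show ?case by (auto intro: continuous_on_compose2)
next
  case (Suc k)
  note D = Ck_SucD[OF Suc.prems(1)] Ck_SucD[OF Suc.prems(2)]
  have "((\<lambda>x. g (f x)) has_derivative
      (\<lambda>h. frechet_derivative g (at (f x)) 1 * frechet_derivative f (at x) h)) (at x)" for x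
  proof -
    interpret bounded_linear "frechet_derivative g (at (f x))"
      using D(1) by (rule has_derivative_bounded_linear)
    have "frechet_derivative g (at (f x)) y = frechet_derivative g (at (f x)) 1 * y" for y
      using scaleR[of y 1] by (simp add: mult.commute)
    then show ?thesis
      by (intro has_derivative_eq_rhs[OF has_derivative_compose[OF D(3) D(1)]] ext)
  qed
  then show ?case
  proof (rule Ck_SucI)
    fix b :: 'a assume "b \<in> Basis"
    then show "Ck k (\<lambda>x. frechet_derivative g (at (f x)) 1 * frechet_derivative f (at x) b)"
      using D by (intro Ck_mult Suc.IH[of "\<lambda>t. frechet_derivative g (at t) 1" f] Ck_Suc_imp_Ck[OF Suc.prems(2)]) auto
  qed
qed

text \<open>Exactly what testing with \<open>G (u x)\<close> requires: smoothness and
  \<open>G 0 = 0\<close> turn test functions into test functions, boundedness of G dominates the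
  term with f, and boundedness of G' dominates the gradient term.\<close>

definition smooth_truncation :: "(real \<Rightarrow> real) \<Rightarrow> (real \<Rightarrow> real) \<Rightarrow> bool" where
  "smooth_truncation G G' \<longleftrightarrow> (\<forall>k. Ck k G) \<and> (\<forall>t. (G has_real_derivative G' t) (at t)) \<and>
     continuous_on UNIV G' \<and> bounded (range G) \<and> bounded (range G') \<and> G 0 = 0"

lemma smooth_truncation_bounds:
  assumes "smooth_truncation G G'"
  obtains B where "B > 0" "\<And>t. \<bar>G t\<bar> \<le> B" "\<And>t. \<bar>G' t\<bar> \<le> B"
proof -
  obtain B1 B2 where "B1 > 0" "\<forall>t. \<bar>G t\<bar> \<le> B1" "B2 > 0" "\<forall>t. \<bar>G' t\<bar> \<le> B2"
    using assms by (auto simp: smooth_truncation_def bounded_pos)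
  then show thesis using that[of "max B1 B2"] by (auto simp: le_max_iff_disj)
qed

lemma smooth_truncation_test_function:
  assumes G: "smooth_truncation G G'" and \<phi>: "\<phi> \<in> test_functions \<Omega>"
  shows "(\<lambda>x. G (\<phi> x)) \<in> test_functions \<Omega>" "grad (\<lambda>x. G (\<phi> x)) x = G' (\<phi> x) *\<^sub>R grad \<phi> x"
proof -
  obtain K where K: "compact K" "K \<subseteq> \<Omega>" "\<And>x. x \<notin> K \<Longrightarrow> \<phi> x = 0" "\<And>x. x \<notin> K \<Longrightarrow> grad \<phi> x = 0"
    using test_functionE[OF \<phi>] by blast
  show "(\<lambda>x. G (\<phi> x)) \<in> test_functions \<Omega>"
  proof (rule test_functionsI[OF _ K(1,2)])
    show "Ck k (\<lambda>x. G (\<phi> x))" for k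
      using G by (intro Ck_compose[OF _ test_functions_Ck[OF \<phi>]]) (simp add: smooth_truncation_def)
    show "G (\<phi> x) = 0" if "x \<notin> K" for x
      using G K(3)[OF that] by (simp add: smooth_truncation_def)
  qed
  have "((\<lambda>x. G (\<phi> x)) has_derivative (\<lambda>h. G' (\<phi> x) * (grad \<phi> x \<bullet> h))) (at x)"
    using G has_derivative_compose[OF test_function_has_gradient[OF \<phi>], of G]
    by (auto simp: smooth_truncation_def has_field_derivative_def)
  then show "grad (\<lambda>x. G (\<phi> x)) x = G' (\<phi> x) *\<^sub>R grad \<phi> x"
    by (intro grad_eqI) simp
qed

lemma smooth_truncation_continuous:
  assumes "smooth_truncation G G'"
  shows "isCont G t" "isCont G' t" "G \<in> borel_measurable borel" "G' \<in> borel_measurable borel"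
proof -
  show 1: "isCont G t" for t using assms by (auto simp: smooth_truncation_def intro: DERIV_isCont)
  show "isCont G' t" using assms by (auto simp: smooth_truncation_def continuous_on_eq_continuous_at)
  show "G \<in> borel_measurable borel" using 1
    by (intro borel_measurable_continuous_onI continuous_at_imp_continuous_on) simp
  show "G' \<in> borel_measurable borel" using assms
    by (intro borel_measurable_continuous_onI) (simp add: smooth_truncation_def)
qed

text \<open>Formally the equation is tested with G(u). Only smooth test functions are admissible, so
  it is tested with G composed with the approximations of u, and both sides pass to the limit by
  dominated convergence.\<close>

lemma weak_solution_test_truncation:
  fixes u :: "'a::euclidean_space \<Rightarrow> real"
  assumes \<Omega>: "open \<Omega>" and p: "p > 1" and f: "integrable (lebesgue_on \<Omega>) f"
    and u: "weak_solution p \<Omega> f u" and G: "smooth_truncation G G'"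
  shows "(LINT x|lebesgue_on \<Omega>. G' (u x) * norm (weak_grad \<Omega> u x) powr p)
    = (LINT x|lebesgue_on \<Omega>. f x * G (u x))"
proof -
  define U where "U = weak_grad \<Omega> u"
  have u0: "u \<in> W1p_0 p \<Omega>" using u by (simp add: weak_solution_def)
  then have uW: "u \<in> W1p p \<Omega>" by (simp add: W1p_0_def)
  note U = W1p_weak_grad[OF \<Omega> uW, folded U_def]
  have meas [measurable]: "u \<in> borel_measurable (lebesgue_on \<Omega>)" "U \<in> borel_measurable (lebesgue_on \<Omega>)"
    "f \<in> borel_measurable (lebesgue_on \<Omega>)"
    using has_weak_gradient_measurable[OF \<Omega> U(1)] f by auto
  note [measurable] = smooth_truncation_continuous(3,4)[OF G]
  obtain B where B: "B > 0" "\<And>t. \<bar>G t\<bar> \<le> B" "\<And>t. \<bar>G' t\<bar> \<le> B"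
    using smooth_truncation_bounds[OF G] by blast
  have p0: "p > 0" using p by simp
  obtain \<phi> D where \<phi>: "\<And>j. \<phi> j \<in> test_functions \<Omega>" "integrable (lebesgue_on \<Omega>) D"
    "AE x in lebesgue_on \<Omega>. (\<lambda>j. \<phi> j x) \<longlonglongrightarrow> u x"
    "AE x in lebesgue_on \<Omega>. (\<lambda>j. grad (\<phi> j) x) \<longlonglongrightarrow> U x"
    "AE x in lebesgue_on \<Omega>. \<forall>j. norm (grad (\<phi> j) x) powr p \<le> D x"
    using W1p_0_approx[OF \<Omega> p0 u0] unfolding U_def by blast
  have m\<phi> [measurable]: "\<phi> j \<in> borel_measurable (lebesgue_on \<Omega>)" "grad (\<phi> j) \<in> borel_measurable (lebesgue_on \<Omega>)" for j
    using continuous_measurable_lebesgue_on test_function_continuous[OF \<phi>(1)]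
      test_function_continuous_grad[OF \<phi>(1)] by blast+
  define V where "V x = (norm (U x) powr (p - 2)) *\<^sub>R U x" for x
  have mV [measurable]: "V \<in> borel_measurable (lebesgue_on \<Omega>)" unfolding V_def by measurable
  have nV: "norm (V x) = norm (U x) powr (p - 1)" for x unfolding V_def by (rule norm_powr_minus_two_scaleR)
  have VU: "V x \<bullet> U x = norm (U x) powr p" for x
    by (cases "U x = 0") (auto simp: V_def dot_square_norm powr_diff powr_numeral)
  have eq: "(LINT x|lebesgue_on \<Omega>. G' (\<phi> j x) * (V x \<bullet> grad (\<phi> j) x)) = (LINT x|lebesgue_on \<Omega>. f x * G (\<phi> j x))" for j
  proof -
    note T = smooth_truncation_test_function[OF G \<phi>(1)[of j]]
    have "(LINT x|lebesgue_on \<Omega>. V x \<bullet> grad (\<lambda>x. G (\<phi> j x)) x) = (LINT x|lebesgue_on \<Omega>. f x * G (\<phi> j x))"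
      using u T(1) unfolding weak_solution_def V_def U_def by blast
    then show ?thesis by (simp add: T(2))
  qed
  have L: "(\<lambda>j. LINT x|lebesgue_on \<Omega>. G' (\<phi> j x) * (V x \<bullet> grad (\<phi> j) x)) \<longlonglongrightarrow> (LINT x|lebesgue_on \<Omega>. G' (u x) * (V x \<bullet> U x))"
  proof (rule integral_dominated_convergence)
    show "integrable (lebesgue_on \<Omega>) (\<lambda>x. B * (norm (U x) powr p + D x))"
      using U(2) \<phi>(2) by (auto simp: Lp_def)
    show "AE x in lebesgue_on \<Omega>. (\<lambda>j. G' (\<phi> j x) * (V x \<bullet> grad (\<phi> j) x)) \<longlonglongrightarrow> G' (u x) * (V x \<bullet> U x)"
      using \<phi>(3,4)
      by eventually_elim (intro tendsto_intros isCont_tendsto_compose[OF smooth_truncation_continuous(2)[OF G]])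
    show "AE x in lebesgue_on \<Omega>. norm (G' (\<phi> j x) * (V x \<bullet> grad (\<phi> j) x)) \<le> B * (norm (U x) powr p + D x)" for j
      using \<phi>(5)
    proof eventually_elim
      case (elim x)
      have "\<bar>V x \<bullet> grad (\<phi> j) x\<bar> \<le> norm (U x) powr (p - 1) * norm (grad (\<phi> j) x)"
        using Cauchy_Schwarz_ineq2[of "V x" "grad (\<phi> j) x"] by (simp add: nV)
      also have "\<dots> \<le> norm (U x) powr p + norm (grad (\<phi> j) x) powr p"
        using p by (intro powr_minus_one_mult_le) auto
      also have "\<dots> \<le> norm (U x) powr p + D x" using elim by simp
      finally show ?case using B(3)[of "\<phi> j x"] B(1) by (auto simp: abs_mult intro!: mult_mono)
    qed
  qed measurable
  have R: "(\<lambda>j. LINT x|lebesgue_on \<Omega>. f x * G (\<phi> j x)) \<longlonglongrightarrow> (LINT x|lebesgue_on \<Omega>. f x * G (u x))"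
  proof (rule integral_dominated_convergence)
    show "integrable (lebesgue_on \<Omega>) (\<lambda>x. \<bar>f x\<bar> * B)" using f by simp
    show "AE x in lebesgue_on \<Omega>. (\<lambda>j. f x * G (\<phi> j x)) \<longlonglongrightarrow> f x * G (u x)"
      using \<phi>(3)
      by eventually_elim (intro tendsto_intros isCont_tendsto_compose[OF smooth_truncation_continuous(1)[OF G]])
    show "AE x in lebesgue_on \<Omega>. norm (f x * G (\<phi> j x)) \<le> \<bar>f x\<bar> * B" for j
      using B(2) by (intro AE_I2) (auto simp: abs_mult intro!: mult_left_mono)
  qed measurable
  show ?thesis
    using LIMSEQ_unique[OF L[unfolded eq] R] unfolding VU unfolding U_def .
qed

text \<open>The inequality is applied to H composed with the approximations of u and passed to the
  limit. The Sobolev bound for H(u) thus comes without a chain rule for weak gradients.\<close>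

lemma sobolev_truncation:
  fixes u :: "'a::euclidean_space \<Rightarrow> real"
  assumes \<Omega>: "open \<Omega>" "bounded \<Omega>" and p: "p > 0" and s: "s > 0" and C: "C \<ge> 0"
    and sob: "\<And>\<phi>. \<phi> \<in> test_functions \<Omega> \<Longrightarrow>
       (LINT x|lborel. \<bar>\<phi> x\<bar> powr s) \<le> C * (LINT x|lborel. norm (grad \<phi> x) powr p) powr (s / p)"
    and u0: "u \<in> W1p_0 p \<Omega>" and H: "smooth_truncation H H'"
  shows "(LINT x|lebesgue_on \<Omega>. \<bar>H (u x)\<bar> powr s)
    \<le> C * (LINT x|lebesgue_on \<Omega>. (\<bar>H' (u x)\<bar> * norm (weak_grad \<Omega> u x)) powr p) powr (s / p)"
proof -
  interpret finite_measure "lebesgue_on \<Omega>" by (rule finite_measure_lebesgue_on_bounded[OF \<Omega>])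
  define U where "U = weak_grad \<Omega> u"
  have uW: "u \<in> W1p p \<Omega>" using u0 by (simp add: W1p_0_def)
  note U = W1p_weak_grad[OF \<Omega>(1) uW, folded U_def]
  have meas [measurable]: "u \<in> borel_measurable (lebesgue_on \<Omega>)" "U \<in> borel_measurable (lebesgue_on \<Omega>)"
    using has_weak_gradient_measurable[OF \<Omega>(1) U(1)] by auto
  note [measurable] = smooth_truncation_continuous(3,4)[OF H]
  obtain B where B: "B > 0" "\<And>t. \<bar>H t\<bar> \<le> B" "\<And>t. \<bar>H' t\<bar> \<le> B"
    using smooth_truncation_bounds[OF H] by blast
  obtain \<phi> D where \<phi>: "\<And>j. \<phi> j \<in> test_functions \<Omega>" "integrable (lebesgue_on \<Omega>) D"
    "AE x in lebesgue_on \<Omega>. (\<lambda>j. \<phi> j x) \<longlonglongrightarrow> u x"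
    "AE x in lebesgue_on \<Omega>. (\<lambda>j. grad (\<phi> j) x) \<longlonglongrightarrow> U x"
    "AE x in lebesgue_on \<Omega>. \<forall>j. norm (grad (\<phi> j) x) powr p \<le> D x"
    using W1p_0_approx[OF \<Omega>(1) p u0] unfolding U_def by blast
  have m\<phi> [measurable]: "\<phi> j \<in> borel_measurable (lebesgue_on \<Omega>)" "grad (\<phi> j) \<in> borel_measurable (lebesgue_on \<Omega>)" for j
    using continuous_measurable_lebesgue_on test_function_continuous[OF \<phi>(1)]
      test_function_continuous_grad[OF \<phi>(1)] by blast+
  have ineq: "(LINT x|lebesgue_on \<Omega>. \<bar>H (\<phi> j x)\<bar> powr s)
     \<le> C * (LINT x|lebesgue_on \<Omega>. (\<bar>H' (\<phi> j x)\<bar> * norm (grad (\<phi> j) x)) powr p) powr (s / p)" for j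
  proof -
    define \<psi> where "\<psi> x = H (\<phi> j x)" for x
    have \<psi>: "\<psi> \<in> test_functions \<Omega>" and g\<psi>: "grad \<psi> x = H' (\<phi> j x) *\<^sub>R grad (\<phi> j) x" for x
      using smooth_truncation_test_function[OF H \<phi>(1)[of j]] by (simp_all add: \<psi>_def[abs_def])
    obtain K where K: "compact K" "K \<subseteq> \<Omega>" "\<And>x. x \<notin> K \<Longrightarrow> \<psi> x = 0" "\<And>x. x \<notin> K \<Longrightarrow> grad \<psi> x = 0"
      using test_functionE[OF \<psi>] by blast
    have [measurable]: "\<psi> \<in> borel_measurable borel" "grad \<psi> \<in> borel_measurable borel"
      using test_function_continuous[OF \<psi>] test_function_continuous_grad[OF \<psi>]
      by (auto intro: borel_measurable_continuous_onI)
    have \<Omega>s: "\<Omega> \<in> sets lebesgue" using \<Omega> by auto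
    have "(LINT x|lebesgue_on \<Omega>. \<bar>\<psi> x\<bar> powr s) = (LINT x|lborel. \<bar>\<psi> x\<bar> powr s)"
    proof (rule lebesgue_on_eq_lborel(1)[OF \<Omega>s])
      show "\<bar>\<psi> x\<bar> powr s = 0" if "x \<notin> \<Omega>" for x
      proof -
        have "x \<notin> K" using that K(2) by blast
        then show ?thesis using K(3) by simp
      qed
    qed measurable
    moreover have "(LINT x|lebesgue_on \<Omega>. norm (grad \<psi> x) powr p) = (LINT x|lborel. norm (grad \<psi> x) powr p)"
    proof (rule lebesgue_on_eq_lborel(1)[OF \<Omega>s])
      show "norm (grad \<psi> x) powr p = 0" if "x \<notin> \<Omega>" for x
      proof -
        have "x \<notin> K" using that K(2) by blast
        then show ?thesis using K(4) by simp
      qed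
    qed measurable
    ultimately show ?thesis using sob[OF \<psi>] by (simp add: g\<psi>) (simp add: \<psi>_def)
  qed
  have L: "(\<lambda>j. LINT x|lebesgue_on \<Omega>. \<bar>H (\<phi> j x)\<bar> powr s) \<longlonglongrightarrow> (LINT x|lebesgue_on \<Omega>. \<bar>H (u x)\<bar> powr s)"
  proof (rule integral_dominated_convergence)
    show "integrable (lebesgue_on \<Omega>) (\<lambda>x. B powr s)" by simp
    show "AE x in lebesgue_on \<Omega>. (\<lambda>j. \<bar>H (\<phi> j x)\<bar> powr s) \<longlonglongrightarrow> \<bar>H (u x)\<bar> powr s"
      using \<phi>(3)
      by eventually_elim (intro tendsto_powr2 tendsto_intros isCont_tendsto_compose[OF smooth_truncation_continuous(1)[OF H]] s; simp)
    show "AE x in lebesgue_on \<Omega>. norm (\<bar>H (\<phi> j x)\<bar> powr s) \<le> B powr s" for j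
      using B(2) s by (intro AE_I2) (auto intro!: powr_mono2)
  qed measurable
  have R: "(\<lambda>j. LINT x|lebesgue_on \<Omega>. (\<bar>H' (\<phi> j x)\<bar> * norm (grad (\<phi> j) x)) powr p)
     \<longlonglongrightarrow> (LINT x|lebesgue_on \<Omega>. (\<bar>H' (u x)\<bar> * norm (U x)) powr p)"
  proof (rule integral_dominated_convergence)
    show "integrable (lebesgue_on \<Omega>) (\<lambda>x. B powr p * D x)" using \<phi>(2) by simp
    show "AE x in lebesgue_on \<Omega>. (\<lambda>j. (\<bar>H' (\<phi> j x)\<bar> * norm (grad (\<phi> j) x)) powr p) \<longlonglongrightarrow> (\<bar>H' (u x)\<bar> * norm (U x)) powr p"
      using \<phi>(3,4)
      by eventually_elim (intro tendsto_powr2 tendsto_intros isCont_tendsto_compose[OF smooth_truncation_continuous(2)[OF H]] p; simp)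
    show "AE x in lebesgue_on \<Omega>. norm ((\<bar>H' (\<phi> j x)\<bar> * norm (grad (\<phi> j) x)) powr p) \<le> B powr p * D x" for j
      using \<phi>(5)
    proof eventually_elim
      case (elim x)
      have "(\<bar>H' (\<phi> j x)\<bar> * norm (grad (\<phi> j) x)) powr p = \<bar>H' (\<phi> j x)\<bar> powr p * norm (grad (\<phi> j) x) powr p"
        by (simp add: powr_mult)
      also have "\<dots> \<le> B powr p * D x"
        using elim B(3) p by (intro mult_mono powr_mono2) auto
      finally show ?case by simp
    qed
  qed measurable
  have R': "(\<lambda>j. C * (LINT x|lebesgue_on \<Omega>. (\<bar>H' (\<phi> j x)\<bar> * norm (grad (\<phi> j) x)) powr p) powr (s / p))
     \<longlonglongrightarrow> C * (LINT x|lebesgue_on \<Omega>. (\<bar>H' (u x)\<bar> * norm (U x)) powr p) powr (s / p)"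
    using p s by (intro tendsto_mult_left tendsto_powr2[OF R] tendsto_const) (auto intro!: always_eventually integral_nonneg_AE)
  show ?thesis
    unfolding U_def[symmetric] by (rule LIMSEQ_le[OF L R']) (use ineq in auto)
qed

text \<open>
  As \<open>e\<close> tends to 0, \<open>reg_powr a e y\<close> tends to \<open>y|y|\<^sup>a\<close> and the bounded function \<open>cutoff e\<close> tends to
  the identity. Both are smooth, so composing them with a test function gives a test function.
\<close>

definition reg_powr :: "real \<Rightarrow> real \<Rightarrow> real \<Rightarrow> real" where
  "reg_powr a e y = y * (e\<^sup>2 + y\<^sup>2) powr (a / 2)"

definition reg_powr' :: "real \<Rightarrow> real \<Rightarrow> real \<Rightarrow> real" where
  "reg_powr' a e y = (e\<^sup>2 + y\<^sup>2) powr (a / 2 - 1) * (e\<^sup>2 + (1 + a) * y\<^sup>2)"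

definition cutoff :: "real \<Rightarrow> real \<Rightarrow> real" where
  "cutoff e t = t * (1 + (e * t)\<^sup>2) powr (- 1 / 2)"

definition cutoff' :: "real \<Rightarrow> real \<Rightarrow> real" where
  "cutoff' e t = (1 + (e * t)\<^sup>2) powr (- 3 / 2)"

lemma sum_squares_pos: "e > 0 \<Longrightarrow> (e::real)\<^sup>2 + y\<^sup>2 > 0" "1 + (z::real)\<^sup>2 > 0"
  by (simp_all add: add_pos_nonneg)

lemma reg_powr_has_derivative:
  assumes "e > 0"
  shows "(reg_powr a e has_real_derivative reg_powr' a e y) (at y)"
proof -
  note Z = sum_squares_pos(1)[OF assms, of y]
  have "(reg_powr a e has_real_derivative
      (e\<^sup>2 + y\<^sup>2) powr (a / 2) + y * (a / 2 * (e\<^sup>2 + y\<^sup>2) powr (a / 2 - 1) * (2 * y))) (at y)"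
    unfolding reg_powr_def[abs_def] using Z by (auto intro!: derivative_eq_intros simp: power2_eq_square)
  also have "(e\<^sup>2 + y\<^sup>2) powr (a / 2) = (e\<^sup>2 + y\<^sup>2) powr (a / 2 - 1) * (e\<^sup>2 + y\<^sup>2)"
    using Z powr_add[of "e\<^sup>2 + y\<^sup>2" "a / 2 - 1" 1] by simp
  finally show ?thesis by (simp add: reg_powr'_def algebra_simps power2_eq_square)
qed

lemma cutoff_has_derivative: "(cutoff e has_real_derivative cutoff' e t) (at t)"
proof -
  note Z = sum_squares_pos(2)[of "e * t"]
  have "(cutoff e has_real_derivative
     (1 + (e * t)\<^sup>2) powr (- 1 / 2) + t * (- 1 / 2 * (1 + (e * t)\<^sup>2) powr (- 3 / 2) * (2 * e\<^sup>2 * t))) (at t)"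
    unfolding cutoff_def[abs_def] using Z by (auto intro!: derivative_eq_intros simp: power2_eq_square)
  also have "(1 + (e * t)\<^sup>2) powr (- 1 / 2) = (1 + (e * t)\<^sup>2) powr (- 3 / 2) * (1 + (e * t)\<^sup>2)"
    using Z powr_add[of "1 + (e * t)\<^sup>2" "- 3 / 2" 1] by simp
  finally show ?thesis by (simp add: cutoff'_def algebra_simps power2_eq_square)
qed

lemma cutoff'_bounds: "0 \<le> cutoff' e t" "cutoff' e t \<le> 1"
proof -
  show "0 \<le> cutoff' e t" by (simp add: cutoff'_def)
  have "(1 + (e * t)\<^sup>2) powr (- 3 / 2) \<le> (1 + (e * t)\<^sup>2) powr 0"
    by (intro powr_mono) auto
  then show "cutoff' e t \<le> 1" using sum_squares_pos(2)[of "e * t"] by (simp add: cutoff'_def)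
qed

lemma cutoff_bound: "e > 0 \<Longrightarrow> \<bar>cutoff e t\<bar> \<le> 1 / e"
proof -
  assume e: "e > 0"
  have "e * \<bar>t\<bar> \<le> sqrt (1 + (e * t)\<^sup>2)"
    using e by (intro real_le_rsqrt) (auto simp: power_mult_distrib)
  moreover have "sqrt (1 + (e * t)\<^sup>2) > 0" using sum_squares_pos(2)[of "e * t"] by simp
  ultimately have "\<bar>t\<bar> * (1 / sqrt (1 + (e * t)\<^sup>2)) \<le> 1 / e"
    using e by (simp add: pos_le_divide_eq pos_divide_le_eq mult.commute)
  moreover have "(1 + (e * t)\<^sup>2) powr (- 1 / 2) = 1 / sqrt (1 + (e * t)\<^sup>2)"
    using powr_minus[of "1 + (e * t)\<^sup>2" "1 / 2"] by (simp add: powr_half_sqrt inverse_eq_divide)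
  ultimately show ?thesis by (simp add: cutoff_def abs_mult)
qed

text \<open>The cutoff takes its values in the compact interval from -1/e to 1/e, on which the
  continuous functions \<open>reg_powr\<close> and \<open>reg_powr'\<close> are bounded.\<close>

lemma smooth_truncation_reg_powr_cutoff:
  assumes e: "e > 0"
  shows "smooth_truncation (\<lambda>t. reg_powr a e (cutoff e t)) (\<lambda>t. reg_powr' a e (cutoff e t) * cutoff' e t)"
proof -
  have id: "Ck k (\<lambda>t::real. t)" for k using Ck_inner[of k "1::real"] by simp
  have c: "Ck k (cutoff e)" for k
    unfolding cutoff_def[abs_def] using sum_squares_pos(2)
    by (intro Ck_mult Ck_powr Ck_add Ck_power Ck_const id)
  have "Ck k (\<lambda>t. reg_powr a e (cutoff e t))" for k
    unfolding reg_powr_def using sum_squares_pos(1)[OF e]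
    by (intro Ck_mult Ck_powr Ck_add Ck_power Ck_const c)
  moreover have "((\<lambda>t. reg_powr a e (cutoff e t)) has_real_derivative reg_powr' a e (cutoff e t) * cutoff' e t) (at t)" for t
    by (rule DERIV_chain2[OF reg_powr_has_derivative[OF e] cutoff_has_derivative])
  moreover have cont: "continuous_on S (reg_powr a e)" "continuous_on S (reg_powr' a e)" "continuous_on S (cutoff e)" "continuous_on S (cutoff' e)" for S
    unfolding reg_powr_def[abs_def] reg_powr'_def[abs_def] cutoff_def[abs_def] cutoff'_def[abs_def]
    using sum_squares_pos(1)[OF e] sum_squares_pos(2)
    by (auto intro!: continuous_intros simp: less_imp_neq[symmetric])
  moreover have "continuous_on UNIV (\<lambda>t. reg_powr' a e (cutoff e t) * cutoff' e t)"
    by (intro continuous_on_mult continuous_on_compose2[OF cont(2) cont(3)] cont(4)) auto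
  moreover have cpt: "bounded (h ` {-1/e..1/e})" if "continuous_on {-1/e..1/e} h" for h :: "real \<Rightarrow> real"
    using that by (intro compact_imp_bounded compact_continuous_image) auto
  moreover have "cutoff e t \<in> {-1/e..1/e}" for t using cutoff_bound[OF e, of t] by auto
  moreover have "bounded (range (\<lambda>t. reg_powr a e (cutoff e t)))"
    by (rule bounded_subset[OF cpt[OF cont(1)]]) (use cutoff_bound[OF e] in \<open>auto simp: abs_le_iff minus_le_iff\<close>)
  moreover have "bounded (range (\<lambda>t. reg_powr' a e (cutoff e t) * cutoff' e t))"
  proof -
    obtain B where B: "B > 0" "\<forall>y\<in>{-1/e..1/e}. \<bar>reg_powr' a e y\<bar> \<le> B"
      using cpt[OF cont(2)] by (auto simp: bounded_pos)
    have "norm (reg_powr' a e (cutoff e t) * cutoff' e t) \<le> B * 1" for t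
      unfolding norm_mult using B cutoff_bound[OF e, of t] cutoff'_bounds[of e t]
      by (intro mult_mono) (auto simp: abs_le_iff minus_le_iff)
    then show ?thesis by (auto simp: bounded_iff)
  qed
  moreover have "reg_powr a e (cutoff e 0) = 0" by (simp add: reg_powr_def cutoff_def)
  ultimately show ?thesis unfolding smooth_truncation_def by blast
qed

text \<open>The factor \<open>e\<^sup>2 + (1 + a) y\<^sup>2\<close> lies between the smaller and the
  larger of 1 and 1 + a, times \<open>e\<^sup>2 + y\<^sup>2\<close>. Minimum and maximum are needed
  since a can have either sign; a > -1 keeps the lower bound positive.\<close>

lemma reg_powr'_bounds:
  assumes e: "e > 0" and a: "a > -1"
  shows "min 1 (1 + a) * (e\<^sup>2 + y\<^sup>2) powr (a / 2) \<le> reg_powr' a e y"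
    and "reg_powr' a e y \<le> max 1 (1 + a) * (e\<^sup>2 + y\<^sup>2) powr (a / 2)"
    and "0 \<le> reg_powr' a e y"
proof -
  note Z = sum_squares_pos(1)[OF e, of y]
  have eq: "c * (e\<^sup>2 + y\<^sup>2) powr (a / 2) = (e\<^sup>2 + y\<^sup>2) powr (a / 2 - 1) * (c * (e\<^sup>2 + y\<^sup>2))" for c
    using Z powr_add[of "e\<^sup>2 + y\<^sup>2" "a / 2 - 1" 1] by simp
  have "min 1 (1 + a) * e\<^sup>2 \<le> 1 * e\<^sup>2" "min 1 (1 + a) * y\<^sup>2 \<le> (1 + a) * y\<^sup>2"
    by (intro mult_right_mono; simp)+
  then show 1: "min 1 (1 + a) * (e\<^sup>2 + y\<^sup>2) powr (a / 2) \<le> reg_powr' a e y"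
    unfolding eq reg_powr'_def by (intro mult_left_mono) (auto simp: distrib_left)
  have "1 * e\<^sup>2 \<le> max 1 (1 + a) * e\<^sup>2" "(1 + a) * y\<^sup>2 \<le> max 1 (1 + a) * y\<^sup>2"
    by (intro mult_right_mono; simp)+
  then show "reg_powr' a e y \<le> max 1 (1 + a) * (e\<^sup>2 + y\<^sup>2) powr (a / 2)"
    unfolding eq reg_powr'_def by (intro mult_left_mono) (auto simp: distrib_left)
  have "0 \<le> min 1 (1 + a) * (e\<^sup>2 + y\<^sup>2) powr (a / 2)" using a by simp
  with 1 show "0 \<le> reg_powr' a e y" by linarith
qed

text \<open>
  The additive error cannot be dropped: near \<open>y = 0\<close> the two sides behave like \<open>|y|\<^sup>Q\<close> and
  \<open>|y|\<^sup>s\<close>, and \<open>Q\<close> may be smaller than \<open>s\<close>.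
\<close>

lemma reg_powr_compare:
  assumes e: "e > 0" and q: "Q > 0" and s: "s > 0" and r: "(1 + a) * Q = r" "(1 + b) * s = r" "r > 0"
  shows "\<bar>reg_powr a e y\<bar> powr Q \<le> 2 powr (s / 2) * \<bar>reg_powr b e y\<bar> powr s + (2 * e\<^sup>2) powr (r / 2)"
proof -
  define Z where "Z = e\<^sup>2 + y\<^sup>2"
  have Z: "Z > 0" unfolding Z_def by (rule sum_squares_pos(1)[OF e])
  have yk: "\<bar>y\<bar> powr k = (y\<^sup>2) powr (k / 2)" for k
  proof (cases "y = 0")
    case False
    then have "y\<^sup>2 = \<bar>y\<bar> powr 2" by simp
    then show ?thesis by (simp only: powr_powr) simp
  qed simp
  have "\<bar>reg_powr a e y\<bar> powr Q = (y\<^sup>2) powr (Q / 2) * Z powr (a * Q / 2)"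
    unfolding reg_powr_def Z_def[symmetric] abs_mult using Z by (simp add: powr_mult powr_powr yk)
  also have "\<dots> \<le> Z powr (Q / 2) * Z powr (a * Q / 2)"
    using q by (intro mult_right_mono powr_mono2) (auto simp: Z_def)
  also have "\<dots> = Z powr (r / 2)"
    using r(1) by (simp add: powr_add[symmetric] algebra_simps add_divide_distrib[symmetric])
  also have "\<dots> \<le> 2 powr (s / 2) * \<bar>reg_powr b e y\<bar> powr s + (2 * e\<^sup>2) powr (r / 2)"
  \<comment> \<open>If y dominates e, then Z is at most \<open>2 y\<^sup>2\<close> and the power can
    be returned to y; otherwise Z is of the size of \<open>e\<^sup>2\<close> and goes into the
    error.\<close>
  proof (cases "e\<^sup>2 \<le> y\<^sup>2")
    case True
    have "Z powr (r / 2) = Z powr (s / 2) * Z powr (b * s / 2)"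
      using r(2) by (simp add: powr_add[symmetric] algebra_simps add_divide_distrib[symmetric])
    also have "\<dots> \<le> (2 * y\<^sup>2) powr (s / 2) * Z powr (b * s / 2)"
      using s True Z by (intro mult_right_mono powr_mono2) (auto simp: Z_def)
    also have "\<dots> = 2 powr (s / 2) * \<bar>reg_powr b e y\<bar> powr s"
      unfolding reg_powr_def Z_def[symmetric] abs_mult using Z by (simp add: powr_mult powr_powr yk)
    finally show ?thesis by (simp add: add_increasing2)
  next
    case False
    then have "Z powr (r / 2) \<le> (2 * e\<^sup>2) powr (r / 2)"
      using r Z by (intro powr_mono2) (auto simp: Z_def)
    then show ?thesis by (simp add: add_increasing)
  qed
  finally show ?thesis .
qed

text \<open>If Y exceeds e, the sum c2 Y + e is at most (c2 + 1) Y, so Y is bounded by a constant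
  times its own power with exponent \<sigma> l < 1, and that power can be divided out.\<close>

lemma absorb_power:
  fixes Y F e c1 c2 \<sigma> l :: real
  assumes "Y \<ge> 0" "F \<ge> 0" "e \<ge> 0" "c1 \<ge> 0" "c2 \<ge> 0" and sl: "\<sigma> > 0" "l > 0" "\<sigma> * l < 1"
    and Y: "Y \<le> c1 * (F * (c2 * Y + e) powr l) powr \<sigma>"
  shows "Y \<le> e + (c1 * (c2 + 1) powr (\<sigma> * l)) powr (1 / (1 - \<sigma> * l)) * F powr (\<sigma> / (1 - \<sigma> * l))"
proof (cases "Y \<le> e")
  case True
  then show ?thesis by (simp add: add_increasing2)
next
  case False
  then have Y0: "Y > 0" using assms by simp
  define t where "t = \<sigma> * l"
  have "Y \<le> c1 * (F * ((c2 + 1) * Y) powr l) powr \<sigma>"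
    using False assms
    by (intro order.trans[OF Y] mult_left_mono powr_mono2) (auto simp: algebra_simps)
  also have "\<dots> = (c1 * (c2 + 1) powr t * F powr \<sigma>) * Y powr t"
    using assms by (simp add: powr_mult powr_powr t_def mult_ac)
  finally have "Y powr 1 * Y powr (- t) \<le> (c1 * (c2 + 1) powr t * F powr \<sigma>) * (Y powr t * Y powr (- t))"
    using Y0 by (simp add: mult_right_mono mult.assoc[symmetric])
  then have "Y powr (1 - t) \<le> c1 * (c2 + 1) powr t * F powr \<sigma>"
    using Y0 by (simp only: powr_add[symmetric]) simp
  then have "(Y powr (1 - t)) powr (1 / (1 - t)) \<le> (c1 * (c2 + 1) powr t * F powr \<sigma>) powr (1 / (1 - t))"
    using sl by (intro powr_mono2) (auto simp: t_def)
  then have "Y \<le> (c1 * (c2 + 1) powr t * F powr \<sigma>) powr (1 / (1 - t))"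
    using sl Y0 by (simp add: powr_powr t_def)
  also have "\<dots> = (c1 * (c2 + 1) powr t) powr (1 / (1 - t)) * F powr (\<sigma> / (1 - t))"
    using assms by (simp add: powr_mult powr_powr)
  finally show ?thesis using assms by (simp add: t_def)
qed

section \<open>The integral estimate for weak solutions\<close>

lemma reg_powr_cutoff_tendsto:
  assumes b: "b > -1" and s: "s > 0" and e: "\<And>i::nat. e i > 0" "e \<longlonglongrightarrow> 0"
  shows "(\<lambda>i. \<bar>reg_powr b (e i) (cutoff (e i) t)\<bar> powr s) \<longlonglongrightarrow> \<bar>t\<bar> powr ((1 + b) * s)"
proof (cases "t = 0")
  case True
  then show ?thesis using b s by (simp add: reg_powr_def cutoff_def)
next
  case False
  have c: "(\<lambda>i. cutoff (e i) t) \<longlonglongrightarrow> t * (1 + (0 * t)\<^sup>2) powr (- 1 / 2)"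
    unfolding cutoff_def using e by (intro tendsto_intros) auto
  then have "(\<lambda>i. \<bar>reg_powr b (e i) (cutoff (e i) t)\<bar> powr s) \<longlonglongrightarrow> \<bar>t * (0\<^sup>2 + t\<^sup>2) powr (b / 2)\<bar> powr s"
    unfolding reg_powr_def using e False s by (intro tendsto_powr2 tendsto_intros) auto
  also have "\<bar>t * (0\<^sup>2 + t\<^sup>2) powr (b / 2)\<bar> = \<bar>t\<bar> powr (1 + b)"
  proof -
    have "t\<^sup>2 = \<bar>t\<bar> powr 2" using False by simp
    then have "(t\<^sup>2) powr (b / 2) = \<bar>t\<bar> powr b" by (simp only: powr_powr) simp
    then show ?thesis using False by (simp add: abs_mult powr_add)
  qed
  finally show ?thesis by (simp add: powr_powr)
qed

text \<open>For q < n/p the condition on r is r < (p - 1) q n / (n - p q) with the denominator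
  cleared; for q = n/p it holds for every r, since its left side is 0. The regularized estimate is
  uniform in f, u and the parameter e up to an error that vanishes with e, and Fatou's lemma removes
  the regularization.\<close>

theorem weak_solution_Lr_bound:
  fixes \<Omega> :: "'a::euclidean_space set" and n p q r :: real
  assumes n: "n = real DIM('a)" and \<Omega>: "open \<Omega>" "bounded \<Omega>" and p: "1 < p" "p < n"
    and q: "q > 1" and r: "r > 0" "r * (n / q - p) < n * (p - 1)"
  shows "\<exists>C. \<forall>f u. f \<in> Lp q \<Omega> \<and> weak_solution p \<Omega> f u \<longrightarrow>
     u \<in> Lp r \<Omega> \<and> Lp_norm r \<Omega> u \<le> C * Lp_norm q \<Omega> f powr (1 / (p - 1))"
proof -
  interpret finite_measure "lebesgue_on \<Omega>" by (rule finite_measure_lebesgue_on_bounded[OF \<Omega>])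
  define Q where "Q = q / (q - 1)"
  have Q: "Q > 1" "1 / q + 1 / Q = 1" using q by (auto simp: Q_def field_simps)
  define a where "a = r / Q - 1"
  define b where "b = a / p"
  have a: "a > -1" using r Q by (simp add: a_def)
  have b: "b > -1" using a p by (simp add: b_def field_simps)
  define s where "s = r / (1 + b)"
  have s: "s > 0" using r b by (simp add: s_def)
  have rs: "(1 + a) * Q = r" "(1 + b) * s = r" using Q b by (auto simp: a_def s_def)
  have b1: "1 + b = (r / Q + p - 1) / p" using p by (simp add: b_def a_def field_simps)
  have "r / Q > 0" using r Q by simp
  then have den: "r / Q + p - 1 > 0" using p by linarith
  have sden: "s = r * p / (r / Q + p - 1)" unfolding s_def b1 using p by simp
  have "1 / Q = 1 - 1 / q" using Q by simp
  then have rQ: "r / Q = r - r / q" by (metis mult.right_neutral right_diff_distrib times_divide_eq_right)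
  \<comment> \<open>Since r/Q = r - r/q, the right side minus the left side is n (p - 1) - r (n/q -
    p), positive by the hypothesis on r.\<close>
  have "r * (n - p) < n * (r / Q + p - 1)"
    using r(2) unfolding rQ by (simp add: algebra_simps)
  then have "p * (r * (n - p)) < p * (n * (r / Q + p - 1))" using p by simp
  then have sob_s: "s * (n - p) < n * p"
    unfolding sden times_divide_eq_left pos_divide_less_eq[OF den] by (simp add: mult_ac)
  define \<sigma> where "\<sigma> = s / p"
  define l where "l = 1 / Q"
  define d where "d = r / Q + p - 1"
  have d: "d > 0" using den by (simp add: d_def)
  have \<sigma>: "\<sigma> > 0" using s p by (simp add: \<sigma>_def)
  have l: "l > 0" using Q by (simp add: l_def)
  have \<sigma>d: "\<sigma> = r / d" using p by (simp add: \<sigma>_def sden d_def)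
  have "1 - \<sigma> * l = (d - r / Q) / d"
    unfolding \<sigma>d l_def using d by (simp add: diff_divide_distrib)
  \<comment> \<open>Here p > 1 makes the absorption possible, and the quotient of \<sigma> by this
    number is the homogeneous exponent r/(p - 1).\<close>
  then have \<sigma>l: "1 - \<sigma> * l = (p - 1) / d" by (simp add: d_def)
  have "(p - 1) / d > 0" using p d by simp
  then have \<sigma>l1: "\<sigma> * l < 1" using \<sigma>l by simp
  have ex: "\<sigma> / (1 - \<sigma> * l) = r / (p - 1)"
  proof -
    have "\<sigma> / (1 - \<sigma> * l) = \<sigma> / ((p - 1) / d)" unfolding \<sigma>l ..
    also have "\<dots> = r / (p - 1)" using d by (simp add: \<sigma>d)
    finally show ?thesis .
  qed
  obtain Cs where Cs: "Cs \<ge> 0" "\<And>\<phi>. \<phi> \<in> test_functions \<Omega> \<Longrightarrow>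
    (LINT x|lborel. \<bar>\<phi> x\<bar> powr s) \<le> Cs * (LINT x|lborel. norm (grad \<phi> x) powr p) powr (s / p)"
    using sobolev_subcritical[OF \<Omega>(2) p(1) p(2)[unfolded n] s sob_s[unfolded n]] by blast
  \<comment> \<open>The upper constant for the derivative belonging to b, raised to the power p,
    over the lower constant for the derivative belonging to a.\<close>
  define \<kappa> where "\<kappa> = max 1 (1 + b) powr p / min 1 (1 + a)"
  have \<kappa>: "\<kappa> \<ge> 0" using a by (simp add: \<kappa>_def)
  define c1 c2 where "c1 = Cs * \<kappa> powr (s / p)" and "c2 = 2 powr (s / 2)"
  define V where "V = measure (lebesgue_on \<Omega>) \<Omega>"
  define K where "K = (c1 * (c2 + 1) powr (\<sigma> * l)) powr (1 / (1 - \<sigma> * l))"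
  define err where "err e = V * (2 * e\<^sup>2) powr (r / 2)" for e :: real
  have main: "integrable (lebesgue_on \<Omega>) (\<lambda>x. \<bar>reg_powr b e (cutoff e (u x))\<bar> powr s)"
    "(LINT x|lebesgue_on \<Omega>. \<bar>reg_powr b e (cutoff e (u x))\<bar> powr s) \<le> err e + K * Lp_norm q \<Omega> f powr (r / (p - 1))"
    if f: "f \<in> Lp q \<Omega>" and u: "weak_solution p \<Omega> f u" and e: "e > 0" for f u e
  proof -
    define G G' where "G t = reg_powr a e (cutoff e t)" and "G' t = reg_powr' a e (cutoff e t) * cutoff' e t" for t
    define H H' where "H t = reg_powr b e (cutoff e t)" and "H' t = reg_powr' b e (cutoff e t) * cutoff' e t" for t
    have G: "smooth_truncation G G'" and H: "smooth_truncation H H'"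
      unfolding G_def[abs_def] G'_def[abs_def] H_def[abs_def] H'_def[abs_def]
      by (rule smooth_truncation_reg_powr_cutoff[OF e])+
    have fm [measurable]: "f \<in> borel_measurable (lebesgue_on \<Omega>)" and fq: "integrable (lebesgue_on \<Omega>) (\<lambda>x. \<bar>f x\<bar> powr q)"
      using f by (auto simp: Lp_def)
    have f1: "integrable (lebesgue_on \<Omega>) f"
    proof -
      have "integrable (lebesgue_on \<Omega>) (\<lambda>x. \<bar>f x\<bar> powr 1)"
        by (rule Lp_mono_finite_measure(1)[OF finite_measure_axioms _ q fm fq]) simp
      then show ?thesis by (intro integrable_norm_cancel[OF _ fm]) simp
    qed
    have u0: "u \<in> W1p_0 p \<Omega>" using u by (simp add: weak_solution_def)
    define U where "U = weak_grad \<Omega> u"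
    have uW: "u \<in> W1p p \<Omega>" using u0 by (simp add: W1p_0_def)
    note U = W1p_weak_grad[OF \<Omega>(1) uW, folded U_def]
    have meas [measurable]: "u \<in> borel_measurable (lebesgue_on \<Omega>)" "U \<in> borel_measurable (lebesgue_on \<Omega>)"
      using has_weak_gradient_measurable[OF \<Omega>(1) U(1)] by auto
    note [measurable] = smooth_truncation_continuous(3,4)[OF H] smooth_truncation_continuous(3,4)[OF G]
    obtain BG where BG: "BG > 0" "\<And>t. \<bar>G t\<bar> \<le> BG" "\<And>t. \<bar>G' t\<bar> \<le> BG"
      using smooth_truncation_bounds[OF G] by blast
    obtain BH where BH: "BH > 0" "\<And>t. \<bar>H t\<bar> \<le> BH" "\<And>t. \<bar>H' t\<bar> \<le> BH"
      using smooth_truncation_bounds[OF H] by blast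
    \<comment> \<open>Y is the quantity to be absorbed. H is bounded and the domain has finite
      measure, so the integral is genuine before any estimate.\<close>
    define Y where "Y = (LINT x|lebesgue_on \<Omega>. \<bar>H (u x)\<bar> powr s)"
    have Y0: "Y \<ge> 0" unfolding Y_def by (intro integral_nonneg_AE) auto
    have Yint: "integrable (lebesgue_on \<Omega>) (\<lambda>x. \<bar>H (u x)\<bar> powr s)"
      using BH s by (intro integrable_const_bound[of _ "BH powr s"]) (auto intro!: AE_I2 powr_mono2)
    have Gint: "integrable (lebesgue_on \<Omega>) (\<lambda>x. \<bar>G (u x)\<bar> powr Q)"
      using BG Q by (intro integrable_const_bound[of _ "BG powr Q"]) (auto intro!: AE_I2 powr_mono2)
    have Upint: "integrable (lebesgue_on \<Omega>) (\<lambda>x. norm (U x) powr p)" using U(2) by (simp add: Lp_def)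
    have GUint: "integrable (lebesgue_on \<Omega>) (\<lambda>x. G' (u x) * norm (U x) powr p)"
    proof (rule Bochner_Integration.integrable_bound)
      show "integrable (lebesgue_on \<Omega>) (\<lambda>x. BG * norm (U x) powr p)" using Upint by simp
      show "AE x in lebesgue_on \<Omega>. norm (G' (u x) * norm (U x) powr p) \<le> norm (BG * norm (U x) powr p)"
        using BG by (intro AE_I2) (auto simp: abs_mult intro!: mult_right_mono)
    qed measurable
    have HG: "\<bar>H' t\<bar> powr p \<le> \<kappa> * G' t" for t
    proof -
      define y Z where "y = cutoff e t" and "Z = (e\<^sup>2 + y\<^sup>2) powr (a / 2)"
      note c' = cutoff'_bounds[of e t]
      have Zb: "((e\<^sup>2 + y\<^sup>2) powr (b / 2)) powr p = Z" using p by (simp add: Z_def powr_powr b_def)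
      have "\<bar>H' t\<bar> = reg_powr' b e y * cutoff' e t"
        using c' reg_powr'_bounds(3)[OF e b, of y] by (simp add: H'_def y_def abs_mult)
      then have "\<bar>H' t\<bar> powr p = reg_powr' b e y powr p * cutoff' e t powr p"
        using c' reg_powr'_bounds(3)[OF e b, of y] by (simp add: powr_mult)
      \<comment> \<open>The values of \<open>cutoff'\<close> lie between 0 and 1, so its p-th power
        is at most its first power, the one that occurs in G'.\<close>
      also have "\<dots> \<le> (max 1 (1 + b) * (e\<^sup>2 + y\<^sup>2) powr (b / 2)) powr p * cutoff' e t powr 1"
        using c' p reg_powr'_bounds(2,3)[OF e b, of y] by (intro mult_mono powr_mono2 powr_mono') auto
      also have "\<dots> = max 1 (1 + b) powr p * Z * cutoff' e t"
        using c' by (simp add: powr_mult Zb)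
      also have "\<dots> = \<kappa> * (min 1 (1 + a) * Z) * cutoff' e t" using a by (simp add: \<kappa>_def)
      also have "\<dots> \<le> \<kappa> * reg_powr' a e y * cutoff' e t"
        using c' \<kappa> reg_powr'_bounds(1)[OF e a, of y] unfolding Z_def by (intro mult_right_mono mult_left_mono) auto
      finally show ?thesis by (simp add: G'_def y_def)
    qed
    define X where "X = (LINT x|lebesgue_on \<Omega>. (\<bar>H' (u x)\<bar> * norm (U x)) powr p)"
    have YX: "Y \<le> Cs * X powr (s / p)"
      unfolding Y_def X_def U_def using p s Cs by (intro sobolev_truncation[OF \<Omega> _ _ _ _ u0 H]) auto

    \<comment> \<open>This closes the circle: Sobolev bounds Y by X, the comparison of H' with G'
      and the tested equation bound X by the integral of f G(u), and Holder with the comparison of G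
      and H leads back to Y.\<close>
    have "X \<le> (LINT x|lebesgue_on \<Omega>. \<kappa> * (G' (u x) * norm (U x) powr p))"
      unfolding X_def
    proof (rule integral_mono_AE')
      show "AE x in lebesgue_on \<Omega>. (\<bar>H' (u x)\<bar> * norm (U x)) powr p \<le> \<kappa> * (G' (u x) * norm (U x) powr p)"
        using mult_right_mono[OF HG] by (intro AE_I2) (simp add: powr_mult mult.assoc)
      show "AE x in lebesgue_on \<Omega>. 0 \<le> \<kappa> * (G' (u x) * norm (U x) powr p)"
      proof (rule AE_I2)
        fix x
        have "0 \<le> \<kappa> * G' (u x)" using HG[of "u x"] powr_ge_zero order.trans by blast
        then have "0 \<le> (\<kappa> * G' (u x)) * norm (U x) powr p" by (rule mult_nonneg_nonneg) simp
        then show "0 \<le> \<kappa> * (G' (u x) * norm (U x) powr p)" by (simp add: mult.assoc)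
      qed
    qed (use GUint in simp)
    also have "\<dots> = \<kappa> * (LINT x|lebesgue_on \<Omega>. f x * G (u x))"
      using weak_solution_test_truncation[OF \<Omega>(1) p(1) f1 u G] by (simp add: U_def)
    also have "\<dots> \<le> \<kappa> * (Lp_norm q \<Omega> f * (c2 * Y + err e) powr l)"
    proof (rule mult_left_mono[OF _ \<kappa>])
      have "(LINT x|lebesgue_on \<Omega>. f x * G (u x)) \<le> (LINT x|lebesgue_on \<Omega>. \<bar>f x * G (u x)\<bar>)"
        using Holder_inequality(1)[OF q Q(1) Q(2) fm _ fq Gint] by (intro integral_mono) auto
      also have "\<dots> \<le> (LINT x|lebesgue_on \<Omega>. \<bar>f x\<bar> powr q) powr (1 / q) * (LINT x|lebesgue_on \<Omega>. \<bar>G (u x)\<bar> powr Q) powr (1 / Q)"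
        using Holder_inequality(2)[OF q Q(1) Q(2) fm _ fq Gint] by simp
      also have "\<dots> = Lp_norm q \<Omega> f * (LINT x|lebesgue_on \<Omega>. \<bar>G (u x)\<bar> powr Q) powr l"
        by (simp add: Lp_norm_def l_def)
      also have "\<dots> \<le> Lp_norm q \<Omega> f * (c2 * Y + err e) powr l"
      proof (intro mult_left_mono powr_mono2)
        have "(LINT x|lebesgue_on \<Omega>. \<bar>G (u x)\<bar> powr Q) \<le> (LINT x|lebesgue_on \<Omega>. c2 * \<bar>H (u x)\<bar> powr s + (2 * e\<^sup>2) powr (r / 2))"
          using Gint Yint reg_powr_compare[OF e _ s rs r(1)] Q
          by (intro integral_mono) (auto simp: c2_def G_def H_def)
        also have "\<dots> = c2 * Y + err e"
          using Yint by (simp add: Y_def err_def V_def)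
        finally show "(LINT x|lebesgue_on \<Omega>. \<bar>G (u x)\<bar> powr Q) \<le> c2 * Y + err e" .
      qed (use l in \<open>auto simp: Lp_norm_def intro!: integral_nonneg_AE\<close>)
      finally show "(LINT x|lebesgue_on \<Omega>. f x * G (u x)) \<le> Lp_norm q \<Omega> f * (c2 * Y + err e) powr l" .
    qed
    finally have "X \<le> \<kappa> * (Lp_norm q \<Omega> f * (c2 * Y + err e) powr l)" .
    moreover have "X \<ge> 0" unfolding X_def by (intro integral_nonneg_AE) auto
    ultimately have "Y \<le> Cs * (\<kappa> * (Lp_norm q \<Omega> f * (c2 * Y + err e) powr l)) powr (s / p)"
      using Cs(1) p s by (intro order.trans[OF YX] mult_left_mono powr_mono2) auto
    then have "Y \<le> c1 * (Lp_norm q \<Omega> f * (c2 * Y + err e) powr l) powr \<sigma>"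
      using \<kappa> by (simp add: c1_def \<sigma>_def powr_mult Lp_norm_def mult_ac)
    then have "Y \<le> err e + (c1 * (c2 + 1) powr (\<sigma> * l)) powr (1 / (1 - \<sigma> * l)) * Lp_norm q \<Omega> f powr (\<sigma> / (1 - \<sigma> * l))"
      using Y0 Cs \<sigma> l \<sigma>l1 by (intro absorb_power) (auto simp: Lp_norm_def err_def V_def c1_def c2_def)
    then show "(LINT x|lebesgue_on \<Omega>. \<bar>reg_powr b e (cutoff e (u x))\<bar> powr s) \<le> err e + K * Lp_norm q \<Omega> f powr (r / (p - 1))"
      by (simp add: Y_def H_def K_def ex)
    show "integrable (lebesgue_on \<Omega>) (\<lambda>x. \<bar>reg_powr b e (cutoff e (u x))\<bar> powr s)"
      using Yint by (simp add: H_def)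
  qed
  show ?thesis
  proof (intro exI[of _ "K powr (1 / r)"] allI impI; elim conjE)
    fix f u assume f: "f \<in> Lp q \<Omega>" and u: "weak_solution p \<Omega> f u"
    define N where "N = Lp_norm q \<Omega> f powr (r / (p - 1))"
    have uW: "u \<in> W1p p \<Omega>" using u by (simp add: weak_solution_def W1p_0_def)
    have um: "u \<in> borel_measurable (lebesgue_on \<Omega>)"
      using has_weak_gradient_measurable[OF \<Omega>(1) W1p_weak_grad(1)[OF \<Omega>(1) uW]] by auto
    define e where "e i = inverse (real (Suc i))" for i
    have e: "e i > 0" for i by (simp add: e_def)
    have e0: "e \<longlonglongrightarrow> 0" unfolding e_def by (rule LIMSEQ_inverse_real_of_nat)
    have "(\<lambda>i. err (e i)) \<longlonglongrightarrow> V * 0"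
      unfolding err_def using e0 r
      by (intro tendsto_mult_left tendsto_zero_powrI[of _ _ _ "r/2"] tendsto_eq_intros(1) ) (auto intro!: tendsto_eq_intros)
    then have lim: "(\<lambda>i. err (e i) + K * N) \<longlonglongrightarrow> K * N"
      using tendsto_add[of "\<lambda>i. err (e i)" 0 sequentially "\<lambda>i. K * N" "K * N"] by simp
    have le: "(LINT x|lebesgue_on \<Omega>. \<bar>reg_powr b (e i) (cutoff (e i) (u x))\<bar> powr s) \<le> err (e i) + K * N" for i
      using main(2)[OF f u e] by (simp add: N_def)
    have AE: "AE x in lebesgue_on \<Omega>. (\<lambda>i. \<bar>reg_powr b (e i) (cutoff (e i) (u x))\<bar> powr s) \<longlonglongrightarrow> \<bar>u x\<bar> powr r"
      using reg_powr_cutoff_tendsto[OF b s e e0] rs by simp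
    have um': "(\<lambda>x. \<bar>u x\<bar> powr r) \<in> borel_measurable (lebesgue_on \<Omega>)"
      using um by measurable
    note F = Fatou_integral_bound[OF main(1)[OF f u e] powr_ge_zero um' powr_ge_zero AE le lim]
    have "u \<in> Lp r \<Omega>" using um F(1) by (simp add: Lp_def)
    moreover have "Lp_norm r \<Omega> u \<le> (K * N) powr (1 / r)"
      unfolding Lp_norm_def using F(2) r by (intro powr_mono2) (auto intro!: integral_nonneg_AE)
    moreover have "(K * N) powr (1 / r) = K powr (1 / r) * Lp_norm q \<Omega> f powr (1 / (p - 1))"
      using r by (simp add: K_def N_def powr_mult powr_powr)
    ultimately show "u \<in> Lp r \<Omega> \<and> Lp_norm r \<Omega> u \<le> K powr (1 / r) * Lp_norm q \<Omega> f powr (1 / (p - 1))" by simp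
  qed
qed

section \<open>Powers of the distance to a point\<close>

lemma integrable_bounded_compact_support:
  fixes f :: "'a::euclidean_space \<Rightarrow> real"
  assumes "f \<in> borel_measurable borel" "\<And>x. \<bar>f x\<bar> \<le> B * indicator (cball 0 R) x"
  shows "integrable lborel f"
proof (rule Bochner_Integration.integrable_bound)
  show "integrable lborel (\<lambda>x::'a. B * indicator (cball 0 R) x :: real)"
    using emeasure_bounded_finite[of "cball (0::'a) R"] by (intro integrable_mult_right integrable_real_indicator) auto
  show "AE x in lborel. norm (f x) \<le> norm (B * indicator (cball 0 R) x)"
    using assms(2) by (intro AE_I2) (auto intro: order.trans[OF _ abs_ge_self])
qed (use assms in simp)

text \<open>The integral over the shell from \<open>R / 2 ^ k\<close> to R is compared with its
  image under halving. Each further halving gives I' = a + \<theta> I with \<theta> =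
  \<open>2 powr \<gamma> / 2 ^ DIM('a)\<close>, which is below 1 exactly because \<gamma> is below
  the dimension, so all shells stay below a / (1 - \<theta>).\<close>

lemma integrable_norm_powr_0:
  fixes \<gamma> R :: real
  assumes \<gamma>: "0 < \<gamma>" "\<gamma> < real DIM('a::euclidean_space)" and R: "R > 0"
  shows "integrable lborel (\<lambda>x::'a. indicator (cball 0 R) x * norm x powr (- \<gamma>))"
proof -
  define h where "h k x = indicator {x. R / 2 ^ k < norm x \<and> norm x \<le> R} x * norm x powr (- \<gamma>)" for k and x :: 'a
  have hm [measurable]: "h k \<in> borel_measurable borel" for k unfolding h_def[abs_def] by measurable
  have h0: "h k x \<ge> 0" for k x by (simp add: h_def)
  have hi: "integrable lborel (h k)" for k
  proof (rule integrable_bounded_compact_support[OF hm, of _ "(R / 2 ^ k) powr (- \<gamma>)" R])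
    show "\<bar>h k x\<bar> \<le> (R / 2 ^ k) powr (- \<gamma>) * indicator (cball 0 R) x" for x
      using R \<gamma> by (auto simp: h_def indicator_def intro!: powr_mono2')
  qed
  define a \<theta> where "a = (LINT x|lborel. h 1 x)" and "\<theta> = 2 powr \<gamma> / 2 ^ DIM('a)"
  have \<theta>: "0 \<le> \<theta>" "\<theta> < 1"
  proof -
    have "2 powr \<gamma> < 2 powr real DIM('a)" using \<gamma> by (intro powr_less_mono) auto
    then show "\<theta> < 1" by (simp add: \<theta>_def powr_realpow)
  qed (simp add: \<theta>_def)
  have step: "(LINT x|lborel. h (Suc k) x) = a + \<theta> * (LINT x|lborel. h k x)" for k
  proof -
    define g where "g x = h (Suc k) x - h 1 x" for x
    have gi: "integrable lborel g" unfolding g_def[abs_def] using hi by simp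
    have g: "g ((1 / 2) *\<^sub>R x) = 2 powr \<gamma> * h k x" for x
    proof -
      have "R / 2 ^ Suc k \<le> R / 2" using R by (simp add: divide_simps)
      then have "g y = indicator {x. R / 2 ^ Suc k < norm x \<and> norm x \<le> R / 2} y * norm y powr (- \<gamma>)" for y
        using R by (auto simp: g_def h_def indicator_def)
      then have "g ((1 / 2) *\<^sub>R x) = indicator {x. R / 2 ^ k < norm x \<and> norm x \<le> R} x * (norm x / 2) powr (- \<gamma>)"
        using R by (auto simp: indicator_def field_simps)
      also have "(norm x / 2) powr (- \<gamma>) = 2 powr \<gamma> * norm x powr (- \<gamma>)"
        by (simp add: powr_divide powr_minus field_simps)
      finally show ?thesis by (simp add: h_def)
    qed
    have "2 powr \<gamma> * (LINT x|lborel. h k x) = (LINT x|lborel. g ((1 / 2) *\<^sub>R x))" by (simp add: g)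
    also have "\<dots> = (LINT x|lborel. g x) * 2 ^ DIM('a)"
      using integral_scale_translate(2)[OF gi, of "1/2" 0] by (simp add: power_one_over field_simps)
    also have "(LINT x|lborel. g x) = (LINT x|lborel. h (Suc k) x) - a"
      unfolding g_def a_def using hi by simp
    finally show ?thesis by (simp add: \<theta>_def field_simps)
  qed
  have "a \<ge> 0" unfolding a_def using h0 by (intro integral_nonneg_AE) auto
  have bd: "(LINT x|lborel. h k x) \<le> a / (1 - \<theta>)" for k
  proof (induction k)
    case 0
    have "h 0 x = 0" for x by (simp add: h_def indicator_def)
    then show ?case using \<open>a \<ge> 0\<close> \<theta> by simp
  next
    case (Suc k)
    have "a + \<theta> * (LINT x|lborel. h k x) \<le> a + \<theta> * (a / (1 - \<theta>))"
      using Suc \<theta> by (intro add_left_mono mult_left_mono) auto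
    also have "\<dots> = a / (1 - \<theta>)" using \<theta> by (simp add: field_simps)
    finally show ?case by (simp add: step)
  qed
  show ?thesis
  proof (rule Fatou_integral_bound(1)[where g=h, OF hi h0 _ _ _ bd tendsto_const])
    show "AE x in lborel. (\<lambda>k. h k x) \<longlonglongrightarrow> indicator (cball 0 R) x * norm x powr (- \<gamma>)"
    proof (rule AE_I2)
      fix x :: 'a
      show "(\<lambda>k. h k x) \<longlonglongrightarrow> indicator (cball 0 R) x * norm x powr (- \<gamma>)"
      proof (cases "x = 0")
        case False
        have "(\<lambda>k. R * (1 / 2) ^ k) \<longlonglongrightarrow> R * 0"
          by (intro tendsto_intros LIMSEQ_power_zero) auto
        then have "eventually (\<lambda>k. R * (1 / 2) ^ k < norm x) sequentially"
          using False by (auto dest!: order_tendstoD(2)[where a="norm x"])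
        then have "eventually (\<lambda>k. h k x = indicator (cball 0 R) x * norm x powr (- \<gamma>)) sequentially"
          by eventually_elim (simp add: h_def indicator_def power_one_over)
        then show ?thesis by (rule tendsto_eventually)
      qed (simp add: h_def)
    qed
    show "(\<lambda>x::'a. indicator (cball 0 R) x * norm x powr (- \<gamma>)) \<in> borel_measurable lborel"
      by (intro borel_measurable_times borel_measurable_indicator) auto
  qed simp
qed

lemma integrable_norm_powr:
  fixes c :: "'a::euclidean_space" and \<gamma> R :: real
  assumes "0 < \<gamma>" "\<gamma> < real DIM('a)" "R > 0"
  shows "integrable lborel (\<lambda>x. indicator (cball c R) x * norm (x - c) powr (- \<gamma>))"
proof -
  have "indicator (cball 0 R) (- c + 1 *\<^sub>R x) * norm (- c + 1 *\<^sub>R x) powr (- \<gamma>)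
      = (indicator (cball c R) x * norm (x - c) powr (- \<gamma>) :: real)" for x
    by (simp add: indicator_def dist_norm norm_minus_commute)
  then show ?thesis
    using integral_scale_translate(1)[OF integrable_norm_powr_0[OF assms] zero_less_one, of "-c"] by (simp only:)
qed

text \<open>This power is scale invariant, so the integrals over the balls of radius \<delta> and
  \<delta>/2 would agree if they were finite. The shell between them would then contribute nothing,
  although the integrand is positive there and the shell contains a ball.\<close>

lemma not_integrable_norm_powr_dim:
  fixes c :: "'a::euclidean_space"
  assumes \<delta>: "\<delta> > 0"
  shows "\<not> integrable lborel (\<lambda>x. indicator (ball c \<delta>) x * norm (x - c) powr (- real DIM('a)))"
proof
  define n where "n = real DIM('a)"
  define h where "h x = indicator (ball c \<delta>) x * norm (x - c) powr (- n)" for x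
  assume "integrable lborel (\<lambda>x. indicator (ball c \<delta>) x * norm (x - c) powr (- real DIM('a)))"
  then have h: "integrable lborel h" by (simp add: h_def[abs_def] n_def)
  define k where "k d w = indicator (ball 0 d) w * norm w powr (- n)" for d and w :: 'a
  have k1: "h (c + 1 *\<^sub>R w) = k \<delta> w" for w by (simp add: h_def k_def indicator_def dist_norm)
  have k2: "h (c + 2 *\<^sub>R w) = k (\<delta> / 2) w / 2 ^ DIM('a)" for w
    by (simp add: h_def k_def indicator_def dist_norm powr_mult powr_minus n_def powr_realpow field_simps)
  have k1i: "integrable lborel (k \<delta>)" "(LINT w|lborel. k \<delta> w) = (LINT w|lborel. h w)"
    using integral_scale_translate[OF h, of 1 c] unfolding k1 by auto
  have "(2::real) > 0" by simp
  note S = integral_scale_translate[OF h this, where x=c, unfolded k2]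
  have "integrable lborel (\<lambda>w. 2 ^ DIM('a) * (k (\<delta> / 2) w / 2 ^ DIM('a)))"
    by (rule integrable_mult_right[OF S(1)])
  moreover have "(\<lambda>w. 2 ^ DIM('a) * (k (\<delta> / 2) w / 2 ^ DIM('a))) = k (\<delta> / 2)" by auto
  ultimately have k2i: "integrable lborel (k (\<delta> / 2))" by (simp only:)
  have k2i: "integrable lborel (k (\<delta> / 2))" "(LINT w|lborel. k (\<delta> / 2) w) = (LINT w|lborel. h w)"
    using k2i S(2) by simp_all
  have le: "k (\<delta> / 2) w \<le> k \<delta> w" for w using \<delta> by (auto simp: k_def indicator_def)
  have "(LINT w|lborel. k \<delta> w - k (\<delta> / 2) w) = 0" using k1i k2i by simp
  then have AE: "AE w in lborel. k \<delta> w - k (\<delta> / 2) w = 0"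
    using k1i k2i le by (subst (asm) integral_nonneg_eq_0_iff_AE) auto
  obtain z :: 'a where z: "norm z = 3 / 4 * \<delta>" using vector_choose_size[of "3 / 4 * \<delta>"] \<delta> by auto
  have "w \<notin> ball z (\<delta> / 4)" if "k \<delta> w - k (\<delta> / 2) w = 0" for w
  proof
    assume "w \<in> ball z (\<delta> / 4)"
    then have "norm (z - w) < \<delta> / 4" by (simp add: dist_norm)
    then have "norm w < \<delta>" "\<delta> / 2 < norm w"
      using norm_triangle_ineq2[of z w] norm_triangle_ineq2[of w z] z by (auto simp: norm_minus_commute)
    then have "k \<delta> w - k (\<delta> / 2) w = norm w powr (- n)" "norm w > 0"
      using \<delta> by (auto simp: k_def)
    then show False using that by simp
  qed
  then have "AE w in lborel. w \<notin> ball z (\<delta> / 4)" using AE by (auto elim!: eventually_mono)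
  then have "ball z (\<delta> / 4) \<in> null_sets lborel" by (subst AE_iff_null_sets) auto
  then have "measure lborel (ball z (\<delta> / 4)) = 0" by (simp add: measure_def null_setsD1)
  moreover have "measure lborel (ball z (\<delta> / 4)) > 0" using \<delta> by (intro content_ball_pos) simp
  ultimately show False by simp
qed

text \<open>Functions with a singularity are recognised as elements of \<open>W1p_0\<close> through
  test functions that converge together with their gradients under fixed p-integrable majorants.
  Dominated convergence yields both the integration by parts formula and the approximation in
  norm.\<close>

lemma W1p_0I_dominated:
  fixes v :: "'a::euclidean_space \<Rightarrow> real"
  assumes \<Omega>: "open \<Omega>" "bounded \<Omega>" and p: "p > 1"
    and vi: "\<And>i::nat. vi i \<in> test_functions \<Omega>"
    and meas [measurable]: "v \<in> borel_measurable (lebesgue_on \<Omega>)" "g \<in> borel_measurable (lebesgue_on \<Omega>)"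
      "a \<in> borel_measurable (lebesgue_on \<Omega>)" "d \<in> borel_measurable (lebesgue_on \<Omega>)"
    and lim: "AE x in lebesgue_on \<Omega>. (\<lambda>i. vi i x) \<longlonglongrightarrow> v x" "AE x in lebesgue_on \<Omega>. (\<lambda>i. grad (vi i) x) \<longlonglongrightarrow> g x"
    and dom: "AE x in lebesgue_on \<Omega>. \<forall>i. \<bar>vi i x\<bar> \<le> a x" "AE x in lebesgue_on \<Omega>. \<forall>i. norm (grad (vi i) x) \<le> d x"
    and int: "integrable (lebesgue_on \<Omega>) (\<lambda>x. \<bar>a x\<bar> powr p)" "integrable (lebesgue_on \<Omega>) (\<lambda>x. \<bar>d x\<bar> powr p)"
  shows "v \<in> W1p_0 p \<Omega>" "has_weak_gradient \<Omega> v g"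
proof -
  interpret finite_measure "lebesgue_on \<Omega>" by (rule finite_measure_lebesgue_on_bounded[OF \<Omega>])
  have p0: "p > 0" using p by simp
  have mi [measurable]: "vi i \<in> borel_measurable (lebesgue_on \<Omega>)" "grad (vi i) \<in> borel_measurable (lebesgue_on \<Omega>)" for i
    using continuous_measurable_lebesgue_on test_function_continuous[OF vi]
      test_function_continuous_grad[OF vi] by blast+
  have int1: "integrable (lebesgue_on \<Omega>) a" "integrable (lebesgue_on \<Omega>) d"
  proof -
    have "integrable (lebesgue_on \<Omega>) (\<lambda>x. \<bar>a x\<bar> powr 1)" "integrable (lebesgue_on \<Omega>) (\<lambda>x. \<bar>d x\<bar> powr 1)"
      by (rule Lp_mono_finite_measure(1)[OF finite_measure_axioms _ p _ int(1)] Lp_mono_finite_measure(1)[OF finite_measure_axioms _ p _ int(2)]; simp)+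
    then show "integrable (lebesgue_on \<Omega>) a" "integrable (lebesgue_on \<Omega>) d"
      by (auto intro: integrable_norm_cancel[OF _ meas(3)] integrable_norm_cancel[OF _ meas(4)])
  qed
  have vb: "AE x in lebesgue_on \<Omega>. \<bar>v x\<bar> \<le> a x"
    using lim(1) dom(1)
  proof eventually_elim
    case (elim x)
    have "(\<lambda>i. \<bar>vi i x\<bar>) \<longlonglongrightarrow> \<bar>v x\<bar>" using elim(1) by (rule tendsto_rabs)
    then show ?case using elim(2) by (intro LIMSEQ_le_const2) auto
  qed
  have gb: "AE x in lebesgue_on \<Omega>. norm (g x) \<le> d x"
    using lim(2) dom(2)
  proof eventually_elim
    case (elim x)
    have "(\<lambda>i. norm (grad (vi i) x)) \<longlonglongrightarrow> norm (g x)" using elim(1) by (rule tendsto_norm)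
    then show ?case using elim(2) by (intro LIMSEQ_le_const2) auto
  qed
  have powr_bd: "integrable (lebesgue_on \<Omega>) (\<lambda>x. norm (w x) powr p)"
    if "w \<in> borel_measurable (lebesgue_on \<Omega>)" "AE x in lebesgue_on \<Omega>. norm (w x) \<le> k x"
       "integrable (lebesgue_on \<Omega>) (\<lambda>x. \<bar>k x\<bar> powr p)" for w :: "'a \<Rightarrow> 'b::euclidean_space" and k
  proof (rule Bochner_Integration.integrable_bound[OF that(3)])
    show "AE x in lebesgue_on \<Omega>. norm (norm (w x) powr p) \<le> norm (\<bar>k x\<bar> powr p)"
      using that(2) by eventually_elim (use p in \<open>auto intro!: powr_mono2\<close>)
  qed (use that(1) in measurable)
  have vL: "v \<in> Lp p \<Omega>" and gL: "g \<in> Lp p \<Omega>"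
    using powr_bd[OF meas(1) _ int(1)] powr_bd[OF meas(2) _ int(2)] vb gb meas by (auto simp: Lp_def)
  have vint: "integrable (lebesgue_on \<Omega>) v"
    by (rule Bochner_Integration.integrable_bound[OF int1(1) meas(1)]) (use vb in \<open>auto elim!: eventually_mono\<close>)
  have gint: "integrable (lebesgue_on \<Omega>) g"
    by (rule Bochner_Integration.integrable_bound[OF int1(2) meas(2)]) (use gb in \<open>auto elim!: eventually_mono\<close>)
  have li: "w locally_integrable_on \<Omega>" if w: "integrable (lebesgue_on \<Omega>) w" for w :: "'a \<Rightarrow> 'b::euclidean_space"
    unfolding locally_integrable_on_def
  proof (intro allI impI; elim conjE)
    fix K assume K: "compact K" "K \<subseteq> \<Omega>"
    then have Ks: "K \<in> sets lebesgue" by (simp add: lmeasurable_compact fmeasurableD)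
    have "set_integrable lebesgue \<Omega> w"
      using w \<Omega> by (simp add: set_integrable_def integrable_restrict_space)
    then have "set_integrable lebesgue K w" using K Ks by (intro set_integrable_subset[of _ \<Omega> _ K]) auto
    then show "integrable (lebesgue_on K) w"
      using Ks by (simp add: set_integrable_def integrable_restrict_space)
  qed
  have ibp: "(LINT x|lebesgue_on \<Omega>. v x *\<^sub>R grad \<phi> x) = - (LINT x|lebesgue_on \<Omega>. \<phi> x *\<^sub>R g x)"
    if \<phi>: "\<phi> \<in> test_functions \<Omega>" for \<phi>
  proof -
    obtain K where K: "compact K" "K \<subseteq> \<Omega>" "\<And>x. x \<notin> K \<Longrightarrow> \<phi> x = 0" "\<And>x. x \<notin> K \<Longrightarrow> grad \<phi> x = 0"
      using test_functionE[OF \<phi>] by blast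
    note c = test_function_continuous[OF \<phi>] test_function_continuous_grad[OF \<phi>]
    have [measurable]: "\<phi> \<in> borel_measurable (lebesgue_on \<Omega>)" "grad \<phi> \<in> borel_measurable (lebesgue_on \<Omega>)"
      using c by (auto intro: continuous_measurable_lebesgue_on)
    obtain B1 where B1: "B1 > 0" "\<And>x. norm (\<phi> x) \<le> B1" using compact_support_bounded[OF c(1) K(1,3)] by blast
    obtain B2 where B2: "B2 > 0" "\<And>x. norm (grad \<phi> x) \<le> B2" using compact_support_bounded[OF c(2) K(1,4)] by blast
    have L1: "(\<lambda>i. LINT x|lebesgue_on \<Omega>. vi i x *\<^sub>R grad \<phi> x) \<longlonglongrightarrow> (LINT x|lebesgue_on \<Omega>. v x *\<^sub>R grad \<phi> x)"
    proof (rule integral_dominated_convergence)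
      show "integrable (lebesgue_on \<Omega>) (\<lambda>x. a x * B2)" using int1 by simp
      show "AE x in lebesgue_on \<Omega>. (\<lambda>i. vi i x *\<^sub>R grad \<phi> x) \<longlonglongrightarrow> v x *\<^sub>R grad \<phi> x"
        using lim(1) by eventually_elim (intro tendsto_intros)
      show "AE x in lebesgue_on \<Omega>. norm (vi i x *\<^sub>R grad \<phi> x) \<le> a x * B2" for i
        using dom(1)
      proof eventually_elim
        case (elim x)
        then have "\<bar>vi i x\<bar> \<le> a x" "0 \<le> a x" using abs_ge_zero order.trans by blast+
        then show ?case using B2(2)[of x] by (auto intro!: mult_mono)
      qed
    qed measurable
    have L2: "(\<lambda>i. LINT x|lebesgue_on \<Omega>. \<phi> x *\<^sub>R grad (vi i) x) \<longlonglongrightarrow> (LINT x|lebesgue_on \<Omega>. \<phi> x *\<^sub>R g x)"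
    proof (rule integral_dominated_convergence)
      show "integrable (lebesgue_on \<Omega>) (\<lambda>x. B1 * d x)" using int1 by simp
      show "AE x in lebesgue_on \<Omega>. (\<lambda>i. \<phi> x *\<^sub>R grad (vi i) x) \<longlonglongrightarrow> \<phi> x *\<^sub>R g x"
        using lim(2) by eventually_elim (intro tendsto_intros)
      show "AE x in lebesgue_on \<Omega>. norm (\<phi> x *\<^sub>R grad (vi i) x) \<le> B1 * d x" for i
        using dom(2)
      proof eventually_elim
        case (elim x)
        then show ?case using B1 by (auto intro!: mult_mono)
      qed
    qed measurable
    have eq: "(LINT x|lebesgue_on \<Omega>. vi i x *\<^sub>R grad \<phi> x) = - (LINT x|lebesgue_on \<Omega>. \<phi> x *\<^sub>R grad (vi i) x)" for i
      using test_function_has_weak_gradient[OF \<Omega>(1) vi] \<phi> by (auto simp: has_weak_gradient_def)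
    show ?thesis by (rule LIMSEQ_unique[OF L1[unfolded eq] tendsto_minus[OF L2]])
  qed
  show wg: "has_weak_gradient \<Omega> v g"
    unfolding has_weak_gradient_def using li[OF vint] li[OF gint] ibp by blast
  have W: "v \<in> W1p p \<Omega>" using vL gL wg by (auto simp: W1p_def)
  have conv: "(\<lambda>i. LINT x|lebesgue_on \<Omega>. norm (w x - wi i x) powr p) \<longlonglongrightarrow> 0"
    if [measurable]: "w \<in> borel_measurable (lebesgue_on \<Omega>)" "\<And>i. wi i \<in> borel_measurable (lebesgue_on \<Omega>)"
      and l: "AE x in lebesgue_on \<Omega>. (\<lambda>i. wi i x) \<longlonglongrightarrow> w x"
      and k: "AE x in lebesgue_on \<Omega>. norm (w x) \<le> k x" "AE x in lebesgue_on \<Omega>. \<forall>i. norm (wi i x) \<le> k x"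
      and ki: "integrable (lebesgue_on \<Omega>) (\<lambda>x. \<bar>k x\<bar> powr p)"
    for w :: "'a \<Rightarrow> 'b::euclidean_space" and wi and k :: "'a \<Rightarrow> real"
  proof -
    have "(\<lambda>i. LINT x|lebesgue_on \<Omega>. norm (w x - wi i x) powr p) \<longlonglongrightarrow> (LINT x|lebesgue_on \<Omega>. 0)"
    proof (rule integral_dominated_convergence)
      show "integrable (lebesgue_on \<Omega>) (\<lambda>x. 2 powr p * (\<bar>k x\<bar> powr p + \<bar>k x\<bar> powr p))" using ki by simp
      show "AE x in lebesgue_on \<Omega>. (\<lambda>i. norm (w x - wi i x) powr p) \<longlonglongrightarrow> 0"
        using l
      proof eventually_elim
        case (elim x)
        have "(\<lambda>i. norm (w x - wi i x)) \<longlonglongrightarrow> norm (w x - w x)" by (intro tendsto_intros elim)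
        then show ?case using p by (intro tendsto_zero_powrI[of _ _ _ p]) auto
      qed
      show "AE x in lebesgue_on \<Omega>. norm (norm (w x - wi i x) powr p) \<le> 2 powr p * (\<bar>k x\<bar> powr p + \<bar>k x\<bar> powr p)" for i
        using k
      proof eventually_elim
        case (elim x)
        have "norm (w x - wi i x) \<le> \<bar>k x\<bar> + \<bar>k x\<bar>"
          using norm_triangle_ineq4[of "w x" "wi i x"] elim(1) elim(2)[rule_format, of i] by linarith
        then have "norm (w x - wi i x) powr p \<le> (\<bar>k x\<bar> + \<bar>k x\<bar>) powr p"
          using p by (intro powr_mono2) auto
        then show ?case using add_powr_le[of "\<bar>k x\<bar>" "\<bar>k x\<bar>" p] p by simp
      qed
    qed measurable
    then show ?thesis by simp
  qed
  have "(\<lambda>i. (LINT x|lebesgue_on \<Omega>. norm (v x - vi i x) powr p) + (LINT x|lebesgue_on \<Omega>. norm (g x - grad (vi i) x) powr p)) \<longlonglongrightarrow> 0 + 0"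
    using vb gb dom lim int by (intro tendsto_add conv[of v vi a] conv[of g "\<lambda>i. grad (vi i)" d]) auto
  then have "(\<lambda>i. ((LINT x|lebesgue_on \<Omega>. norm (v x - vi i x) powr p) + (LINT x|lebesgue_on \<Omega>. norm (g x - grad (vi i) x) powr p)) powr (1 / p)) \<longlonglongrightarrow> 0"
    using p by (intro tendsto_zero_powrI[of _ _ _ "1/p"]) (auto intro!: always_eventually add_nonneg_nonneg integral_nonneg_AE)
  moreover have "W1p_norm p \<Omega> (\<lambda>x. v x - vi i x) =
      ((LINT x|lebesgue_on \<Omega>. norm (v x - vi i x) powr p) + (LINT x|lebesgue_on \<Omega>. norm (g x - grad (vi i) x) powr p)) powr (1 / p)" for i
    using W1p_norm_eq[OF \<Omega>(1) has_weak_gradient_diff[OF \<Omega>(1) wg test_function_has_weak_gradient[OF \<Omega>(1) vi]] p0] by simp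
  ultimately have lim0: "(\<lambda>i. W1p_norm p \<Omega> (\<lambda>x. v x - vi i x)) \<longlonglongrightarrow> 0" by simp
  have "\<exists>\<phi>\<in>test_functions \<Omega>. W1p_norm p \<Omega> (\<lambda>x. v x - \<phi> x) < \<epsilon>" if "\<epsilon> > 0" for \<epsilon>
    using order_tendstoD(2)[OF lim0 that] vi by (auto simp: eventually_sequentially)
  with W show "v \<in> W1p_0 p \<Omega>" by (simp add: W1p_0_def)
qed

section \<open>A radial solution\<close>

text \<open>The variable \<rho> is the squared distance. Without the bump this is, up to a constant
  factor, minus the derivative of \<open>\<rho> powr (-\<beta>/2)\<close>. Cutting off the
  derivative instead of the function keeps the gradient an explicit product, so that its powers can
  be computed.\<close>

definition radial_density :: "real \<Rightarrow> real \<Rightarrow> real \<Rightarrow> real" where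
  "radial_density \<beta> R \<rho> = \<rho> powr (- \<beta> / 2 - 1) * bump_exp (R - \<rho>)"

text \<open>The density vanishes beyond R. The upper limit R + 1 does not change the value and makes
  every \<rho> up to R an interior point when the integral is differentiated.\<close>

definition radial_profile :: "real \<Rightarrow> real \<Rightarrow> real \<Rightarrow> real" where
  "radial_profile \<beta> R \<rho> = integral {\<rho>..R + 1} (radial_density \<beta> R)"

lemma radial_density_bounds:
  "0 \<le> radial_density \<beta> R \<rho>" "radial_density \<beta> R \<rho> \<le> \<rho> powr (- \<beta> / 2 - 1)"
  "\<rho> \<ge> R \<Longrightarrow> radial_density \<beta> R \<rho> = 0"
proof -
  show "0 \<le> radial_density \<beta> R \<rho>" by (simp add: radial_density_def)
  have "\<rho> powr (- \<beta> / 2 - 1) * bump_exp (R - \<rho>) \<le> \<rho> powr (- \<beta> / 2 - 1) * 1"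
    using bump_exp_le_1[of "R - \<rho>"] by (intro mult_left_mono) auto
  then show "radial_density \<beta> R \<rho> \<le> \<rho> powr (- \<beta> / 2 - 1)" by (simp add: radial_density_def)
  show "radial_density \<beta> R \<rho> = 0" if "\<rho> \<ge> R"
    using that bump_exp_eq_0_iff[of "R - \<rho>"] by (simp add: radial_density_def)
qed

lemma continuous_on_bump_exp: "continuous_on S bump_exp"
  by (rule DERIV_continuous_on[OF has_field_derivative_at_within[OF bump_exp_has_derivative]])

lemma continuous_on_radial_density: "S \<subseteq> {0<..} \<Longrightarrow> continuous_on S (radial_density \<beta> R)"
proof -
  assume S: "S \<subseteq> {0<..}"
  have "continuous_on S (\<lambda>\<rho>. bump_exp (R - \<rho>))"
    by (rule continuous_on_compose2[OF continuous_on_bump_exp[of UNIV]]) (auto intro!: continuous_intros)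
  moreover have "continuous_on S (\<lambda>\<rho>. \<rho> powr (- \<beta> / 2 - 1))"
    using S by (intro continuous_on_powr continuous_on_id continuous_on_const) auto
  ultimately show ?thesis unfolding radial_density_def[abs_def] by (intro continuous_on_mult)
qed

lemma radial_profile_eq_0: "\<rho> \<ge> R \<Longrightarrow> radial_profile \<beta> R \<rho> = 0"
  unfolding radial_profile_def
  by (subst Henstock_Kurzweil_Integration.integral_cong[of _ _ "\<lambda>_. 0"]) (auto simp: radial_density_bounds(3))

lemma radial_profile_has_derivative:
  assumes R: "R > 0" and \<rho>: "\<rho> > 0"
  shows "(radial_profile \<beta> R has_real_derivative - radial_density \<beta> R \<rho>) (at \<rho>)"
proof (cases "\<rho> > R")
  case True
  have "((\<lambda>_. 0) has_real_derivative 0) (at \<rho>)" by simp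
  moreover have "eventually (\<lambda>\<rho>. 0 = radial_profile \<beta> R \<rho>) (nhds \<rho>)"
    using eventually_nhds_in_open[of "{R<..}" \<rho>] True by (auto simp: radial_profile_eq_0 elim!: eventually_mono)
  ultimately have "(radial_profile \<beta> R has_real_derivative 0) (at \<rho>)"
    by (subst (asm) DERIV_cong_ev) auto
  then show ?thesis using True by (simp add: radial_density_bounds(3))
next
  case False
  define a where "a = \<rho> / 2"
  have a: "0 < a" "a < \<rho>" "\<rho> < R + 1" using \<rho> False by (auto simp: a_def)
  have c: "continuous_on {a..R + 1} (radial_density \<beta> R)"
    using a by (intro continuous_on_radial_density) auto
  have "((\<lambda>t. integral {a..t} (radial_density \<beta> R)) has_real_derivative radial_density \<beta> R \<rho>) (at \<rho> within {a..R + 1})"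
    using a by (intro integral_has_real_derivative[OF c]) auto
  then have d: "((\<lambda>t. integral {a..t} (radial_density \<beta> R)) has_real_derivative radial_density \<beta> R \<rho>) (at \<rho>)"
    using a by (simp add: at_within_Icc_at)
  have "((\<lambda>t. integral {a..R + 1} (radial_density \<beta> R) - integral {a..t} (radial_density \<beta> R)) has_real_derivative 0 - radial_density \<beta> R \<rho>) (at \<rho>)"
    by (intro DERIV_diff DERIV_const d)
  moreover have "eventually (\<lambda>t. integral {a..R + 1} (radial_density \<beta> R) - integral {a..t} (radial_density \<beta> R) = radial_profile \<beta> R t) (nhds \<rho>)"
    using eventually_nhds_in_open[of "{a<..<R+1}" \<rho>, OF open_greaterThanLessThan]
  proof (rule eventually_mono)
    show "\<rho> \<in> {a<..<R+1}" using a by simp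
    fix t assume t: "t \<in> {a<..<R+1}"
    have "integral {a..t} (radial_density \<beta> R) + integral {t..R + 1} (radial_density \<beta> R) = integral {a..R + 1} (radial_density \<beta> R)"
      using t by (intro Henstock_Kurzweil_Integration.integral_combine integrable_continuous_interval c) auto
    then show "integral {a..R + 1} (radial_density \<beta> R) - integral {a..t} (radial_density \<beta> R) = radial_profile \<beta> R t"
      by (simp add: radial_profile_def)
  qed
  ultimately show ?thesis by (subst (asm) DERIV_cong_ev) auto
qed

text \<open>Derivatives are compared with those of
  \<open>2 / \<beta> * \<rho> powr (-\<beta>/2)\<close>. The upper bound supplies the majorants. The
  lower bound, valid where the bump is at least its value at R/2, shows that the singularity at 0
  has full strength.\<close>

lemma radial_profile_bounds:
  assumes R: "R > 0" and \<beta>: "\<beta> > 0" and \<rho>: "\<rho> > 0"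
  shows "0 \<le> radial_profile \<beta> R \<rho>" "radial_profile \<beta> R \<rho> \<le> 2 / \<beta> * \<rho> powr (- \<beta> / 2)"
    and "\<rho> \<le> R / 2 \<Longrightarrow> bump_exp (R / 2) * (2 / \<beta>) * (\<rho> powr (- \<beta> / 2) - (R / 2) powr (- \<beta> / 2)) \<le> radial_profile \<beta> R \<rho>"
proof -
  have dp: "((\<lambda>t. 2 / \<beta> * t powr (- \<beta> / 2)) has_real_derivative - (t powr (- \<beta> / 2 - 1))) (at t)" if "t > 0" for t
    using that \<beta> by (auto intro!: derivative_eq_intros)
  note dB = radial_profile_has_derivative[OF R, of _ \<beta>]
  have pos: "0 \<le> radial_profile \<beta> R t" if t: "t > 0" for t
  proof (cases "t \<le> R")
    case True
    have "radial_profile \<beta> R R \<le> radial_profile \<beta> R t"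
      using True
    proof (rule DERIV_nonpos_imp_nonincreasing)
      show "\<exists>y. (radial_profile \<beta> R has_real_derivative y) (at x) \<and> y \<le> 0" if "t \<le> x" "x \<le> R" for x
        using dB[of x] that t radial_density_bounds(1)[of \<beta> R x] by (intro exI[of _ "- radial_density \<beta> R x"]) auto
    qed
    then show ?thesis by (simp add: radial_profile_eq_0)
  qed (simp add: radial_profile_eq_0)
  show "0 \<le> radial_profile \<beta> R \<rho>" using pos[OF \<rho>] .
  show "radial_profile \<beta> R \<rho> \<le> 2 / \<beta> * \<rho> powr (- \<beta> / 2)"
  proof (cases "\<rho> \<le> R")
    case True
    have "2 / \<beta> * R powr (- \<beta> / 2) - radial_profile \<beta> R R \<le> 2 / \<beta> * \<rho> powr (- \<beta> / 2) - radial_profile \<beta> R \<rho>"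
      using True
    proof (rule DERIV_nonpos_imp_nonincreasing)
      show "\<exists>y. ((\<lambda>t. 2 / \<beta> * t powr (- \<beta> / 2) - radial_profile \<beta> R t) has_real_derivative y) (at x) \<and> y \<le> 0"
        if "\<rho> \<le> x" "x \<le> R" for x
        using DERIV_diff[OF dp[of x] dB[of x]] that \<rho> radial_density_bounds(2)[of \<beta> R x]
        by (intro exI[of _ "- (x powr (- \<beta> / 2 - 1)) - - radial_density \<beta> R x"]) auto
    qed
    moreover have "0 \<le> 2 / \<beta> * R powr (- \<beta> / 2)" using \<beta> by simp
    ultimately show ?thesis by (simp add: radial_profile_eq_0)
  qed (use \<beta> in \<open>simp add: radial_profile_eq_0\<close>)
  show "bump_exp (R / 2) * (2 / \<beta>) * (\<rho> powr (- \<beta> / 2) - (R / 2) powr (- \<beta> / 2)) \<le> radial_profile \<beta> R \<rho>" if le: "\<rho> \<le> R / 2"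
  proof -
    define E where "E = bump_exp (R / 2)"
    have "radial_profile \<beta> R (R / 2) - E * (2 / \<beta> * (R / 2) powr (- \<beta> / 2)) \<le> radial_profile \<beta> R \<rho> - E * (2 / \<beta> * \<rho> powr (- \<beta> / 2))"
      using le
    proof (rule DERIV_nonpos_imp_nonincreasing)
      fix x assume x: "\<rho> \<le> x" "x \<le> R / 2"
      have "E * x powr (- \<beta> / 2 - 1) \<le> radial_density \<beta> R x"
        unfolding radial_density_def E_def using x by (subst mult.commute) (intro mult_left_mono bump_exp_mono; simp)
      then show "\<exists>y. ((\<lambda>t. radial_profile \<beta> R t - E * (2 / \<beta> * t powr (- \<beta> / 2))) has_real_derivative y) (at x) \<and> y \<le> 0"
        using DERIV_diff[OF dB[of x] DERIV_cmult[OF dp[of x], of E]] x \<rho>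
        by (intro exI[of _ "- radial_density \<beta> R x - E * - (x powr (- \<beta> / 2 - 1))"]) auto
    qed
    moreover have "0 \<le> radial_profile \<beta> R (R / 2)" using R by (intro pos) simp
    ultimately show ?thesis by (simp add: E_def algebra_simps)
  qed
qed

lemma Ck_radial_density: "(\<And>x. f x > 0) \<Longrightarrow> Ck k f \<Longrightarrow> Ck k (\<lambda>x. radial_density \<beta> R (f x))"
  unfolding radial_density_def by (intro Ck_mult Ck_powr Ck_bump_exp Ck_diff Ck_const)

lemma radial_profile_compose_has_derivative:
  assumes "R > 0" "f x > 0" "(f has_derivative D) (at x)"
  shows "((\<lambda>x. radial_profile \<beta> R (f x)) has_derivative (\<lambda>h. - radial_density \<beta> R (f x) * D h)) (at x)"
  using has_derivative_compose[OF assms(3) radial_profile_has_derivative[OF assms(1,2), unfolded has_field_derivative_def]] .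

lemma Ck_radial_profile:
  assumes R: "R > 0" and f: "\<And>x. f x > 0" "\<And>k. Ck k f"
  shows "Ck k (\<lambda>x. radial_profile \<beta> R (f x))"
proof -
  note D = Ck_SucD[OF f(2)]
  have "Ck (Suc k) (\<lambda>x. radial_profile \<beta> R (f x))"
    by (rule Ck_SucI[OF radial_profile_compose_has_derivative[OF R f(1) D(1)]])
      (intro Ck_mult Ck_minus Ck_radial_density f D(2))
  then show ?thesis by (rule Ck_Suc_imp_Ck)
qed

text \<open>
  For \<open>u x = radial_profile \<beta> R |x|\<^sup>2\<close> one has \<open>|\<nabla>u|\<^bsup>p-2\<^esup> \<nabla>u = - radial_flux p \<beta> R |x|\<^sup>2 x\<close>. Since
  \<open>bump_exp t powr (p - 1) = bump_exp (t / (p - 1))\<close>, the flux is smooth away from the origin even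
  if \<open>p < 2\<close>, also at the edge of the support.
\<close>

definition flux_exponent :: "real \<Rightarrow> real \<Rightarrow> real" where
  "flux_exponent p \<beta> = (\<beta> * (p - 1) + p) / 2"

definition radial_flux :: "real \<Rightarrow> real \<Rightarrow> real \<Rightarrow> real \<Rightarrow> real" where
  "radial_flux p \<beta> R \<rho> = 2 powr (p - 1) * (\<rho> powr (- flux_exponent p \<beta>) * bump_exp ((R - \<rho>) / (p - 1)))"

definition radial_flux' :: "real \<Rightarrow> real \<Rightarrow> real \<Rightarrow> real \<Rightarrow> real" where
  "radial_flux' p \<beta> R \<rho> = 2 powr (p - 1) *
     (- flux_exponent p \<beta> * \<rho> powr (- flux_exponent p \<beta> - 1) * bump_exp ((R - \<rho>) / (p - 1))
      - \<rho> powr (- flux_exponent p \<beta>) * (bump_exp' ((R - \<rho>) / (p - 1)) / (p - 1)))"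

lemma radial_flux_has_derivative:
  assumes "\<rho> > 0" "p > 1"
  shows "(radial_flux p \<beta> R has_real_derivative radial_flux' p \<beta> R \<rho>) (at \<rho>)"
proof -
  have b: "((\<lambda>\<rho>. bump_exp ((R - \<rho>) / (p - 1))) has_real_derivative bump_exp' ((R - \<rho>) / (p - 1)) * (- 1 / (p - 1))) (at \<rho>)"
    using DERIV_cdivide[OF DERIV_diff[OF DERIV_const[of R] DERIV_ident], of "p - 1" \<rho>]
    by (intro DERIV_chain2[OF bump_exp_has_derivative]) simp
  have "((\<lambda>\<rho>. \<rho> powr (- flux_exponent p \<beta>)) has_real_derivative - flux_exponent p \<beta> * \<rho> powr (- flux_exponent p \<beta> - 1)) (at \<rho>)"
    using assms by (auto intro!: derivative_eq_intros)
  from DERIV_cmult[OF DERIV_mult[OF this b], of "2 powr (p - 1)"] show ?thesis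
    unfolding radial_flux_def[abs_def] radial_flux'_def by (rule DERIV_cong) (simp add: algebra_simps)
qed

lemma isCont_radial_flux':
  assumes "\<rho> > 0" "p > 1"
  shows "isCont (radial_flux' p \<beta> R) \<rho>"
proof -
  have "isCont (\<lambda>\<rho>. (R - \<rho>) / (p - 1)) \<rho>" using assms by (intro continuous_intros) auto
  from isCont_o2[OF this isCont_bump_exp'] isCont_o2[OF this DERIV_isCont[OF bump_exp_has_derivative]]
  show ?thesis unfolding radial_flux'_def[abs_def] using assms by (intro continuous_intros) auto
qed

lemma Ck_radial_flux: "(\<And>x. f x > 0) \<Longrightarrow> Ck k f \<Longrightarrow> Ck k (\<lambda>x. radial_flux p \<beta> R (f x))"
  unfolding radial_flux_def divide_inverse by (intro Ck_mult Ck_powr Ck_bump_exp Ck_diff Ck_const)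

lemma radial_flux_eq_0:
  assumes "\<rho> \<ge> R" "p > 1"
  shows "radial_flux p \<beta> R \<rho> = 0" "radial_flux' p \<beta> R \<rho> = 0"
proof -
  have "(R - \<rho>) / (p - 1) \<le> 0" using assms by (intro divide_nonpos_pos) auto
  then have "bump_exp ((R - \<rho>) / (p - 1)) = 0" by (simp add: bump_exp_eq_0_iff)
  then show "radial_flux p \<beta> R \<rho> = 0" "radial_flux' p \<beta> R \<rho> = 0"
    by (simp_all add: radial_flux_def radial_flux'_def bump_exp'_def)
qed

text \<open>The derivative is bounded together with a factor \<rho>, which restores the exponent
  lost by differentiation; in the divergence it appears with just such a factor. The summand 2 R /
  (p - 1) comes from the bound 2 on \<open>bump_exp'\<close>.\<close>

lemma radial_flux_bounds:
  assumes "p > 1" "\<beta> > 0" "\<rho> > 0" "\<rho> \<le> R"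
  shows "0 \<le> radial_flux p \<beta> R \<rho>" "radial_flux p \<beta> R \<rho> \<le> 2 powr (p - 1) * \<rho> powr (- flux_exponent p \<beta>)"
    and "\<bar>radial_flux' p \<beta> R \<rho>\<bar> * \<rho> \<le> 2 powr (p - 1) * (flux_exponent p \<beta> + 2 * R / (p - 1)) * \<rho> powr (- flux_exponent p \<beta>)"
proof -
  define m where "m = flux_exponent p \<beta>"
  define E E' where "E = bump_exp ((R - \<rho>) / (p - 1))" and "E' = bump_exp' ((R - \<rho>) / (p - 1))"
  have m: "m > 0" using assms by (simp add: m_def flux_exponent_def add_pos_pos)
  have E: "0 \<le> E" "E \<le> 1" "0 \<le> E'" "E' \<le> 2" unfolding E_def E'_def using bump_exp_le_1 bump_exp'_bounds by auto
  show "0 \<le> radial_flux p \<beta> R \<rho>" "radial_flux p \<beta> R \<rho> \<le> 2 powr (p - 1) * \<rho> powr (- flux_exponent p \<beta>)"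
    using E mult_left_mono[of E 1 "\<rho> powr (- flux_exponent p \<beta>)"] by (simp_all add: radial_flux_def E_def)
  have pw: "\<rho> powr (- m - 1) * \<rho> = \<rho> powr (- m)" using assms powr_add[of \<rho> "- m - 1" 1] by simp
  have "\<bar>- m * \<rho> powr (- m - 1) * E - \<rho> powr (- m) * (E' / (p - 1))\<bar> \<le> m * \<rho> powr (- m - 1) * E + \<rho> powr (- m) * (E' / (p - 1))"
    using E m assms by (intro order.trans[OF abs_triangle_ineq4]) (simp add: abs_mult)
  also have "\<dots> \<le> m * \<rho> powr (- m - 1) * 1 + \<rho> powr (- m) * (2 / (p - 1))"
    using E m assms by (intro add_mono mult_left_mono divide_right_mono) auto
  finally have "\<bar>- m * \<rho> powr (- m - 1) * E - \<rho> powr (- m) * (E' / (p - 1))\<bar> * \<rho>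
      \<le> (m * \<rho> powr (- m - 1) * 1 + \<rho> powr (- m) * (2 / (p - 1))) * \<rho>"
    using assms by (intro mult_right_mono) auto
  also have "\<dots> = m * \<rho> powr (- m) + \<rho> powr (- m) * (2 / (p - 1) * \<rho>)"
    unfolding pw[symmetric] by (simp add: algebra_simps)
  also have "\<dots> \<le> m * \<rho> powr (- m) + \<rho> powr (- m) * (2 / (p - 1) * R)"
    using assms by (intro add_left_mono mult_left_mono) auto
  also have "\<dots> = (m + 2 * R / (p - 1)) * \<rho> powr (- m)" by (simp add: algebra_simps)
  finally have *: "\<bar>- m * \<rho> powr (- m - 1) * E - \<rho> powr (- m) * (E' / (p - 1))\<bar> * \<rho> \<le> (m + 2 * R / (p - 1)) * \<rho> powr (- m)" .
  have "\<bar>radial_flux' p \<beta> R \<rho>\<bar> * \<rho> = 2 powr (p - 1) * (\<bar>- m * \<rho> powr (- m - 1) * E - \<rho> powr (- m) * (E' / (p - 1))\<bar> * \<rho>)"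
    by (simp add: radial_flux'_def abs_mult m_def E_def E'_def)
  also have "\<dots> \<le> 2 powr (p - 1) * ((m + 2 * R / (p - 1)) * \<rho> powr (- m))"
    by (intro mult_left_mono *) simp
  finally show "\<bar>radial_flux' p \<beta> R \<rho>\<bar> * \<rho> \<le> 2 powr (p - 1) * (flux_exponent p \<beta> + 2 * R / (p - 1)) * \<rho> powr (- flux_exponent p \<beta>)"
    by (simp add: m_def mult.assoc)
qed

lemma radial_flux_eq:
  fixes y :: "'a::euclidean_space" and R \<beta> :: real
  assumes p: "p > 1" and y: "y \<noteq> 0"
  defines "U \<equiv> (- 2 * radial_density \<beta> R (y \<bullet> y)) *\<^sub>R y"
  shows "(norm U powr (p - 2)) *\<^sub>R U = - radial_flux p \<beta> R (y \<bullet> y) *\<^sub>R y"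
proof (cases "y \<bullet> y \<ge> R")
  case True
  then show ?thesis using radial_density_bounds(3) radial_flux_eq_0(1)[OF True p] by (simp add: U_def)
next
  case False
  define \<rho> b where "\<rho> = y \<bullet> y" and "b = radial_density \<beta> R \<rho>"
  have \<rho>: "\<rho> > 0" "\<rho> < R" using y False by (auto simp: \<rho>_def)
  have b: "b > 0" using \<rho> by (simp add: b_def radial_density_def bump_exp_pos_iff)
  have ny: "norm y powr a = \<rho> powr (a / 2)" for a
  proof -
    have "\<rho> = norm y powr 2" using y by (simp add: \<rho>_def dot_square_norm)
    then show ?thesis by (simp only: powr_powr) simp
  qed
  have "norm U = 2 * b * norm y" using b by (simp add: U_def b_def \<rho>_def)
  then have "norm U powr (p - 2) * (2 * b) = (2 * b) powr (p - 2) * (2 * b) powr 1 * \<rho> powr ((p - 2) / 2)"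
    using b by (simp add: powr_mult ny[symmetric])
  also have "(2 * b) powr (p - 2) * (2 * b) powr 1 = (2 * b) powr (p - 1)"
    by (simp only: powr_add[symmetric]) simp
  also have "(2 * b) powr (p - 1) = 2 powr (p - 1) * (\<rho> powr ((- \<beta> / 2 - 1) * (p - 1)) * bump_exp ((R - \<rho>) / (p - 1)))"
    using b p by (simp add: powr_mult b_def radial_density_def powr_powr bump_exp_powr)
  also have "2 powr (p - 1) * (\<rho> powr ((- \<beta> / 2 - 1) * (p - 1)) * bump_exp ((R - \<rho>) / (p - 1))) * \<rho> powr ((p - 2) / 2)
     = 2 powr (p - 1) * ((\<rho> powr ((- \<beta> / 2 - 1) * (p - 1)) * \<rho> powr ((p - 2) / 2)) * bump_exp ((R - \<rho>) / (p - 1)))"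
    by (simp only: mult_ac)
  also have "\<rho> powr ((- \<beta> / 2 - 1) * (p - 1)) * \<rho> powr ((p - 2) / 2) = \<rho> powr (- flux_exponent p \<beta>)"
  proof -
    \<comment> \<open>The first summand is the power p - 1 of the density, the second is the norm of
      y to the power p - 2, the norm being the square root of \<rho>.\<close>
    have "(- \<beta> / 2 - 1) * (p - 1) + (p - 2) / 2 = - flux_exponent p \<beta>"
      by (simp add: flux_exponent_def field_simps)
    then show ?thesis by (simp only: powr_add[symmetric])
  qed
  finally have "norm U powr (p - 2) * (2 * b) = radial_flux p \<beta> R \<rho>" by (simp add: radial_flux_def)
  moreover have "(norm U powr (p - 2)) *\<^sub>R U = - (norm U powr (p - 2) * (2 * b)) *\<^sub>R y"
    by (simp add: U_def b_def \<rho>_def)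
  ultimately show ?thesis by (simp add: \<rho>_def)
qed

text \<open>With \<beta> = n/r, \<open>rp\<close> says that the p-th power of the distance to the
  exponent -(\<beta> + 1), the size of the gradient, is integrable, and \<open>rq\<close> says the
  same for f with exponent -(\<beta> (p - 1) + p) and power q. The r-th power of u has exponent -n
  and is not integrable.\<close>

lemma radial_example:
  fixes \<Omega> :: "'a::euclidean_space set" and p q r :: real
  defines "n \<equiv> real DIM('a)"
  assumes \<Omega>: "open \<Omega>" "bounded \<Omega>" and c: "c \<in> \<Omega>" and p: "p > 1" and q: "q > 1" and r: "r > 0"
    and rp: "p * (n / r + 1) < n" and rq: "q * (n / r * (p - 1) + p) < n"
  shows "\<exists>f u. f \<in> Lp q \<Omega> \<and> weak_solution p \<Omega> f u \<and> u \<notin> Lp r \<Omega>"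
proof -
  define \<beta> where "\<beta> = n / r"
  have n: "n > 0" by (simp add: n_def)
  have \<beta>: "\<beta> > 0" using n r by (simp add: \<beta>_def)
  obtain d where d: "d > 0" "cball c d \<subseteq> \<Omega>" using \<Omega>(1) c open_contains_cball by blast
  define R where "R = d\<^sup>2"
  have R: "R > 0" using d by (simp add: R_def)
  define sq where "sq x = (x - c) \<bullet> (x - c)" for x
  have sq_norm: "sq x = (norm (x - c))\<^sup>2" for x by (simp add: sq_def dot_square_norm)
  have sq0: "sq x \<ge> 0" for x by (simp add: sq_def)
  have sq_pos: "sq x > 0 \<longleftrightarrow> x \<noteq> c" for x by (simp add: sq_def)
  have sq_powr: "sq x powr a = norm (x - c) powr (2 * a)" for x a
  proof (cases "x = c")
    case False
    then have "sq x = norm (x - c) powr 2" by (simp add: sq_norm)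
    then show ?thesis by (simp only: powr_powr)
  qed (simp add: sq_def)
  have sq_out: "sq x \<ge> R" if "x \<notin> cball c d" for x
  proof -
    have "d \<le> norm (x - c)" using that by (simp add: dist_norm norm_minus_commute)
    then show ?thesis using d by (simp add: sq_norm R_def power_mono)
  qed
  have Ck_sq: "Ck k (\<lambda>x. e + sq x)" for k e
  proof -
    have "Ck k (\<lambda>x. e + (\<Sum>b\<in>Basis. (x \<bullet> b - c \<bullet> b) * (x \<bullet> b - c \<bullet> b)))"
      by (intro Ck_add Ck_sum Ck_mult Ck_diff Ck_inner Ck_const)
    moreover have "sq x = (\<Sum>b\<in>Basis. (x \<bullet> b - c \<bullet> b) * (x \<bullet> b - c \<bullet> b))" for x
      unfolding sq_def by (subst euclidean_inner) (simp add: inner_diff_left)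
    ultimately show ?thesis by simp
  qed
  have dsq: "((\<lambda>x. e + sq x) has_derivative (\<lambda>h. 2 * ((x - c) \<bullet> h))) (at x)" for x e
    unfolding sq_def by (auto intro!: derivative_eq_intros simp: inner_commute)
  \<comment> \<open>Adding e i to the squared distance removes the singularity, so the shifted
    profiles are test functions; they converge to u away from c.\<close>
  define e where "e i = inverse (real (Suc i))" for i
  have e: "e i > 0" for i by (simp add: e_def)
  have e0: "e \<longlonglongrightarrow> 0" unfolding e_def by (rule LIMSEQ_inverse_real_of_nat)
  have \<rho>: "e i + sq x > 0" "sq x \<le> e i + sq x" for i x using e[of i] sq0[of x] by auto
  have lim\<rho>: "(\<lambda>i. e i + sq x) \<longlonglongrightarrow> sq x" for x
    using tendsto_add[OF e0 tendsto_const[of "sq x"]] by simp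
  define B b where "B = radial_profile \<beta> R" and "b = radial_density \<beta> R"
  define u where "u x = B (sq x)" for x
  define U where "U x = (- 2 * b (sq x)) *\<^sub>R (x - c)" for x
  define ui where "ui i x = B (e i + sq x)" for i x
  define Ui where "Ui i x = (- 2 * b (e i + sq x)) *\<^sub>R (x - c)" for i x
  have \<Omega>s: "\<Omega> \<in> sets lebesgue" using \<Omega> by auto
  have borel_meas: "h \<in> borel_measurable (lebesgue_on \<Omega>)" if "h \<in> borel_measurable borel" for h :: "'a \<Rightarrow> 'b::euclidean_space"
    by (intro measurable_restrict_space1 measurable_completion) (use that in simp)
  have sqm [measurable]: "sq \<in> borel_measurable borel" unfolding sq_def[abs_def] by measurable
  have AEc: "AE x in lebesgue_on \<Omega>. x \<noteq> c"
  proof -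
    have "AE x in lebesgue. x \<noteq> c" by (rule AE_completion[OF AE_lborel_singleton])
    then have "AE x in lebesgue. x \<in> \<Omega> \<longrightarrow> x \<noteq> c" by eventually_elim simp
    then show ?thesis using \<Omega>s by (simp add: AE_restrict_space_iff)
  qed
  \<comment> \<open>All majorants below are multiples of these functions, and a power of one is
    another with exponent multiplied, so each integrability question becomes a comparison of an
    exponent with n.\<close>
  define w where "w \<gamma> x = indicator (cball c d) x * norm (x - c) powr (- \<gamma>)" for \<gamma> x
  have w0: "w \<gamma> x \<ge> 0" for \<gamma> x by (simp add: w_def)
  have wb [measurable]: "w \<gamma> \<in> borel_measurable borel" for \<gamma>
    unfolding w_def by (intro borel_measurable_times borel_measurable_indicator) auto
  have wm [measurable]: "w \<gamma> \<in> borel_measurable (lebesgue_on \<Omega>)" for \<gamma>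
    by (rule borel_meas[OF wb])
  have w_powr: "\<bar>C * w \<gamma> x\<bar> powr k = \<bar>C\<bar> powr k * w (\<gamma> * k) x" if "k > 0" for C \<gamma> k x
    using that by (auto simp: w_def indicator_def abs_mult powr_mult powr_powr)
  have w_int: "integrable (lebesgue_on \<Omega>) (w \<gamma>)" if "0 < \<gamma>" "\<gamma> < n" for \<gamma>
  proof -
    have "integrable lborel (w \<gamma>)"
      unfolding w_def using integrable_norm_powr[of \<gamma> d c] that d by (simp add: n_def)
    moreover have "w \<gamma> x = 0" if "x \<notin> \<Omega>" for x
    proof -
      have "x \<notin> cball c d" using that d by blast
      then show ?thesis by (simp add: w_def)
    qed
    ultimately show ?thesis using lebesgue_on_eq_lborel(2)[OF \<Omega>s wb] by blast
  qed
  have w_int_powr: "integrable (lebesgue_on \<Omega>) (\<lambda>x. \<bar>C * w \<gamma> x\<bar> powr k)" if "0 < \<gamma>" "0 < k" "\<gamma> * k < n" for C \<gamma> k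
    unfolding w_powr[OF that(2)] using that by (intro integrable_mult_right w_int) auto
  have ui_der: "(ui i has_derivative (\<lambda>h. Ui i x \<bullet> h)) (at x)" for i x
    unfolding ui_def[abs_def] B_def
    by (rule has_derivative_eq_rhs[OF radial_profile_compose_has_derivative[OF R \<rho>(1) dsq]])
      (simp add: Ui_def b_def fun_eq_iff)
  have ui_grad: "grad (ui i) x = Ui i x" for i x by (rule grad_eqI[OF ui_der])
  have ui_test: "ui i \<in> test_functions \<Omega>" for i
  proof (rule test_functionsI[OF _ compact_cball d(2)])
    show "Ck k (ui i)" for k
      unfolding ui_def[abs_def] B_def by (rule Ck_radial_profile[OF R \<rho>(1) Ck_sq])
    show "ui i x = 0" if "x \<notin> cball c d" for x
      using sq_out[OF that] e[of i] by (simp add: ui_def B_def radial_profile_eq_0)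
  qed
  have ui_bound: "\<bar>ui i x\<bar> \<le> 2 / \<beta> * w \<beta> x" if x: "x \<noteq> c" for i x
  proof (cases "x \<in> cball c d")
    case True
    have "\<bar>ui i x\<bar> \<le> 2 / \<beta> * (e i + sq x) powr (- \<beta> / 2)"
      using radial_profile_bounds(1,2)[OF R \<beta> \<rho>(1)] by (simp add: ui_def B_def)
    also have "\<dots> \<le> 2 / \<beta> * sq x powr (- \<beta> / 2)"
      using \<beta> x sq_pos \<rho>(2) by (intro mult_left_mono powr_mono2') auto
    finally show ?thesis using True by (simp add: w_def sq_powr)
  next
    case False
    then show ?thesis using sq_out[OF False] e[of i] by (simp add: ui_def B_def radial_profile_eq_0 w_def)
  qed
  have Ui_bound: "norm (Ui i x) \<le> 2 * w (\<beta> + 1) x" if x: "x \<noteq> c" for i x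
  proof (cases "x \<in> cball c d")
    case True
    have "norm (Ui i x) = 2 * b (e i + sq x) * norm (x - c)"
      using radial_density_bounds(1) by (simp add: Ui_def b_def)
    also have "\<dots> \<le> 2 * (e i + sq x) powr (- \<beta> / 2 - 1) * norm (x - c)"
      using radial_density_bounds(2) by (intro mult_right_mono mult_left_mono) (auto simp: b_def)
    also have "\<dots> \<le> 2 * sq x powr (- \<beta> / 2 - 1) * norm (x - c)"
      using \<beta> x sq_pos \<rho>(2) by (intro mult_right_mono mult_left_mono powr_mono2') auto
    also have "\<dots> = 2 * (norm (x - c) powr (2 * (- \<beta> / 2 - 1)) * norm (x - c) powr 1)"
      by (simp add: sq_powr)
    also have "norm (x - c) powr (2 * (- \<beta> / 2 - 1)) * norm (x - c) powr 1 = norm (x - c) powr (- (\<beta> + 1))"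
      by (simp only: powr_add[symmetric]) (simp add: algebra_simps)
    finally show ?thesis using True by (simp add: w_def)
  next
    case False
    then show ?thesis using sq_out[OF False] e[of i] by (simp add: Ui_def b_def radial_density_bounds(3) w_def)
  qed
  have contB: "isCont B t" and contb: "isCont b t" if "t > 0" for t
  proof -
    show "isCont B t" unfolding B_def using radial_profile_has_derivative[OF R that] by (rule DERIV_isCont)
    show "isCont b t" unfolding b_def
      using continuous_on_radial_density[of "{0<..}" \<beta> R] that by (simp add: continuous_on_eq_continuous_at)
  qed
  have cont_comp: "continuous_on (- {c}) (\<lambda>x. h (sq x))" if "\<And>t. t > 0 \<Longrightarrow> isCont h t" for h :: "real \<Rightarrow> real"
  proof (rule continuous_at_imp_continuous_on, rule ballI)
    fix x assume "x \<in> - {c}"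
    then have "isCont h (sq x)" using that sq_pos by simp
    moreover have "isCont sq x" unfolding sq_def[abs_def] by (intro continuous_intros)
    ultimately show "isCont (\<lambda>x. h (sq x)) x" by (rule isCont_o2[rotated])
  qed
  have um: "u \<in> borel_measurable borel"
    unfolding u_def[abs_def] using cont_comp[OF contB] by (auto intro: borel_measurable_continuous_countable_exceptions[of "{c}"])
  have Um: "U \<in> borel_measurable borel"
  proof -
    have "(\<lambda>x. b (sq x)) \<in> borel_measurable borel"
      using cont_comp[OF contb] by (auto intro: borel_measurable_continuous_countable_exceptions[of "{c}"])
    then show ?thesis unfolding U_def[abs_def] by measurable
  qed
  have \<beta>n: "\<beta> * p < n" "(\<beta> + 1) * p < n" using rp p \<beta> by (auto simp: \<beta>_def[symmetric] algebra_simps)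
  have lim: "AE x in lebesgue_on \<Omega>. (\<lambda>i. ui i x) \<longlonglongrightarrow> u x" "AE x in lebesgue_on \<Omega>. (\<lambda>i. grad (ui i) x) \<longlonglongrightarrow> U x"
  proof -
    show "AE x in lebesgue_on \<Omega>. (\<lambda>i. ui i x) \<longlonglongrightarrow> u x"
      using AEc by eventually_elim (auto simp: ui_def u_def sq_pos intro!: isCont_tendsto_compose[OF contB] lim\<rho>)
    show "AE x in lebesgue_on \<Omega>. (\<lambda>i. grad (ui i) x) \<longlonglongrightarrow> U x"
      using AEc unfolding ui_grad
      by eventually_elim (auto simp: Ui_def U_def sq_pos intro!: tendsto_intros isCont_tendsto_compose[OF contb] lim\<rho>)
  qed
  have dom: "AE x in lebesgue_on \<Omega>. \<forall>i. \<bar>ui i x\<bar> \<le> 2 / \<beta> * w \<beta> x" "AE x in lebesgue_on \<Omega>. \<forall>i. norm (grad (ui i) x) \<le> 2 * w (\<beta> + 1) x"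
  proof -
    show "AE x in lebesgue_on \<Omega>. \<forall>i. \<bar>ui i x\<bar> \<le> 2 / \<beta> * w \<beta> x"
      using AEc by eventually_elim (use ui_bound in blast)
    show "AE x in lebesgue_on \<Omega>. \<forall>i. norm (grad (ui i) x) \<le> 2 * w (\<beta> + 1) x"
      using AEc unfolding ui_grad by eventually_elim (use Ui_bound in blast)
  qed
  have wint: "integrable (lebesgue_on \<Omega>) (\<lambda>x. \<bar>2 / \<beta> * w \<beta> x\<bar> powr p)"
      "integrable (lebesgue_on \<Omega>) (\<lambda>x. \<bar>2 * w (\<beta> + 1) x\<bar> powr p)"
    using \<beta>n \<beta> p by (intro w_int_powr; simp)+
  have wmm: "(\<lambda>x. 2 / \<beta> * w \<beta> x) \<in> borel_measurable (lebesgue_on \<Omega>)" "(\<lambda>x. 2 * w (\<beta> + 1) x) \<in> borel_measurable (lebesgue_on \<Omega>)"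
    by measurable
  note W = W1p_0I_dominated[OF \<Omega> p ui_test borel_meas[OF um] borel_meas[OF Um] wmm lim dom wint]
  note uW = W(1) and uU = W(2)
  define m where "m = flux_exponent p \<beta>"
  have m: "0 < 2 * m" "2 * m * q < n" "2 * m < n"
  proof -
    have 2: "2 * m = \<beta> * (p - 1) + p" by (simp add: m_def flux_exponent_def)
    show m0: "0 < 2 * m" unfolding 2 using \<beta> p by (simp add: add_pos_pos)
    show mq: "2 * m * q < n" unfolding 2 using rq by (simp add: \<beta>_def mult.commute)
    \<comment> \<open>Besides f in the space with exponent q, the limit in the weak equation needs
      plain integrability of f and of the flux; q > 1 provides it.\<close>
    have "2 * m * 1 < 2 * m * q" using m0 q by (intro mult_strict_left_mono) auto
    with mq show "2 * m < n" by simp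
  qed
  define A A' where "A = radial_flux p \<beta> R" and "A' = radial_flux' p \<beta> R"
  \<comment> \<open>M1 adds the bounds of the two terms of F, the second from the bound on the
    derivative of the flux times its argument.\<close>
  define M0 M1 where "M0 = 2 powr (p - 1)" and "M1 = n * M0 + 2 * (M0 * (m + 2 * R / (p - 1)))"
  \<comment> \<open>\<open>F s\<close> is the divergence of \<open>A (s + |x - c|\<^sup>2) (x - c)\<close>\<close>
  define F where "F s x = n * A (s + sq x) + 2 * sq x * A' (s + sq x)" for s x
  define f where "f = F 0"
  have A_bound: "\<bar>A (s + sq x)\<bar> \<le> M0 * w (2 * m) x" and F_bound: "\<bar>F s x\<bar> \<le> M1 * w (2 * m) x"
    if x: "x \<noteq> c" and s: "s \<ge> 0" for s x
  proof -
    define t where "t = s + sq x"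
    have t: "t > 0" "sq x \<le> t" "sq x > 0" using s x sq_pos[of x] by (auto simp: t_def)
    have "\<bar>A t\<bar> \<le> M0 * w (2 * m) x \<and> \<bar>A' t\<bar> * t \<le> M0 * (m + 2 * R / (p - 1)) * w (2 * m) x"
    proof (cases "t < R")
      case True
      have "x \<in> cball c d" using sq_out[of x] t True by fastforce
      then have wx: "w (2 * m) x = sq x powr (- m)" by (simp add: w_def sq_powr)
      have tm: "t powr (- m) \<le> sq x powr (- m)" using t m by (intro powr_mono2') auto
      note bd = radial_flux_bounds[OF p \<beta> t(1) less_imp_le[OF True], folded A_def A'_def m_def M0_def]
      have "M0 * t powr (- m) \<le> M0 * sq x powr (- m)"
        using tm by (intro mult_left_mono) (auto simp: M0_def)
      then have "\<bar>A t\<bar> \<le> M0 * sq x powr (- m)"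
        using bd(1,2) by linarith
      moreover have "M0 * (m + 2 * R / (p - 1)) * t powr (- m) \<le> M0 * (m + 2 * R / (p - 1)) * sq x powr (- m)"
        using tm m R p by (intro mult_left_mono) (auto simp: M0_def)
      ultimately show ?thesis using bd(3) unfolding wx by linarith
    next
      case False
      then show ?thesis using radial_flux_eq_0[of R t p \<beta>] p m R w0[of "2 * m" x]
        by (simp add: A_def A'_def M0_def)
    qed
    then have 1: "\<bar>A t\<bar> \<le> M0 * w (2 * m) x" and 2: "\<bar>A' t\<bar> * t \<le> M0 * (m + 2 * R / (p - 1)) * w (2 * m) x" by auto
    show "\<bar>A (s + sq x)\<bar> \<le> M0 * w (2 * m) x" using 1 by (simp add: t_def)
    have "\<bar>A' t\<bar> * sq x \<le> \<bar>A' t\<bar> * t" using t by (intro mult_left_mono) auto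
    then have "\<bar>2 * sq x * A' t\<bar> \<le> 2 * (M0 * (m + 2 * R / (p - 1)) * w (2 * m) x)"
      using 2 t by (simp add: abs_mult mult_ac)
    moreover have "\<bar>n * A t\<bar> \<le> n * (M0 * w (2 * m) x)"
      using 1 n by (simp add: abs_mult)
    ultimately have "\<bar>F s x\<bar> \<le> n * (M0 * w (2 * m) x) + 2 * (M0 * (m + 2 * R / (p - 1)) * w (2 * m) x)"
      unfolding F_def t_def[symmetric] by (intro order.trans[OF abs_triangle_ineq] add_mono)
    then show "\<bar>F s x\<bar> \<le> M1 * w (2 * m) x" by (simp add: M1_def algebra_simps)
  qed
  have contA: "isCont A t" and contA': "isCont A' t" if "t > 0" for t
    unfolding A_def A'_def using radial_flux_has_derivative[OF that p] isCont_radial_flux'[OF that p]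
    by (auto dest: DERIV_isCont)
  have Am: "(\<lambda>x. A (sq x)) \<in> borel_measurable borel" "(\<lambda>x. A' (sq x)) \<in> borel_measurable borel"
    using cont_comp[OF contA] cont_comp[OF contA']
    by (auto intro: borel_measurable_continuous_countable_exceptions[of "{c}"])
  then have fm: "f \<in> borel_measurable borel" unfolding f_def F_def[abs_def] add_0 by measurable
  have fL: "f \<in> Lp q \<Omega>"
  proof -
    have "integrable (lebesgue_on \<Omega>) (\<lambda>x. norm (f x) powr q)"
    proof (rule Bochner_Integration.integrable_bound)
      show "integrable (lebesgue_on \<Omega>) (\<lambda>x. \<bar>M1 * w (2 * m) x\<bar> powr q)"
        using m q by (intro w_int_powr) auto
      show "AE x in lebesgue_on \<Omega>. norm (norm (f x) powr q) \<le> norm (\<bar>M1 * w (2 * m) x\<bar> powr q)"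
        using AEc
      proof eventually_elim
        case (elim x)
        have "norm (f x) \<le> \<bar>M1 * w (2 * m) x\<bar>" using F_bound[OF elim, of 0] by (simp add: f_def)
        then show ?case using q by (auto intro!: powr_mono2)
      qed
    qed (use borel_meas[OF fm] in measurable)
    then show ?thesis using borel_meas[OF fm] by (simp add: Lp_def)
  qed
  \<comment> \<open>For each shift s > 0 the field A (s + sq x) (x - c) is smooth on the whole
    space, so the identity holds with no contribution from c. The majorants do not depend on s and
    are integrable by 2 m < n, hence the identity survives s tending to 0.\<close>
  have eqn: "(LINT x|lebesgue_on \<Omega>. f x * \<phi> x + A (sq x) * ((x - c) \<bullet> grad \<phi> x)) = 0"
    and int: "integrable (lebesgue_on \<Omega>) (\<lambda>x. f x * \<phi> x)"
      "integrable (lebesgue_on \<Omega>) (\<lambda>x. A (sq x) * ((x - c) \<bullet> grad \<phi> x))"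
    if \<phi>: "\<phi> \<in> test_functions \<Omega>" for \<phi>
  proof -
    obtain K where K: "compact K" "K \<subseteq> \<Omega>" "\<And>x. x \<notin> K \<Longrightarrow> \<phi> x = 0" "\<And>x. x \<notin> K \<Longrightarrow> grad \<phi> x = 0"
      using test_functionE[OF \<phi>] by blast
    note cont = test_function_continuous[OF \<phi>] test_function_continuous_grad[OF \<phi>]
    have [measurable]: "\<phi> \<in> borel_measurable borel" "grad \<phi> \<in> borel_measurable borel"
      using cont by (auto intro: borel_measurable_continuous_onI)
    obtain B1 where B1: "B1 > 0" "\<And>x. norm (\<phi> x) \<le> B1" using compact_support_bounded[OF cont(1) K(1,3)] by blast
    obtain B2 where B2: "B2 > 0" "\<And>x. norm (grad \<phi> x) \<le> B2" using compact_support_bounded[OF cont(2) K(1,4)] by blast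
    define I where "I s x = F s x * \<phi> x + A (s + sq x) * ((x - c) \<bullet> grad \<phi> x)" for s x
    have bd1: "\<bar>F s x * \<phi> x\<bar> \<le> (M1 * B1) * w (2 * m) x" if "x \<noteq> c" "s \<ge> 0" for s x
      using mult_mono[OF F_bound[OF that] B1(2)[of x]] order.trans[OF abs_ge_zero F_bound[OF that]]
      by (simp add: abs_mult mult_ac)
    have bd2: "\<bar>A (s + sq x) * ((x - c) \<bullet> grad \<phi> x)\<bar> \<le> (M0 * (d * B2)) * w (2 * m) x" if "x \<noteq> c" "s \<ge> 0" for s x
    proof (cases "x \<in> cball c d")
      case True
      have "\<bar>(x - c) \<bullet> grad \<phi> x\<bar> \<le> norm (x - c) * norm (grad \<phi> x)" by (rule Cauchy_Schwarz_ineq2)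
      also have "\<dots> \<le> d * B2" using True B2 d by (intro mult_mono) (auto simp: dist_norm norm_minus_commute)
      finally have "\<bar>A (s + sq x)\<bar> * \<bar>(x - c) \<bullet> grad \<phi> x\<bar> \<le> (M0 * w (2 * m) x) * (d * B2)"
        using A_bound[OF that] order.trans[OF abs_ge_zero A_bound[OF that]] by (intro mult_mono) auto
      then show ?thesis by (simp add: abs_mult mult_ac)
    next
      case False
      then have "A (s + sq x) = 0" using sq_out[OF False] that radial_flux_eq_0(1)[of R "s + sq x" p \<beta>] p by (simp add: A_def)
      then show ?thesis using w0 d B2 by (simp add: M0_def)
    qed
    have int_I: "(LINT x|lborel. I s x) = 0" "I s \<in> borel_measurable borel" if s: "s > 0" for s
    proof -
      have pos: "s + sq x > 0" for x using s sq0[of x] by simp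
      have CkA: "Ck k (\<lambda>x. A (s + sq x))" for k unfolding A_def by (intro Ck_radial_flux pos Ck_sq)
      \<comment> \<open>The component along b of the test function times the shifted field. Summing
        the derivative of each component in its own direction gives the divergence, whose integral
        is 0.\<close>
      define \<psi> where "\<psi> b x = A (s + sq x) * \<phi> x * (x \<bullet> b - c \<bullet> b)" for b x
      have Ck\<psi>: "Ck k (\<psi> b)" for k b
        unfolding \<psi>_def[abs_def] by (intro Ck_mult CkA test_functions_Ck[OF \<phi>] Ck_diff Ck_inner Ck_const)
      have dA: "((\<lambda>x. A (s + sq x)) has_derivative (\<lambda>h. A' (s + sq x) * (2 * ((x - c) \<bullet> h)))) (at x)" for x
        using has_derivative_compose[OF dsq radial_flux_has_derivative[OF pos p, unfolded has_field_derivative_def]]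
        by (simp add: A_def A'_def)
      define G where "G b x = (A' (s + sq x) * 2 * \<phi> x * (x \<bullet> b - c \<bullet> b)) *\<^sub>R (x - c)
          + (A (s + sq x) * (x \<bullet> b - c \<bullet> b)) *\<^sub>R grad \<phi> x + (A (s + sq x) * \<phi> x) *\<^sub>R b" for b x
      have d\<psi>: "(\<psi> b has_derivative (\<lambda>h. G b x \<bullet> h)) (at x)" for b x
      proof -
        have "((\<lambda>x. x \<bullet> b - c \<bullet> b) has_derivative (\<lambda>h. h \<bullet> b)) (at x)"
          by (auto intro!: derivative_eq_intros)
        from has_derivative_mult[OF has_derivative_mult[OF dA test_function_has_gradient[OF \<phi>]] this]
        show ?thesis unfolding \<psi>_def[abs_def]
          by (rule has_derivative_eq_rhs) (simp add: G_def fun_eq_iff inner_add_left algebra_simps inner_commute[of b])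
      qed
      have gG: "grad (\<psi> b) = G b" for b using grad_eqI[OF d\<psi>] by auto
      have cG: "continuous_on UNIV (G b)" for b
        using Ck_has_gradient(2)[OF Ck\<psi>, of b] unfolding gG .
      have G0: "G b x = 0" if "x \<notin> K" for b x using K(3,4)[OF that] by (simp add: G_def)
      have iG: "integrable lborel (G b)" for b
        by (rule integrable_lborel_compact_support[OF cG K(1) G0])
      have "(LINT x|lborel. G b x) = 0" for b
        by (rule integral_gradient_eq_0[OF d\<psi> cG K(1) _ G0]) (simp add: \<psi>_def K(3))
      then have "(LINT x|lborel. G b x \<bullet> b) = 0" for b
        using integral_inner_left[of b lborel "G b"] iG by simp
      then have "(LINT x|lborel. (\<Sum>b\<in>Basis. G b x \<bullet> b)) = 0"
        using iG by (subst Bochner_Integration.integral_sum) auto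
      moreover have "(\<Sum>b\<in>Basis. G b x \<bullet> b) = I s x" for x
      proof -
        have 1: "(\<Sum>b\<in>Basis. (x \<bullet> b - c \<bullet> b) * (y \<bullet> b)) = (x - c) \<bullet> y" for y
          by (subst euclidean_inner[of "x - c" y]) (simp add: inner_diff_left)
        have "(\<Sum>b\<in>Basis. G b x \<bullet> b) = (\<Sum>b\<in>Basis. A' (s + sq x) * 2 * \<phi> x * ((x \<bullet> b - c \<bullet> b) * ((x - c) \<bullet> b))
          + A (s + sq x) * ((x \<bullet> b - c \<bullet> b) * (grad \<phi> x \<bullet> b)) + A (s + sq x) * \<phi> x)"
          by (intro sum.cong) (auto simp: G_def inner_add_left)
        also have "\<dots> = A' (s + sq x) * 2 * \<phi> x * sq x + A (s + sq x) * ((x - c) \<bullet> grad \<phi> x) + n * (A (s + sq x) * \<phi> x)"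
          unfolding sum.distrib sum_distrib_left[symmetric] 1 by (simp add: n_def sq_def)
        finally show ?thesis by (simp add: I_def F_def algebra_simps)
      qed
      ultimately show "(LINT x|lborel. I s x) = 0" by simp
      have "(\<lambda>x. \<Sum>b\<in>Basis. G b x \<bullet> b) \<in> borel_measurable borel"
        using iG by (intro borel_measurable_sum borel_measurable_inner) auto
      then show "I s \<in> borel_measurable borel" using \<open>\<And>x. (\<Sum>b\<in>Basis. G b x \<bullet> b) = I s x\<close> by simp
    qed
    have I_out: "I s x = 0" if "x \<notin> \<Omega>" for s x
    proof -
      have "x \<notin> K" using that K(2) by blast
      then show ?thesis using K(3,4) by (simp add: I_def)
    qed
    have z: "(LINT x|lebesgue_on \<Omega>. I (e i) x) = 0" for i
      using int_I[OF e[of i]] lebesgue_on_eq_lborel(1)[OF \<Omega>s, of "I (e i)"] I_out by simp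
    have I0m: "I 0 \<in> borel_measurable borel"
      unfolding I_def add_0 using fm Am unfolding f_def by measurable
    have "(\<lambda>i. LINT x|lebesgue_on \<Omega>. I (e i) x) \<longlonglongrightarrow> (LINT x|lebesgue_on \<Omega>. I 0 x)"
    proof (rule integral_dominated_convergence)
      show "integrable (lebesgue_on \<Omega>) (\<lambda>x. (M1 * B1) * w (2 * m) x + (M0 * (d * B2)) * w (2 * m) x)"
        using w_int[OF m(1,3)] by simp
      show "AE x in lebesgue_on \<Omega>. (\<lambda>i. I (e i) x) \<longlonglongrightarrow> I 0 x"
        using AEc unfolding I_def F_def
      proof eventually_elim
        case (elim x)
        then have t: "sq x > 0" using sq_pos by simp
        show ?case
          by (intro tendsto_intros isCont_tendsto_compose[of "0 + sq x" A] isCont_tendsto_compose[of "0 + sq x" A'] e0 contA contA')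
            (use t in auto)
      qed
      show "AE x in lebesgue_on \<Omega>. norm (I (e i) x) \<le> (M1 * B1) * w (2 * m) x + (M0 * (d * B2)) * w (2 * m) x" for i
        using AEc
      proof eventually_elim
        case (elim x)
        show ?case unfolding I_def real_norm_def
          using bd1[OF elim less_imp_le[OF e]] bd2[OF elim less_imp_le[OF e]]
          by (intro order.trans[OF abs_triangle_ineq] add_mono)
      qed
    qed (use borel_meas[OF I0m] borel_meas[OF int_I(2)[OF e]] in auto)
    then have "(LINT x|lebesgue_on \<Omega>. I 0 x) = 0" unfolding z by (simp add: LIMSEQ_const_iff)
    then show "(LINT x|lebesgue_on \<Omega>. f x * \<phi> x + A (sq x) * ((x - c) \<bullet> grad \<phi> x)) = 0"
      by (simp add: I_def f_def)
    show "integrable (lebesgue_on \<Omega>) (\<lambda>x. f x * \<phi> x)"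
    proof (rule Bochner_Integration.integrable_bound)
      show "integrable (lebesgue_on \<Omega>) (\<lambda>x. (M1 * B1) * w (2 * m) x)" using w_int[OF m(1,3)] by simp
      show "(\<lambda>x. f x * \<phi> x) \<in> borel_measurable (lebesgue_on \<Omega>)"
        by (rule borel_meas) (use fm in measurable)
      show "AE x in lebesgue_on \<Omega>. norm (f x * \<phi> x) \<le> norm ((M1 * B1) * w (2 * m) x)"
        using AEc
      proof eventually_elim
        case (elim x)
        show ?case using bd1[OF elim, of 0] by (simp add: f_def)
      qed
    qed
    show "integrable (lebesgue_on \<Omega>) (\<lambda>x. A (sq x) * ((x - c) \<bullet> grad \<phi> x))"
    proof (rule Bochner_Integration.integrable_bound)
      show "integrable (lebesgue_on \<Omega>) (\<lambda>x. (M0 * (d * B2)) * w (2 * m) x)" using w_int[OF m(1,3)] by simp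
      show "(\<lambda>x. A (sq x) * ((x - c) \<bullet> grad \<phi> x)) \<in> borel_measurable (lebesgue_on \<Omega>)"
        by (rule borel_meas) (use Am in measurable)
      show "AE x in lebesgue_on \<Omega>. norm (A (sq x) * ((x - c) \<bullet> grad \<phi> x)) \<le> norm ((M0 * (d * B2)) * w (2 * m) x)"
        using AEc
      proof eventually_elim
        case (elim x)
        show ?case using bd2[OF elim, of 0] by simp
      qed
    qed
  qed
  have sol: "weak_solution p \<Omega> f u"
    unfolding weak_solution_def
  proof (intro conjI uW ballI)
    fix \<phi> assume \<phi>: "\<phi> \<in> test_functions \<Omega>"
    have [measurable]: "grad \<phi> \<in> borel_measurable (lebesgue_on \<Omega>)"
      by (rule continuous_measurable_lebesgue_on[OF test_function_continuous_grad[OF \<phi>]])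
    have [measurable]: "weak_grad \<Omega> u \<in> borel_measurable (lebesgue_on \<Omega>)"
      by (rule has_weak_gradient_measurable(2)[OF \<Omega>(1) weak_grad_works[OF uU]])
    have "(LINT x|lebesgue_on \<Omega>. ((norm (weak_grad \<Omega> u x) powr (p - 2)) *\<^sub>R weak_grad \<Omega> u x) \<bullet> grad \<phi> x)
        = (LINT x|lebesgue_on \<Omega>. - (A (sq x) * ((x - c) \<bullet> grad \<phi> x)))"
    proof (rule integral_cong_AE)
      show "(\<lambda>x. - (A (sq x) * ((x - c) \<bullet> grad \<phi> x))) \<in> borel_measurable (lebesgue_on \<Omega>)"
        using int(2)[OF \<phi>] by simp
      show "AE x in lebesgue_on \<Omega>. ((norm (weak_grad \<Omega> u x) powr (p - 2)) *\<^sub>R weak_grad \<Omega> u x) \<bullet> grad \<phi> x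
          = - (A (sq x) * ((x - c) \<bullet> grad \<phi> x))"
        using weak_grad_AE_eq[OF \<Omega>(1) uU] AEc
      proof eventually_elim
        case (elim x)
        \<comment> \<open>The minus sign makes f, the divergence of A (x - c), equal to minus the
          divergence of the flux of u, as the equation requires.\<close>
        have "(norm (U x) powr (p - 2)) *\<^sub>R U x = - A (sq x) *\<^sub>R (x - c)"
          unfolding U_def b_def A_def sq_def using elim(2) by (intro radial_flux_eq[OF p]) simp
        then show ?case by (simp only: elim(1)) simp
      qed
    qed measurable
    also have "\<dots> = (LINT x|lebesgue_on \<Omega>. f x * \<phi> x)"
      using eqn[OF \<phi>] int[OF \<phi>] by simp
    finally show "(LINT x|lebesgue_on \<Omega>. ((norm (weak_grad \<Omega> u x) powr (p - 2)) *\<^sub>R weak_grad \<Omega> u x) \<bullet> grad \<phi> x)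
        = (LINT x|lebesgue_on \<Omega>. f x * \<phi> x)" .
  qed
  have "u \<notin> Lp r \<Omega>"
  proof
    assume "u \<in> Lp r \<Omega>"
    then have uint: "integrable (lebesgue_on \<Omega>) (\<lambda>x. \<bar>u x\<bar> powr r)" by (simp add: Lp_def)
    define k0 where "k0 = (R / 2) powr (- \<beta> / 2)"
    \<comment> \<open>Half of the constant in the lower bound for the profile; the other half pays
      for the subtracted term k0.\<close>
    define \<kappa> where "\<kappa> = bump_exp (R / 2) / \<beta>"
    have k0: "k0 > 0" using R by (simp add: k0_def)
    have \<kappa>: "\<kappa> > 0" using R \<beta> by (simp add: \<kappa>_def bump_exp_pos_iff)
    \<comment> \<open>The first entry makes \<open>norm (x - c) powr (-\<beta>)\<close> at least 2
      k0, so subtracting k0 loses at most half; the second keeps \<open>sq x\<close> at most R/2,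
      where the lower bound holds.\<close>
    define \<delta> where "\<delta> = min ((2 * k0) powr (- 1 / \<beta>)) (sqrt (R / 2))"
    have \<delta>: "\<delta> > 0" using k0 R by (simp add: \<delta>_def)
    have in_ball: "x \<in> cball c d" "\<kappa> * norm (x - c) powr (- \<beta>) \<le> u x" if x: "x \<in> ball c \<delta>" "x \<noteq> c" for x
    proof -
      have nx: "norm (x - c) < \<delta>" "norm (x - c) > 0" using x by (auto simp: dist_norm norm_minus_commute)
      have "norm (x - c) < sqrt (R / 2)" using nx by (simp add: \<delta>_def)
      then have "norm (x - c) * norm (x - c) \<le> sqrt (R / 2) * sqrt (R / 2)" using R by (intro mult_mono) auto
      then have sqR: "sq x \<le> R / 2" using R by (simp add: sq_norm power2_eq_square)
      show "x \<in> cball c d"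
      proof (rule ccontr)
        assume "x \<notin> cball c d"
        from sq_out[OF this] sqR R show False by simp
      qed
      have "norm (x - c) \<le> (2 * k0) powr (- 1 / \<beta>)" using nx by (simp add: \<delta>_def)
      then have "((2 * k0) powr (- 1 / \<beta>)) powr (- \<beta>) \<le> norm (x - c) powr (- \<beta>)"
        using nx \<beta> by (intro powr_mono2') auto
      then have "2 * k0 \<le> norm (x - c) powr (- \<beta>)" using k0 \<beta> by (simp add: powr_powr)
      then have "norm (x - c) powr (- \<beta>) \<le> 2 * (norm (x - c) powr (- \<beta>) - k0)" by simp
      from mult_left_mono[OF this less_imp_le[OF \<kappa>]]
      have "\<kappa> * norm (x - c) powr (- \<beta>) \<le> \<kappa> * (2 * (norm (x - c) powr (- \<beta>) - k0))" .
      also have "\<dots> = bump_exp (R / 2) * (2 / \<beta>) * (norm (x - c) powr (- \<beta>) - k0)"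
        by (simp add: \<kappa>_def)
      also have "\<dots> \<le> u x"
        using radial_profile_bounds(3)[OF R \<beta> _ sqR] sq_pos[of x] x(2)
        by (simp add: u_def B_def k0_def sq_powr)
      finally show "\<kappa> * norm (x - c) powr (- \<beta>) \<le> u x" .
    qed
    define h where "h x = indicator (ball c \<delta>) x * norm (x - c) powr (- n)" for x
    have hb: "h \<in> borel_measurable borel"
      unfolding h_def[abs_def] by (intro borel_measurable_times borel_measurable_indicator) auto
    have "integrable (lebesgue_on \<Omega>) h"
    proof (rule Bochner_Integration.integrable_bound)
      show "integrable (lebesgue_on \<Omega>) (\<lambda>x. \<kappa> powr (- r) * \<bar>u x\<bar> powr r)" using uint by simp
      have "\<bar>h x\<bar> \<le> \<kappa> powr (- r) * \<bar>u x\<bar> powr r" for x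
      proof (cases "x \<in> ball c \<delta> \<and> x \<noteq> c")
        case True
        then have "\<kappa> * norm (x - c) powr (- \<beta>) \<le> \<bar>u x\<bar>" using in_ball(2)[of x] by linarith
        then have "(\<kappa> * norm (x - c) powr (- \<beta>)) powr r \<le> \<bar>u x\<bar> powr r"
          using \<kappa> r by (intro powr_mono2) auto
        moreover have "(\<kappa> * norm (x - c) powr (- \<beta>)) powr r = \<kappa> powr r * norm (x - c) powr (- n)"
          using \<kappa> r by (simp add: powr_mult powr_powr \<beta>_def)
        ultimately have "\<kappa> powr (- r) * (\<kappa> powr r * norm (x - c) powr (- n)) \<le> \<kappa> powr (- r) * \<bar>u x\<bar> powr r"
          by (intro mult_left_mono) auto
        moreover have "\<kappa> powr (- r) * \<kappa> powr r = 1" using \<kappa> by (simp add: powr_minus)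
        ultimately show ?thesis using True by (simp add: h_def mult.assoc[symmetric])
      qed (auto simp: h_def)
      then show "AE x in lebesgue_on \<Omega>. norm (h x) \<le> norm (\<kappa> powr (- r) * \<bar>u x\<bar> powr r)"
        by (intro AE_I2) (auto intro: order.trans[OF _ abs_ge_self])
    qed (rule borel_meas[OF hb])
    moreover have "h x = 0" if "x \<notin> \<Omega>" for x
    proof (cases "x \<in> ball c \<delta> \<and> x \<noteq> c")
      case True
      then show ?thesis using in_ball(1)[of x] that d by blast
    qed (auto simp: h_def)
    ultimately have "integrable lborel h"
      using lebesgue_on_eq_lborel(2)[OF \<Omega>s hb] by blast
    then show False using not_integrable_norm_powr_dim[OF \<delta>, of c] by (simp add: h_def[abs_def] n_def)
  qed
  with fL sol show ?thesis by blast
qed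

section \<open>The critical exponents\<close>

theorem theorem1:
  fixes \<Omega> :: "'a::euclidean_space set" and n p q :: real
  assumes n_def: "n = real DIM('a)"
    and dim: "DIM('a) \<ge> 3"
    and domain: "open \<Omega>" "connected \<Omega>" "\<Omega> \<noteq> {}"
    and bounded: "bounded \<Omega>"
    and p: "1 < p" "p < n"
    and q: "q > 1" "q \<ge> n * p / (n * p - n + p)"
  shows
    "(q < n / p \<longrightarrow>
        (\<forall>r. 1 \<le> r \<and> r < (p - 1) * q * n / (n - p * q) \<longrightarrow>
          (\<exists>C. \<forall>f u. f \<in> Lp q \<Omega> \<and> weak_solution p \<Omega> f u \<longrightarrow>
             u \<in> Lp r \<Omega> \<and> Lp_norm r \<Omega> u \<le> C * Lp_norm q \<Omega> f powr (1 / (p - 1))))) \<and>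
     (q < n / p \<longrightarrow>
        (\<forall>r. r > (p - 1) * q * n / (n - p * q) \<longrightarrow>
          (\<exists>f u. f \<in> Lp q \<Omega> \<and> weak_solution p \<Omega> f u \<and> u \<notin> Lp r \<Omega>))) \<and>
     (q = n / p \<longrightarrow>
        (\<forall>r. 1 \<le> r \<longrightarrow>
          (\<exists>C. \<forall>f u. f \<in> Lp q \<Omega> \<and> weak_solution p \<Omega> f u \<longrightarrow>
             u \<in> Lp r \<Omega> \<and> Lp_norm r \<Omega> u \<le> C * Lp_norm q \<Omega> f powr (1 / (p - 1)))))"
proof (intro conjI impI allI; (elim conjE)?)
  fix r :: real
  have "q > 0" using q by simp
  {
    assume "q < n / p" and r: "1 \<le> r" "r < (p - 1) * q * n / (n - p * q)"
    then have pq: "n - p * q > 0" using p by (simp add: pos_less_divide_eq mult.commute)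
    have "r * (n - p * q) < (p - 1) * q * n"
      using r(2) pq by (simp add: pos_less_divide_eq)
    then have "r * (n / q - p) < n * (p - 1)"
      using \<open>q > 0\<close> by (simp add: field_simps)
    then show "\<exists>C. \<forall>f u. f \<in> Lp q \<Omega> \<and> weak_solution p \<Omega> f u \<longrightarrow>
        u \<in> Lp r \<Omega> \<and> Lp_norm r \<Omega> u \<le> C * Lp_norm q \<Omega> f powr (1 / (p - 1))"
      using r by (intro weak_solution_Lr_bound[OF n_def domain(1) bounded p q(1)]) auto
  }
  {
    assume "q = n / p" and r: "1 \<le> r"
    \<comment> \<open>The condition on r in the estimate becomes 0 < n (p - 1), with no upper limit
      for r.\<close>
    then have "n / q - p = 0" using p by simp
    then show "\<exists>C. \<forall>f u. f \<in> Lp q \<Omega> \<and> weak_solution p \<Omega> f u \<longrightarrow>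
        u \<in> Lp r \<Omega> \<and> Lp_norm r \<Omega> u \<le> C * Lp_norm q \<Omega> f powr (1 / (p - 1))"
      using r p by (intro weak_solution_Lr_bound[OF n_def domain(1) bounded p q(1)]) auto
  }
  {
    assume "q < n / p" and r: "(p - 1) * q * n / (n - p * q) < r"
    then have pq: "n - p * q > 0" using p by (simp add: pos_less_divide_eq mult.commute)
    have "(p - 1) * q * n / (n - p * q) > 0" using p q pq by simp
    with r have r0: "r > 0" by linarith
    have rn: "(p - 1) * q * n < r * (n - p * q)"
      using r pq by (simp add: pos_divide_less_eq)
    obtain c where c: "c \<in> \<Omega>" using domain(3) by blast
    have rq: "q * (n / r * (p - 1) + p) < n"
      using rn r0 by (simp add: field_simps)
    have "n * 1 < n * p" using p by (intro mult_strict_left_mono) auto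
    then have den: "n * p - n + p > 0" using p by linarith
    have "n * p \<le> q * (n * p - n + p)" using q(2) den by (simp add: pos_divide_le_eq)
    have "p * (n / r + 1) < n"
    proof -
      have "n / r * (q * (p - 1)) < n - p * q" using rn r0 by (simp add: field_simps)
      \<comment> \<open>An equivalent form of the lower bound on q: the difference of the two sides
        is q (n p - n + p) - n p. It turns a condition on r that places f in its space into the one
        that places the gradient in the space with exponent p.\<close>
      moreover have "p * (n - p * q) \<le> (n - p) * (q * (p - 1))"
        using \<open>n * p \<le> q * (n * p - n + p)\<close> by (simp add: algebra_simps)
      ultimately have "p * (n / r * (q * (p - 1))) < (n - p) * (q * (p - 1))"
        using p by (smt (verit) mult_less_cancel_left_pos)
      then have "(p * (n / r)) * (q * (p - 1)) < (n - p) * (q * (p - 1))" by (simp only: mult.assoc)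
      moreover have "q * (p - 1) > 0" using p \<open>q > 0\<close> by simp
      ultimately have "p * (n / r) < n - p" by (rule mult_right_less_imp_less[OF _ less_imp_le])
      then show ?thesis by (simp add: distrib_left)
    qed
    then show "\<exists>f u. f \<in> Lp q \<Omega> \<and> weak_solution p \<Omega> f u \<and> u \<notin> Lp r \<Omega>"
      using radial_example[OF domain(1) bounded c p(1) q(1) r0] rq by (simp add: n_def)
  }
qed

end
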